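(* There exists $\alpha_0>0$ such that for every $\alpha\in(0,\alpha_0)$ (with no assumption on the remainder $r(\alpha)$), the extremal front $\mathcal F(\alpha,(k_M-1)\pi)$ is optimal, i.e. $\mathcal F(\alpha,(k_M-1)\pi)=OF(\alpha,(k_M-1)\pi)$.
   Context: For $\alpha\in(0,\pi/4)$ set $$F=\begin{pmatrix}0&-\cos\alpha&0\\ \cos\alpha&0&0\\0&0&0\end{pmatrix},\quad G=\begin{pmatrix}0&0&0\\0&0&-\sin\alpha\\0&\sin\alpha&0\end{pmatrix},\quad X_\pm=F\pm G,\quad N=(0,0,1)^T,$$ and let $(\Sigma)_\alpha$ be the system $\dot x=(F+uG)x$ on $S^2$, with measurable controls $|u|\le1$. Put $k_M=[\pi/(2\alpha)]$ (integer part), $r(\alpha)=\pi/(2\alpha)-k_M$, $v(s)=\pi+2\arctan\frac{\sin s}{\cos s+\cot^2\alpha}$. An extremal trajectory is an admissible trajectory starting from $N$ satisfying the Pontryagin Maximum Principle for the minimum time problem. The extremals are the bang-bang trajectories $e^{tX_{\pm}}e^{v(s)X_{\mp}}\cdots e^{v(s)X_{-\varepsilon}}e^{sX_\varepsilon}N$ (alternating signs) with first arc of duration $s\in(0,\pi]$, all interior arcs of duration $v(s)$ and last arc of duration $t\in(0,v(s)]$. $\mathcal F(\alpha,T)$ is the set of points reached at time $T$ by extremal trajectories, and $OF(\alpha,T)$ is the set of points reached at time $T$ by time optimal trajectories from $N$. *)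

theory Defs
  imports "HOL-Analysis.Analysis"
begin

definition F_mat :: "real \<Rightarrow> real ^ 3 ^ 3" where
  "F_mat \<alpha> = vector [vector [0, - cos \<alpha>, 0],
                     vector [cos \<alpha>, 0, 0],
                     vector [0, 0, 0]]"

definition G_mat :: "real \<Rightarrow> real ^ 3 ^ 3" where
  "G_mat \<alpha> = vector [vector [0, 0, 0],
                     vector [0, 0, - sin \<alpha>],
                     vector [0, sin \<alpha>, 0]]"

definition N_pole :: "real ^ 3" where
  "N_pole = vector [0, 0, 1]"

definition k_M :: "real \<Rightarrow> int" where
  "k_M \<alpha> = \<lfloor>pi / (2 * \<alpha>)\<rfloor>"

text \<open>Admissible trajectories on the time interval from 0 to \<open>T\<close>, starting at the north pole, with
  their controls. Solutions are taken in the sense of Caratheodory; since the controlled field is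
  bounded on the sphere, absolutely continuous solutions are the same as Lipschitz ones.\<close>

definition admissible_traj ::
  "real \<Rightarrow> real \<Rightarrow> (real \<Rightarrow> real) \<Rightarrow> (real \<Rightarrow> real ^ 3) \<Rightarrow> bool" where
  "admissible_traj \<alpha> T u x \<longleftrightarrow>
     0 \<le> T \<and>
     u \<in> borel_measurable (lebesgue_on {0..T}) \<and>
     (\<forall>t\<in>{0..T}. \<bar>u t\<bar> \<le> 1) \<and>
     (\<forall>t\<in>{0..T}. x t \<in> sphere 0 1) \<and>
     x 0 = N_pole \<and>
     (\<exists>L. L-lipschitz_on {0..T} x) \<and>
     (AE t in lebesgue_on {0..T}.
        (x has_vector_derivative ((F_mat \<alpha> + u t *\<^sub>R G_mat \<alpha>) *v x t)) (at t within {0..T}))"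

definition pmp_hamiltonian :: "real \<Rightarrow> real ^ 3 \<Rightarrow> real ^ 3 \<Rightarrow> real \<Rightarrow> real" where
  "pmp_hamiltonian \<alpha> x p w = p \<bullet> ((F_mat \<alpha> + w *\<^sub>R G_mat \<alpha>) *v x)"

text \<open>The Pontryagin Maximum Principle for the minimum time problem. A covector at \<open>x\<close> in the
  cotangent space of the sphere is represented by the vector \<open>p\<close> of \<open>real ^ 3\<close> with
  \<open>p \<bullet> x = 0\<close>; without this condition \<open>p = x\<close> would satisfy everything else trivially.
  The equation for \<open>p\<close> is \<open>p' = - \<partial>H/\<partial>x\<close>, with \<open>p\<close> as a row vector.\<close>

definition satisfies_PMP ::
  "real \<Rightarrow> real \<Rightarrow> (real \<Rightarrow> real) \<Rightarrow> (real \<Rightarrow> real ^ 3) \<Rightarrow> bool" where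
  "satisfies_PMP \<alpha> T u x \<longleftrightarrow>
     (\<exists>(p :: real \<Rightarrow> real ^ 3) (p0 :: real).
        p0 \<le> 0 \<and>
        (\<forall>t\<in>{0..T}. p t \<noteq> 0 \<and> p t \<bullet> x t = 0) \<and>
        (\<exists>L. L-lipschitz_on {0..T} p) \<and>
        (AE t in lebesgue_on {0..T}.
           (p has_vector_derivative (- (p t v* (F_mat \<alpha> + u t *\<^sub>R G_mat \<alpha>)))) (at t within {0..T}) \<and>
           pmp_hamiltonian \<alpha> (x t) (p t) (u t) + p0 = 0 \<and>
           (\<forall>w\<in>{-1..1}. pmp_hamiltonian \<alpha> (x t) (p t) w \<le> pmp_hamiltonian \<alpha> (x t) (p t) (u t))))"

definition extremal_traj ::
  "real \<Rightarrow> real \<Rightarrow> (real \<Rightarrow> real) \<Rightarrow> (real \<Rightarrow> real ^ 3) \<Rightarrow> bool" where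
  "extremal_traj \<alpha> T u x \<longleftrightarrow> admissible_traj \<alpha> T u x \<and> satisfies_PMP \<alpha> T u x"

definition time_optimal_traj ::
  "real \<Rightarrow> real \<Rightarrow> (real \<Rightarrow> real) \<Rightarrow> (real \<Rightarrow> real ^ 3) \<Rightarrow> bool" where
  "time_optimal_traj \<alpha> T u x \<longleftrightarrow>
     admissible_traj \<alpha> T u x \<and>
     (\<forall>T' u' x'. admissible_traj \<alpha> T' u' x' \<and> x' T' = x T \<longrightarrow> T \<le> T')"

definition extremal_front :: "real \<Rightarrow> real \<Rightarrow> (real ^ 3) set" where
  "extremal_front \<alpha> T = {x T | u x. extremal_traj \<alpha> T u x}"

definition optimal_front :: "real \<Rightarrow> real \<Rightarrow> (real ^ 3) set" where
  "optimal_front \<alpha> T = {x T | u x. time_optimal_traj \<alpha> T u x}"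

end

(* Undoing the rotation about the first axis that the control generates leaves an equation whose right-hand side
   depends only on the primitive U of the control, and U ranges over the compact set of 1-Lipschitz functions.
   A first variation in U at the points maximizing a linear functional on the reachable set of time T gives the
   maximum principle, and a limiting argument then puts every boundary point of the reachable set on the extremal
   front. Reachable sets of earlier times lie in the interior of later ones. So a point of the front at time T is
   optimal as soon as it is a boundary point of the reachable set of time T, and this holds if the south pole is not
   reachable by time T and no two points of the front lie in the same direction as seen from it.

   In spinor form, the endpoint for the first arc s, at time (k_M - 1) \<pi>, has x_1 + i x_2 equal, up to a sign
   independent of s, to 2 \<kappa> e^(- i s) F(s) with \<kappa> > 0, where F - 1 and its Lipschitz constant in s are
   O(\<alpha>). For small \<alpha> its direction therefore determines s, whatever the remainder r(\<alpha>) is; the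
   extremals starting with the opposite sign fill the other half turn. *)
theory Submission
  imports Defs "HOL-Complex_Analysis.Great_Picard"
begin

section \<open>Linear differential equations\<close>

text \<open>The remainder enters the leading terms only as a scale: \<open>\<kappa>\<close> equals
  (1 + r(\<alpha>)) \<alpha>, hence lies between \<alpha> and 2 \<alpha>, while the planar
  coordinates of the front are known up to O(\<alpha>^2). This lower bound by \<alpha> is what the
  time (k_M - 1) pi provides. The obstacle is the number of interior arcs, about pi / (2 \<alpha>),
  which magnifies the error made on one arc by 1/\<alpha>. Therefore all interior arcs are made
  powers of a single rotation, whose half-angle is \<alpha> + O(\<alpha>^3), so that even the total
  angle is known up to O(\<alpha>^2). Controls are replaced by 1-Lipschitz primitives throughout,
  and three links lead back to measurable controls: an admissible endpoint lies in
  \<open>reach\<close> (\<open>admissible_in_reach\<close>), the endpoint of a trajectory satisfying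
  the maximum principle lies in \<open>front\<close> (\<open>extremal_front_subset\<close>), and
  every point of \<open>front\<close> is such an endpoint
  (\<open>front_subset_extremal_front\<close>).\<close>

definition antideriv :: "(real \<Rightarrow> 'a::banach) \<Rightarrow> real \<Rightarrow> 'a" where
  "antideriv h t = integral {0..t} h - integral {t..0} h"

lemma antideriv_has_vector_derivative:
  fixes h :: "real \<Rightarrow> 'a::banach"
  assumes "continuous_on UNIV h"
  shows "(antideriv h has_vector_derivative h t) (at t)"
proof -
  define r where "r = \<bar>t\<bar> + 1"
  have int: "h integrable_on {a..b}" for a b
    by (meson assms continuous_on_subset integrable_continuous_real subset_UNIV)
  \<comment> \<open>One of the two integrals in \<open>antideriv\<close> always runs over an empty
    interval or a point. Starting at -r, left of both 0 and u, turns their difference into one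
    indefinite integral.\<close>
  have eq: "integral {-r..u} h - integral {-r..0} h = antideriv h u" if "u \<in> {-r<..<r}" for u
  proof (cases "0 \<le> u")
    case True
    then have "integral {-r..0} h + integral {0..u} h = integral {-r..u} h"
      by (intro Henstock_Kurzweil_Integration.integral_combine int) (auto simp: r_def)
    moreover have "integral {u..0} h = 0"
      using True by (cases "u = 0") auto
    ultimately show ?thesis by (simp add: antideriv_def algebra_simps)
  next
    case False
    then have "integral {-r..u} h + integral {u..0} h = integral {-r..0} h"
      using that by (intro Henstock_Kurzweil_Integration.integral_combine int) (auto simp: r_def)
    with False show ?thesis by (simp add: antideriv_def algebra_simps)
  qed
  have "t \<in> {-r..r}" by (auto simp: r_def)
  then have "((\<lambda>u. integral {-r..u} h) has_vector_derivative h t) (at t within {-r..r})"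
    by (intro integral_has_vector_derivative continuous_on_subset[OF assms]) auto
  then have "((\<lambda>u. integral {-r..u} h) has_vector_derivative h t) (at t)"
    by (subst (asm) at_within_Icc_at) (auto simp: r_def)
  then have "((\<lambda>u. integral {-r..u} h - integral {-r..0} h) has_vector_derivative h t) (at t)"
    by (auto intro!: derivative_eq_intros)
  then show ?thesis
    by (rule has_vector_derivative_transform_within_open[where S = "{-r<..<r}"])
       (use eq in \<open>auto simp: r_def\<close>)
qed

lemma antideriv_diff:
  fixes h k :: "real \<Rightarrow> 'a::banach"
  assumes "continuous_on UNIV h" "continuous_on UNIV k"
  shows "antideriv h t - antideriv k t = antideriv (\<lambda>s. h s - k s) t"
proof -
  have int: "h integrable_on {a..b}" "k integrable_on {a..b}" for a b
    by (meson assms continuous_on_subset integrable_continuous_real subset_UNIV)+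
  show ?thesis
    by (simp add: antideriv_def Henstock_Kurzweil_Integration.integral_diff[OF int])
qed

text \<open>The gain of the factor 1/l makes the Picard map a contraction as soon as l exceeds the
  growth constant of the field.\<close>

lemma norm_antideriv_le:
  fixes h :: "real \<Rightarrow> 'a::banach"
  assumes h: "continuous_on UNIV h" and "0 < l"
    and le: "\<And>t. norm (h t) \<le> C * exp (l * \<bar>t\<bar>)"
  shows "norm (antideriv h t) \<le> C / l * exp (l * \<bar>t\<bar>)"
proof -
  have "0 \<le> C" using le[of 0] by (simp add: order_trans[OF norm_ge_zero])
  have int: "h integrable_on {a..b}" for a b
    by (meson assms continuous_on_subset integrable_continuous_real subset_UNIV)
  show ?thesis
  proof (cases "0 \<le> t")
    case True
    have I: "((\<lambda>s. C * exp (l * s)) has_integral (C / l * exp (l * t) - C / l * exp (l * 0))) {0..t}"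
      by (rule fundamental_theorem_of_calculus)
         (use True \<open>0 < l\<close> in \<open>auto intro!: derivative_eq_intros simp flip: has_real_derivative_iff_has_vector_derivative\<close>)
    have "antideriv h t = integral {0..t} h" 
      using True by (cases "t = 0") (auto simp: antideriv_def)
    also have "norm \<dots> \<le> integral {0..t} (\<lambda>s. C * exp (l * s))"
      using I le by (intro integral_norm_bound_integral int) (auto simp: has_integral_iff abs_of_nonneg dest: spec, metis abs_of_nonneg)
    also have "\<dots> \<le> C / l * exp (l * \<bar>t\<bar>)"
      using I True \<open>0 < l\<close> \<open>0 \<le> C\<close> by (simp add: has_integral_iff)
    finally show ?thesis .
  next
    case False
    have I: "((\<lambda>s. C * exp (l * (-s))) has_integral (- (C / l * exp (l * (-0))) - (- (C / l * exp (l * (-t)))))) {t..0}"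
      by (rule fundamental_theorem_of_calculus)
         (use False \<open>0 < l\<close> in \<open>auto intro!: derivative_eq_intros simp flip: has_real_derivative_iff_has_vector_derivative\<close>)
    have "norm (antideriv h t) = norm (integral {t..0} h)" 
      using False by (auto simp: antideriv_def)
    also have "\<dots> \<le> integral {t..0} (\<lambda>s. C * exp (l * (-s)))"
    proof (intro integral_norm_bound_integral int)
      show "norm (h x) \<le> C * exp (l * - x)" if "x \<in> {t..0}" for x
        using le[of x] that by (simp add: abs_of_nonpos)
    qed (use I in \<open>auto simp: has_integral_iff\<close>)
    also have "\<dots> \<le> C / l * exp (l * \<bar>t\<bar>)"
      using I False \<open>0 < l\<close> \<open>0 \<le> C\<close> by (simp add: has_integral_iff)
    finally show ?thesis .
  qed
qed

(* Picard iteration contracts in the norm sup exp (- 2 K |t|) |y t|. *)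
lemma linear_ode_solution_exists:
  fixes f :: "real \<Rightarrow> 'a::banach \<Rightarrow> 'a"
  assumes cont: "\<And>y. continuous_on UNIV y \<Longrightarrow> continuous_on UNIV (\<lambda>t. f t (y t))"
    and lin: "\<And>t. linear (f t)" and "0 < K" and bound: "\<And>t x. norm (f t x) \<le> K * norm x"
  obtains y where "y 0 = y0" "\<And>t. (y has_vector_derivative f t (y t)) (at t)"
proof -
  define l where "l = 2 * K"
  have "0 < l" using \<open>0 < K\<close> by (simp add: l_def)
  \<comment> \<open>The fixed point is sought among bounded continuous g, with y = exp (l |t|) g;
    this gives a solution on the whole line at once.\<close>
  define h where "h g t = f t (exp (l * \<bar>t\<bar>) *\<^sub>R apply_bcontfun g t)" for g t
  have h: "continuous_on UNIV (h g)" for g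
    unfolding h_def by (intro cont continuous_intros) auto
  have hd: "h g t - h g' t = h (g - g') t" for g g' t
    by (simp add: h_def scaleR_diff_right flip: linear_diff[OF lin])
  have hb: "norm (h g t) \<le> K * norm g * exp (l * \<bar>t\<bar>)" for g t
  proof -
    have "norm (h g t) \<le> K * norm (exp (l * \<bar>t\<bar>) *\<^sub>R apply_bcontfun g t)"
      unfolding h_def by (rule bound)
    also have "\<dots> \<le> K * (exp (l * \<bar>t\<bar>) * norm g)"
      using \<open>0 < K\<close> by (intro mult_left_mono) (auto simp: norm_bounded)
    finally show ?thesis by (simp add: mult_ac)
  qed
  have Jb: "norm (antideriv (h g) t) \<le> norm g / 2 * exp (l * \<bar>t\<bar>)" for g t
    using norm_antideriv_le[OF h \<open>0 < l\<close> hb] \<open>0 < K\<close> by (simp add: l_def)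
  have Jc: "continuous_on UNIV (antideriv (h g))" for g
    using antideriv_has_vector_derivative[OF h] 
    by (meson continuous_at_imp_continuous_on has_vector_derivative_continuous)
  define \<Phi> where "\<Phi> g = Bcontfun (\<lambda>t. exp (- l * \<bar>t\<bar>) *\<^sub>R (y0 + antideriv (h g) t))" for g
  have app: "apply_bcontfun (\<Phi> g) t = exp (- l * \<bar>t\<bar>) *\<^sub>R (y0 + antideriv (h g) t)" for g t
  proof -
    have "(\<lambda>t. exp (- l * \<bar>t\<bar>) *\<^sub>R (y0 + antideriv (h g) t)) \<in> bcontfun"
    proof (rule bcontfun_normI[where b = "norm y0 + norm g / 2"])
      show "continuous_on UNIV (\<lambda>t. exp (- l * \<bar>t\<bar>) *\<^sub>R (y0 + antideriv (h g) t))"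
        by (intro continuous_intros Jc)
      fix t
      have "norm (y0 + antideriv (h g) t) \<le> norm y0 + norm g / 2 * exp (l * \<bar>t\<bar>)"
        using norm_triangle_le[OF add_left_mono[OF Jb]] by blast
      also have "\<dots> \<le> (norm y0 + norm g / 2) * exp (l * \<bar>t\<bar>)"
        using \<open>0 < l\<close> mult_left_mono[of 1 "exp (l * \<bar>t\<bar>)" "norm y0"] by (simp add: algebra_simps)
      finally show "norm (exp (- l * \<bar>t\<bar>) *\<^sub>R (y0 + antideriv (h g) t)) \<le> norm y0 + norm g / 2"
        unfolding norm_scaleR by (simp add: exp_minus field_simps)
    qed
    then show ?thesis by (simp add: \<Phi>_def Bcontfun_inverse)
  qed
  have "\<exists>!g. \<Phi> g = g"
  proof (rule banach_fix_type[where c = "1/2"]; (intro allI)?)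
    fix g g'
    have "norm (apply_bcontfun (\<Phi> g - \<Phi> g') t) \<le> 1/2 * norm (g - g')" for t
    proof -
      have "apply_bcontfun (\<Phi> g - \<Phi> g') t = exp (- l * \<bar>t\<bar>) *\<^sub>R antideriv (h (g - g')) t"
        using antideriv_diff[OF h h, of g t g'] by (simp add: app hd algebra_simps)
      then show ?thesis
        using Jb[of "g - g'" t] by (simp add: exp_minus field_simps)
    qed
    then show "dist (\<Phi> g) (\<Phi> g') \<le> 1/2 * dist g g'"
      unfolding dist_norm by (rule norm_bound)
  qed auto
  then obtain g where g: "\<Phi> g = g" by blast
  define y where "y t = exp (l * \<bar>t\<bar>) *\<^sub>R apply_bcontfun g t" for t
  have y: "y t = y0 + antideriv (h g) t" for t
    using app[of g t] by (simp add: y_def g exp_minus)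
  show thesis
  proof
    show "y 0 = y0" by (simp add: y antideriv_def)
    fix t
    have "((\<lambda>t. y0 + antideriv (h g) t) has_vector_derivative h g t) (at t)"
      using antideriv_has_vector_derivative[OF h] by (auto intro!: derivative_eq_intros)
    then show "(y has_vector_derivative f t (y t)) (at t)"
      unfolding y[abs_def] by (simp add: h_def y_def[symmetric] y)
  qed
qed

section \<open>Rotations\<close>

unbundle cross3_syntax

definition rotx :: "real \<Rightarrow> real^3 \<Rightarrow> real^3" where
  "rotx p x = vector [x$1, cos p * x$2 - sin p * x$3, sin p * x$2 + cos p * x$3]"

text \<open>The rotation axis of F, the third basis vector, turned by -p about the first axis: the
  drift as seen in the frame that rotates with the control.\<close>

definition drift_axis :: "real \<Rightarrow> real^3" where
  "drift_axis p = vector [0, sin p, cos p]"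

lemma rotx_nth [simp]:
  "rotx p x $ 1 = x$1" "rotx p x $ 2 = cos p * x$2 - sin p * x$3" "rotx p x $ 3 = sin p * x$2 + cos p * x$3"
  by (simp_all add: rotx_def)

lemma drift_axis_nth [simp]: "drift_axis p $ 1 = 0" "drift_axis p $ 2 = sin p" "drift_axis p $ 3 = cos p"
  by (simp_all add: drift_axis_def)

lemma inner3: "(x::real^3) \<bullet> y = x$1 * y$1 + x$2 * y$2 + x$3 * (y$3::real)"
  by (simp add: inner_vec_def sum_3)

lemma eq3_iff: "(x::real^3) = y \<longleftrightarrow> x$1 = y$1 \<and> x$2 = y$2 \<and> x$3 = (y$3::real)"
  by (simp add: vec_eq_iff forall_3)

lemma norm3_sq: "(norm (x::real^3))\<^sup>2 = (x$1)\<^sup>2 + (x$2)\<^sup>2 + (x$3)\<^sup>2"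
  unfolding power2_norm_eq_inner inner3 by (simp add: power2_eq_square)

lemma rotx_0 [simp]: "rotx 0 x = x"
  by (simp add: eq3_iff)

lemma linear_rotx: "linear (rotx p)"
  by (rule linearI) (auto simp: eq3_iff algebra_simps)

lemma rotx_rotx: "rotx p (rotx q x) = rotx (p + q) x"
  by (simp add: eq3_iff cos_add sin_add algebra_simps)

lemma inner_rotx: "rotx p x \<bullet> rotx p y = x \<bullet> y"
proof -
  have "rotx p x \<bullet> rotx p y = x$1 * y$1 + (x$2 * y$2 + x$3 * y$3) * ((sin p)\<^sup>2 + (cos p)\<^sup>2)"
    unfolding inner3 rotx_nth by algebra
  then show ?thesis by (simp add: inner3)
qed

lemma inner_rotx_left: "rotx p x \<bullet> y = x \<bullet> rotx (- p) y"
  by (simp add: inner3 algebra_simps)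

lemma norm_rotx [simp]: "norm (rotx p x) = norm x"
  by (simp add: norm_eq_sqrt_inner inner_rotx)

lemma rotx_cross: "rotx p (x \<times> y) = rotx p x \<times> rotx p y"
proof -
  have "rotx p x $ 2 * rotx p y $ 3 - rotx p y $ 2 * rotx p x $ 3
      = (x$2 * y$3 - y$2 * x$3) * ((sin p)\<^sup>2 + (cos p)\<^sup>2)"
    unfolding rotx_nth by (simp only: algebra_simps power2_eq_square)
  also have "\<dots> = rotx p (x \<times> y) $ 1"
    by (simp add: cross_components)
  finally show ?thesis
    unfolding eq3_iff cross_components(1)[of "rotx p x"] by (simp add: cross_components algebra_simps)
qed

lemma rotx_drift_axis: "rotx p (drift_axis q) = drift_axis (q - p)"
  by (simp add: eq3_iff sin_diff cos_diff algebra_simps)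

lemma chord_le_arc: "2 - 2 * cos (x::real) \<le> x\<^sup>2"
proof -
  have "2 - 2 * cos x = (2 * sin (x/2))\<^sup>2"
    using cos_double_sin[of "x/2"] by (simp add: power_mult_distrib)
  also have "\<dots> \<le> x\<^sup>2"
    using abs_sin_x_le_abs_x[of "x/2"] by (intro abs_le_square_iff[THEN iffD1]) (simp add: abs_mult)
  finally show ?thesis .
qed

lemma norm_rotx_diff_le: "norm (rotx p x - rotx q x) \<le> \<bar>p - q\<bar> * norm x"
proof (rule power2_le_imp_le)
  have "(norm (rotx p x - rotx q x))\<^sup>2 = (2 - 2 * cos (p - q)) * ((x$2)\<^sup>2 + (x$3)\<^sup>2)"
  proof -
    have "(c * u - s * v - (c' * u - s' * v))\<^sup>2 + (s * u + c * v - (s' * u + c' * v))\<^sup>2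
        = (s\<^sup>2 + c\<^sup>2 + (s'\<^sup>2 + c'\<^sup>2) - 2 * (c * c' + s * s')) * (u\<^sup>2 + v\<^sup>2)" for c s c' s' u v :: real
      by (simp add: power2_eq_square algebra_simps)
    then have "(norm (rotx p x - rotx q x))\<^sup>2 = ((sin p)\<^sup>2 + (cos p)\<^sup>2 + ((sin q)\<^sup>2 + (cos q)\<^sup>2)
        - 2 * (cos p * cos q + sin p * sin q)) * ((x$2)\<^sup>2 + (x$3)\<^sup>2)"
      unfolding norm3_sq vector_minus_component rotx_nth by (simp only: diff_self power_zero_numeral add_0)
    then show ?thesis by (simp add: cos_diff)
  qed
  also have "\<dots> \<le> (p - q)\<^sup>2 * (norm x)\<^sup>2"
    by (intro mult_mono chord_le_arc) (auto simp: norm3_sq)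
  finally show "(norm (rotx p x - rotx q x))\<^sup>2 \<le> (\<bar>p - q\<bar> * norm x)\<^sup>2"
    by (simp add: power_mult_distrib)
qed simp

lemma norm_drift_axis_diff_le: "norm (drift_axis p - drift_axis q) \<le> \<bar>p - q\<bar>"
proof -
  have "norm (drift_axis 0) = 1"
    by (simp add: norm_eq_sqrt_inner inner3)
  then show ?thesis
    using norm_rotx_diff_le[of "- p" "drift_axis 0" "- q"] by (simp add: rotx_drift_axis)
qed

lemma norm_drift_axis [simp]: "norm (drift_axis p) = 1"
  by (simp add: norm_eq_sqrt_inner inner3 add.commute[of "sin p * sin p"])

lemma norm_cross_le: "norm (x \<times> y) \<le> norm x * norm y"
proof (rule power2_le_imp_le)
  show "(norm (x \<times> y))\<^sup>2 \<le> (norm x * norm y)\<^sup>2"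
    using norm_cross_dot[of x y] by (metis le_add_same_cancel1 zero_le_power2)
qed simp

lemma bounded_bilinear_cross3: "bounded_bilinear (\<times>)"
  using bilinear_cross bilinear_conv_bounded_bilinear by blast

lemma has_vector_derivative_cross:
  assumes "(x has_vector_derivative x') (at t within S)" "(y has_vector_derivative y') (at t within S)"
  shows "((\<lambda>t. x t \<times> y t) has_vector_derivative (x' \<times> y t + x t \<times> y')) (at t within S)"
  using bounded_bilinear.has_vector_derivative[OF bounded_bilinear_cross3 assms] by (simp add: add.commute)

lemma has_real_derivative_inner:
  fixes x y :: "real \<Rightarrow> real^3"
  assumes "(x has_vector_derivative x') (at t within S)" "(y has_vector_derivative y') (at t within S)"
  shows "((\<lambda>t. x t \<bullet> y t) has_real_derivative (x' \<bullet> y t + x t \<bullet> y')) (at t within S)"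
  using bounded_bilinear.has_vector_derivative[OF bounded_bilinear_inner assms]
  by (simp add: add.commute has_real_derivative_iff_has_vector_derivative)

lemma has_vector_derivative_vec3_iff:
  fixes x :: "real \<Rightarrow> real^3"
  shows "(x has_vector_derivative x') (at t within S) \<longleftrightarrow> ((\<lambda>t. x t $ 1) has_vector_derivative x' $ 1) (at t within S) \<and>
    ((\<lambda>t. x t $ 2) has_vector_derivative x' $ 2) (at t within S) \<and> ((\<lambda>t. x t $ 3) has_vector_derivative x' $ 3) (at t within S)"
  unfolding has_vector_derivative_def has_derivative_componentwise_within[of x]
  by (auto simp: Basis_vec_def forall_3 simp flip: cart_eq_inner_axis)

lemma continuous_on_drift_axis: "continuous_on S drift_axis"
  by (rule lipschitz_on_continuous_on[of 1])
     (auto simp: lipschitz_on_def dist_norm norm_drift_axis_diff_le)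

section \<open>Trajectories and reachable sets\<close>

text \<open>The primitives of controls bounded by 1, described without derivatives. The class is
  convex and closed under uniform limits, which the first variation and the compactness argument
  use.\<close>

definition lip1 :: "(real \<Rightarrow> real) \<Rightarrow> bool" where
  "lip1 U \<longleftrightarrow> U 0 = 0 \<and> (\<forall>s t. \<bar>U s - U t\<bar> \<le> \<bar>s - t\<bar>)"

lemma lip1_continuous: "lip1 U \<Longrightarrow> continuous_on S U"
  by (rule lipschitz_on_continuous_on[of 1]) (auto simp: lip1_def lipschitz_on_def dist_real_def)

locale bang =
  fixes \<alpha> :: real
  assumes \<alpha>: "0 < \<alpha>" "\<alpha> < pi / 4"
begin

lemma sin_pos: "0 < sin \<alpha>" and cos_pos: "0 < cos \<alpha>" and sin_less_cos: "sin \<alpha> < cos \<alpha>"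
proof -
  show s: "0 < sin \<alpha>" and c: "0 < cos \<alpha>" using \<alpha> by (auto intro!: sin_gt_zero cos_gt_zero_pi)
  have "tan \<alpha> < 1" using tan_monotone[of \<alpha> "pi/4"] \<alpha> tan_45 by auto
  then show "sin \<alpha> < cos \<alpha>" using c by (simp add: tan_def)
qed

(* With x = rotx (sin \<alpha> * U) y and U the primitive of the control, the control enters
   the equation for y only through U. *)
definition sol :: "(real \<Rightarrow> real) \<Rightarrow> (real \<Rightarrow> real^3) \<Rightarrow> bool" where
  "sol U y \<longleftrightarrow> (\<forall>t. (y has_vector_derivative (cos \<alpha> *\<^sub>R (drift_axis (sin \<alpha> * U t) \<times> y t))) (at t))"

lemma solD: "sol U y \<Longrightarrow> (y has_vector_derivative (cos \<alpha> *\<^sub>R (drift_axis (sin \<alpha> * U t) \<times> y t))) (at t within S)"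
  by (auto simp: sol_def intro: has_vector_derivative_at_within)

lemma sol_continuous: "sol U y \<Longrightarrow> continuous_on S y"
  by (meson continuous_at_imp_continuous_on has_vector_derivative_continuous solD)

text \<open>The field is skew-symmetric at every time, so the flow consists of rotations. In
  particular the adjoint equation is the equation itself.\<close>

lemma sol_inner:
  assumes "sol U y" "sol U z"
  shows "y t \<bullet> z t = y s \<bullet> z s"
proof -
  have "((\<lambda>t. y t \<bullet> z t) has_real_derivative 0) (at t)" for t
    using has_real_derivative_inner[OF solD[OF assms(1)] solD[OF assms(2)], of t UNIV]
    by (simp add: inner3 cross_components algebra_simps)
  then show ?thesis using DERIV_isconst_all[of "\<lambda>t. y t \<bullet> z t" t s] by blast
qed

lemma sol_norm: "sol U y \<Longrightarrow> norm (y t) = norm (y s)"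
  by (simp add: norm_eq_sqrt_inner sol_inner[of U y y t s])

lemma sol_diff:
  assumes "sol U y" "sol U z"
  shows "sol U (\<lambda>t. y t - z t)"
  unfolding sol_def
proof
  fix t
  show "((\<lambda>t. y t - z t) has_vector_derivative
    cos \<alpha> *\<^sub>R (drift_axis (sin \<alpha> * U t) \<times> (y t - z t))) (at t)"
    using has_vector_derivative_diff[OF solD[OF assms(1)] solD[OF assms(2)], of t UNIV]
    by (simp add: Cross3.right_diff_distrib scaleR_diff_right)
qed

lemma sol_scaleR:
  assumes "sol U y"
  shows "sol U (\<lambda>t. k *\<^sub>R y t)"
  unfolding sol_def
proof
  fix t
  show "((\<lambda>t. k *\<^sub>R y t) has_vector_derivative
    cos \<alpha> *\<^sub>R (drift_axis (sin \<alpha> * U t) \<times> (k *\<^sub>R y t))) (at t)"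
    using bounded_linear.has_vector_derivative[OF bounded_linear_scaleR_right[of k] solD[OF assms], of t UNIV]
    by (simp add: cross_mult_right mult.commute)
qed

lemma sol_unique:
  assumes "sol U y" "sol U z" "y s = z s"
  shows "y t = z t"
  using sol_norm[OF sol_diff[OF assms(1,2)], of t s] assms(3) by simp

text \<open>Product rule and Jacobi identity. State and covector thus combine into a third solution,
  whose first component is the switching function.\<close>

lemma sol_cross:
  assumes "sol U y" "sol U z"
  shows "sol U (\<lambda>t. y t \<times> z t)"
  unfolding sol_def
proof
  fix t
  let ?n = "drift_axis (sin \<alpha> * U t)"
  have "(?n \<times> y t) \<times> z t + y t \<times> (?n \<times> z t) = ?n \<times> (y t \<times> z t)"
    unfolding eq3_iff cross_components vector_add_component by (simp add: algebra_simps)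
  then show "((\<lambda>t. y t \<times> z t) has_vector_derivative cos \<alpha> *\<^sub>R (?n \<times> (y t \<times> z t))) (at t)"
    using has_vector_derivative_cross[OF solD[OF assms(1)] solD[OF assms(2)], of t]
    by (simp add: cross_mult_left cross_mult_right flip: scaleR_add_right)
qed

text \<open>Restarts the clock at time a and turns the frame; with p = U a the new primitive starts
  at 0 again. Concatenation of trajectories rests on this.\<close>

lemma sol_shift:
  assumes "sol U y"
  shows "sol (\<lambda>t. U (a + t) - p) (\<lambda>t. rotx (sin \<alpha> * p) (y (a + t)))"
  unfolding sol_def
proof
  fix t
  let ?D = "cos \<alpha> *\<^sub>R (drift_axis (sin \<alpha> * U (a + t)) \<times> y (a + t))"
  have "((\<lambda>t. y (a + t)) has_vector_derivative (1 *\<^sub>R ?D)) (at t)"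
  proof -
    have "((\<lambda>t. a + t) has_vector_derivative 1) (at t)"
      by (auto intro!: derivative_eq_intros)
    from vector_diff_chain_at[OF this solD[OF assms]] show ?thesis
      by (simp add: o_def)
  qed
  from bounded_linear.has_vector_derivative[OF linear_conv_bounded_linear[THEN iffD1, OF linear_rotx[of "sin \<alpha> * p"]] this]
  show "((\<lambda>t. rotx (sin \<alpha> * p) (y (a + t))) has_vector_derivative
    cos \<alpha> *\<^sub>R (drift_axis (sin \<alpha> * (U (a + t) - p)) \<times> rotx (sin \<alpha> * p) (y (a + t)))) (at t)"
    by (simp add: linear_cmul[OF linear_rotx] rotx_cross rotx_drift_axis Rings.right_diff_distrib)
qed

lemma sol_exists:
  assumes U: "continuous_on UNIV U"
  obtains y where "sol U y" "y t0 = y0"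
proof -
  define f where "f t = (\<lambda>y. cos \<alpha> *\<^sub>R (drift_axis (sin \<alpha> * U (t + t0)) \<times> y))" for t
  obtain y where y: "y 0 = y0" "\<And>t. (y has_vector_derivative f t (y t)) (at t)"
  proof (rule linear_ode_solution_exists[of f 1 y0])
    show "continuous_on UNIV (\<lambda>t. f t (y t))" if "continuous_on UNIV y" for y
    proof -
      have "continuous_on UNIV (\<lambda>t. drift_axis (sin \<alpha> * U (t + t0)))"
        by (intro continuous_on_compose2[OF continuous_on_drift_axis[of UNIV]] continuous_intros continuous_on_compose2[OF U]) auto
      then show ?thesis unfolding f_def
        by (intro continuous_intros continuous_on_cross that)
    qed
    show "linear (f t)" for t
      unfolding f_def by (rule linearI) (auto simp: cross_add_right cross_mult_right scaleR_add_right)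
    fix t x
    have "norm (f t x) \<le> cos \<alpha> * (norm (drift_axis (sin \<alpha> * U (t + t0))) * norm x)"
      unfolding f_def norm_scaleR using cos_pos by (simp add: norm_cross_le[THEN order_trans])
    also have "\<dots> \<le> 1 * norm x"
      unfolding norm_drift_axis by (intro mult_mono) auto
    finally show "norm (f t x) \<le> 1 * norm x" .
  qed auto
  then have "sol (\<lambda>t. U (t + t0)) y" by (simp add: sol_def f_def)
  from sol_shift[OF this, of "- t0" 0] have "sol U (\<lambda>t. y (t - t0))" by simp
  with y(1) show thesis by (intro that[of "\<lambda>t. y (t - t0)"]) auto
qed

lemma sol_lipschitz:
  assumes "sol U y"
  shows "norm (y s - y t) \<le> norm (y 0) * \<bar>s - t\<bar>"
proof -
  have "norm (y s - y t) \<le> norm (y 0) * norm (s - t)"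
  proof (rule differentiable_bound[of UNIV y])
    show "(y has_derivative (\<lambda>h. h *\<^sub>R (cos \<alpha> *\<^sub>R (drift_axis (sin \<alpha> * U x) \<times> y x)))) (at x within UNIV)" for x
      using solD[OF assms, of x UNIV] by (simp add: has_vector_derivative_def)
    fix x
    have "norm (cos \<alpha> *\<^sub>R (drift_axis (sin \<alpha> * U x) \<times> y x)) \<le> 1 * (norm (drift_axis (sin \<alpha> * U x)) * norm (y x))"
      unfolding norm_scaleR by (intro mult_mono norm_cross_le) auto
    also have "\<dots> = norm (y 0)" using sol_norm[OF assms, of x 0] by simp
    finally show "onorm (\<lambda>h. h *\<^sub>R (cos \<alpha> *\<^sub>R (drift_axis (sin \<alpha> * U x) \<times> y x))) \<le> norm (y 0)"
      by (intro onorm_le) (subst norm_scaleR, simp only: real_norm_def mult.commute[of "norm (y 0)"] mult_left_mono abs_ge_zero)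
  qed auto
  then show ?thesis by simp
qed

text \<open>Both flows preserve lengths, so the inner product changes only through the difference of
  the two axes, at a rate of at most |U - V|. The bound is linear in t, without the exponential of
  Gronwall's inequality.\<close>

lemma sol_compare:
  assumes "sol U a" "sol V b" "0 \<le> t" and d: "\<And>s. s \<in> {0..t} \<Longrightarrow> \<bar>U s - V s\<bar> \<le> d"
  shows "\<bar>a t \<bullet> b t - a 0 \<bullet> b 0\<bar> \<le> t * d * (norm (a 0) * norm (b 0))"
proof -
  let ?n = "\<lambda>s. drift_axis (sin \<alpha> * U s) - drift_axis (sin \<alpha> * V s)"
  have der: "((\<lambda>s. a s \<bullet> b s) has_vector_derivative (cos \<alpha> * ((?n s \<times> a s) \<bullet> b s))) (at s within S)" for s S
  proof -
    have "(drift_axis (sin \<alpha> * V s) \<times> b s) \<bullet> a s = - ((drift_axis (sin \<alpha> * V s) \<times> a s) \<bullet> b s)"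
      by (simp add: inner3 cross_components algebra_simps)
    then show ?thesis
      using has_real_derivative_inner[OF solD[OF assms(1)] solD[OF assms(2)], of s S]
      by (simp add: has_real_derivative_iff_has_vector_derivative Cross3.left_diff_distrib inner_diff_left inner_commute algebra_simps)
  qed
  have "norm (a t \<bullet> b t - a 0 \<bullet> b 0) \<le> (d * (norm (a 0) * norm (b 0))) * norm (t - 0)"
  proof (rule differentiable_bound[of "{0..t}" "\<lambda>s. a s \<bullet> b s"])
    show "((\<lambda>s. a s \<bullet> b s) has_derivative (\<lambda>h. h *\<^sub>R (cos \<alpha> * ((?n s \<times> a s) \<bullet> b s)))) (at s within {0..t})" for s
      using der[of s "{0..t}"] by (simp add: has_vector_derivative_def)
    fix s assume s: "s \<in> {0..t}"
    have "\<bar>(?n s \<times> a s) \<bullet> b s\<bar> \<le> norm (?n s \<times> a s) * norm (b s)" by (rule Cauchy_Schwarz_ineq2)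
    also have "\<dots> \<le> norm (?n s) * norm (a s) * norm (b s)"
      by (intro mult_right_mono norm_cross_le) auto
    also have "\<dots> \<le> d * norm (a s) * norm (b s)"
    proof (intro mult_right_mono)
      have "norm (?n s) \<le> \<bar>sin \<alpha> * U s - sin \<alpha> * V s\<bar>" by (rule norm_drift_axis_diff_le)
      also have "\<dots> = sin \<alpha> * \<bar>U s - V s\<bar>" using sin_pos by (metis Rings.right_diff_distrib abs_mult abs_of_pos)
      also have "\<dots> \<le> 1 * \<bar>U s - V s\<bar>" by (intro mult_right_mono) auto
      finally show "norm (?n s) \<le> d" using d[OF s] by simp
    qed auto
    finally have le: "\<bar>(?n s \<times> a s) \<bullet> b s\<bar> \<le> d * (norm (a 0) * norm (b 0))"
      using sol_norm[OF assms(1), of s 0] sol_norm[OF assms(2), of s 0] by (simp add: mult.assoc)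
    have "\<bar>cos \<alpha> * ((?n s \<times> a s) \<bullet> b s)\<bar> \<le> 1 * \<bar>(?n s \<times> a s) \<bullet> b s\<bar>"
      unfolding abs_mult by (intro mult_right_mono) auto
    with le have "\<bar>cos \<alpha> * ((?n s \<times> a s) \<bullet> b s)\<bar> \<le> d * (norm (a 0) * norm (b 0))" by linarith
    then show "onorm (\<lambda>h. h *\<^sub>R (cos \<alpha> * ((?n s \<times> a s) \<bullet> b s))) \<le> d * (norm (a 0) * norm (b 0))"
      by (intro onorm_le) (subst norm_scaleR, simp only: real_norm_def mult.commute[of "d * (norm (a 0) * norm (b 0))"] mult_left_mono abs_ge_zero)
  qed (use assms in auto)
  then show ?thesis using \<open>0 \<le> t\<close> by (simp add: mult_ac)
qed

end

section \<open>Compactness of the reachable set\<close>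

lemma N_pole_nth [simp]: "N_pole $ 1 = 0" "N_pole $ 2 = 0" "N_pole $ 3 = 1"
  by (simp_all add: N_pole_def)

lemma norm_N_pole [simp]: "norm N_pole = 1"
  by (simp add: norm_eq_sqrt_inner inner3)

lemma norm_diff_sq_unit:
  fixes x y :: "'a::real_inner"
  assumes "norm x = 1" "norm y = 1"
  shows "(norm (x - y))\<^sup>2 = 2 - 2 * (x \<bullet> y)"
  using assms unfolding norm_eq_1 by (simp add: power2_norm_eq_inner inner_diff_left inner_diff_right inner_commute)

lemma lip1_zero: "lip1 U \<Longrightarrow> U 0 = 0" and lip1_le: "lip1 U \<Longrightarrow> \<bar>U s - U t\<bar> \<le> \<bar>s - t\<bar>"
  by (auto simp: lip1_def)

lemma lip1_abs_le: "lip1 U \<Longrightarrow> \<bar>U t\<bar> \<le> \<bar>t\<bar>"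
  using lip1_le[of U t 0] by (simp add: lip1_zero)

lemma lip1_convex:
  assumes "lip1 U" "lip1 V" "0 \<le> e" "e \<le> 1"
  shows "lip1 (\<lambda>t. U t + e * (V t - U t))"
  unfolding lip1_def
proof (intro conjI allI)
  fix s t
  have "U s + e * (V s - U s) - (U t + e * (V t - U t)) = (1 - e) * (U s - U t) + e * (V s - V t)"
    by (simp add: algebra_simps)
  also have "\<bar>\<dots>\<bar> \<le> (1 - e) * \<bar>U s - U t\<bar> + e * \<bar>V s - V t\<bar>"
    using assms abs_triangle_ineq[of "(1 - e) * (U s - U t)" "e * (V s - V t)"] by (simp add: abs_mult)
  also have "\<dots> \<le> (1 - e) * \<bar>s - t\<bar> + e * \<bar>s - t\<bar>"
    using assms by (intro add_mono mult_left_mono lip1_le) auto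
  finally show "\<bar>U s + e * (V s - U s) - (U t + e * (V t - U t))\<bar> \<le> \<bar>s - t\<bar>"
    by (simp add: algebra_simps)
qed (use assms in \<open>simp add: lip1_zero\<close>)

lemma lip1_seq_compact:
  assumes U: "\<And>n::nat. lip1 (U n)" and "0 \<le> B"
  obtains k V where "strict_mono (k :: nat \<Rightarrow> nat)" "lip1 V"
    "\<forall>e>0. \<exists>N. \<forall>n\<ge>N. \<forall>t\<in>{0..B}. \<bar>U (k n) t - V t\<bar> < e"
proof -
  obtain g k where g: "continuous_on {0..B} g" "strict_mono (k :: nat \<Rightarrow> nat)"
    and conv: "\<And>e. 0 < e \<Longrightarrow> \<exists>N. \<forall>n t. n \<ge> N \<and> t \<in> {0..B} \<longrightarrow> norm (U (k n) t - g t) < e"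
  proof (rule Arzela_Ascoli[of "{0..B}" U B])
    show "norm (U n x) \<le> B" if "x \<in> {0..B}" for n x
      using lip1_abs_le[OF U, of n x] that by auto
    show "\<exists>d>0. \<forall>n y. y \<in> {0..B} \<and> norm (x - y) < d \<longrightarrow> norm (U n x - U n y) < e"
      if "0 < e" for x e
    proof (intro exI[of _ e] conjI allI impI)
      fix n y assume "y \<in> {0..B} \<and> norm (x - y) < e"
      then show "norm (U n x - U n y) < e"
        using lip1_le[OF U, of n x y] by simp
    qed fact
  qed auto
  have lim: "(\<lambda>n. U (k n) t) \<longlonglongrightarrow> g t" if "t \<in> {0..B}" for t
    unfolding LIMSEQ_iff using conv that by blast
  \<comment> \<open>The limit is known on [0, B] only; clamping the argument extends it to the line
    with the same Lipschitz constant.\<close>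
  define c where "c t = max 0 (min B t)" for t
  have c: "c t \<in> {0..B}" "\<bar>c s - c t\<bar> \<le> \<bar>s - t\<bar>" for s t
    using \<open>0 \<le> B\<close> by (auto simp: c_def)
  have c_id: "c t = t" if "t \<in> {0..B}" for t
    using that by (auto simp: c_def)
  have "lip1 (\<lambda>t. g (c t))"
    unfolding lip1_def
  proof (intro conjI allI)
    show "g (c 0) = 0"
      using lim[OF c(1)[of 0]] LIMSEQ_unique c_id[of 0] \<open>0 \<le> B\<close> by (simp add: lip1_zero[OF U] LIMSEQ_const_iff)
    fix s t
    have "(\<lambda>n. \<bar>U (k n) (c s) - U (k n) (c t)\<bar>) \<longlonglongrightarrow> \<bar>g (c s) - g (c t)\<bar>"
      by (intro tendsto_intros lim c)
    then show "\<bar>g (c s) - g (c t)\<bar> \<le> \<bar>s - t\<bar>"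
      using order_trans[OF lip1_le[OF U] c(2)] by (intro LIMSEQ_le_const2) auto
  qed
  then show thesis
  proof (rule that[OF g(2)], intro allI impI)
    fix e :: real assume "0 < e"
    from conv[OF this] obtain N where N: "\<And>n t. n \<ge> N \<Longrightarrow> t \<in> {0..B} \<Longrightarrow> norm (U (k n) t - g t) < e"
      by blast
    have "\<bar>U (k n) t - g (c t)\<bar> < e" if "n \<ge> N" "t \<in> {0..B}" for n t
      using N[OF that] c_id[OF that(2)] by simp
    then show "\<exists>N. \<forall>n\<ge>N. \<forall>t\<in>{0..B}. \<bar>U (k n) t - g (c t)\<bar> < e"
      by blast
  qed
qed

context bang
begin

lemma sol_pole: "sol (\<lambda>_. 0) (\<lambda>_. N_pole)"
proof -
  have "drift_axis 0 \<times> N_pole = 0"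
    by (simp add: eq3_iff cross_components)
  then show ?thesis by (auto simp: sol_def)
qed

text \<open>Every 1-Lipschitz U counts here, whether or not it is given as the primitive of a
  control. This makes the set compact by Arzela-Ascoli.\<close>

definition reach :: "real \<Rightarrow> (real^3) set" where
  "reach T = {rotx (sin \<alpha> * U T) (y T) | U y. lip1 U \<and> sol U y \<and> y 0 = N_pole}"

lemma reachE:
  assumes "x \<in> reach T"
  obtains U y where "lip1 U" "sol U y" "y 0 = N_pole" "x = rotx (sin \<alpha> * U T) (y T)"
  using assms by (auto simp: reach_def)

lemma reachI: "lip1 U \<Longrightarrow> sol U y \<Longrightarrow> y 0 = N_pole \<Longrightarrow> rotx (sin \<alpha> * U T) (y T) \<in> reach T"
  by (auto simp: reach_def)

lemma norm_reach: "x \<in> reach T \<Longrightarrow> norm x = 1"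
  by (erule reachE) (use sol_norm[of _ _ T 0] in simp)

lemma N_pole_in_reach: "N_pole \<in> reach T"
  using reachI[OF _ sol_pole, of T] by (simp add: lip1_def)

text \<open>For unit vectors |a - b|^2 = 2 - 2 a . b, and the inner product is controlled by
  \<open>sol_compare\<close>; hence the square root.\<close>

lemma sol_dist:
  assumes "sol U a" "sol V b" "0 \<le> t" "a 0 = b 0" "norm (a 0) = 1"
    and "\<And>s. s \<in> {0..t} \<Longrightarrow> \<bar>U s - V s\<bar> \<le> d"
  shows "norm (a t - b t) \<le> sqrt (2 * t * d)"
proof (rule real_le_rsqrt)
  have "norm (a t) = 1" "norm (b t) = 1" "a 0 \<bullet> b 0 = 1"
    using sol_norm[OF assms(1), of t 0] sol_norm[OF assms(2), of t 0] assms(4,5)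
    by (auto simp flip: norm_eq_1)
  then show "(norm (a t - b t))\<^sup>2 \<le> 2 * t * d"
    using sol_compare[OF assms(1-3,6)] assms(4,5) by (simp add: norm_diff_sq_unit)
qed

lemma sol_agree:
  assumes "sol U a" "sol V b" "0 \<le> t" "a 0 = b 0"
    and "\<And>s. s \<in> {0..t} \<Longrightarrow> U s = V s"
  shows "a t = b t"
proof -
  have "a t \<bullet> b t = a 0 \<bullet> a 0"
    using sol_compare[OF assms(1-3), of 0] assms(4,5) by auto
  moreover have "a t \<bullet> a t = a 0 \<bullet> a 0" "b t \<bullet> b t = a 0 \<bullet> a 0"
    using sol_inner[OF assms(1,1), of t 0] sol_inner[OF assms(2,2), of t 0] assms(4) by auto
  ultimately have "(a t - b t) \<bullet> (a t - b t) = 0"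
    by (simp add: inner_diff_left inner_diff_right inner_commute)
  then show ?thesis by simp
qed

lemma traj_dist:
  assumes "sol U a" "sol V b" "0 \<le> t" "a 0 = b 0" "norm (a 0) = 1"
    and d: "\<And>s. s \<in> {0..t} \<Longrightarrow> \<bar>U s - V s\<bar> \<le> d"
  shows "norm (rotx (sin \<alpha> * U t) (a t) - rotx (sin \<alpha> * V t) (b t)) \<le> d + sqrt (2 * t * d)"
proof -
  have "norm (rotx (sin \<alpha> * U t) (a t) - rotx (sin \<alpha> * V t) (a t)) \<le> \<bar>sin \<alpha> * U t - sin \<alpha> * V t\<bar> * norm (a t)"
    by (rule norm_rotx_diff_le)
  also have "\<dots> = sin \<alpha> * \<bar>U t - V t\<bar>"
    using sin_pos sol_norm[OF assms(1), of t 0] assms(5)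
    by (simp add: abs_mult flip: Rings.right_diff_distrib)
  also have "\<dots> \<le> 1 * d"
    using d[of t] \<open>0 \<le> t\<close> by (intro mult_mono) auto
  finally have 1: "norm (rotx (sin \<alpha> * U t) (a t) - rotx (sin \<alpha> * V t) (a t)) \<le> d" by simp
  have 2: "norm (rotx (sin \<alpha> * V t) (a t) - rotx (sin \<alpha> * V t) (b t)) \<le> sqrt (2 * t * d)"
    using sol_dist[OF assms] by (simp flip: linear_diff[OF linear_rotx])
  show ?thesis
    using norm_triangle_ineq[of "rotx (sin \<alpha> * U t) (a t) - rotx (sin \<alpha> * V t) (a t)"
        "rotx (sin \<alpha> * V t) (a t) - rotx (sin \<alpha> * V t) (b t)"] 1 2 by simp
qed

lemma traj_lipschitz:
  assumes "lip1 U" "sol U y" "norm (y 0) = 1"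
  shows "norm (rotx (sin \<alpha> * U s) (y s) - rotx (sin \<alpha> * U t) (y t)) \<le> 2 * \<bar>s - t\<bar>"
proof -
  have "norm (rotx (sin \<alpha> * U s) (y s) - rotx (sin \<alpha> * U t) (y s)) \<le> \<bar>sin \<alpha> * U s - sin \<alpha> * U t\<bar> * norm (y s)"
    by (rule norm_rotx_diff_le)
  also have "\<dots> = sin \<alpha> * \<bar>U s - U t\<bar>"
    using sin_pos sol_norm[OF assms(2), of s 0] assms(3)
    by (simp add: abs_mult flip: Rings.right_diff_distrib)
  also have "\<dots> \<le> 1 * \<bar>s - t\<bar>"
    using lip1_le[OF assms(1)] by (intro mult_mono) auto
  finally have 1: "norm (rotx (sin \<alpha> * U s) (y s) - rotx (sin \<alpha> * U t) (y s)) \<le> \<bar>s - t\<bar>" by simp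
  have 2: "norm (rotx (sin \<alpha> * U t) (y s) - rotx (sin \<alpha> * U t) (y t)) \<le> \<bar>s - t\<bar>"
    using sol_lipschitz[OF assms(2), of s t] assms(3) by (simp flip: linear_diff[OF linear_rotx])
  show ?thesis
    using norm_triangle_ineq[of "rotx (sin \<alpha> * U s) (y s) - rotx (sin \<alpha> * U t) (y s)"
        "rotx (sin \<alpha> * U t) (y s) - rotx (sin \<alpha> * U t) (y t)"] 1 2 by simp
qed

lemma reach_near:
  assumes "x \<in> reach t"
  obtains x' where "x' \<in> reach t'" "norm (x - x') \<le> 2 * \<bar>t - t'\<bar>"
proof -
  obtain U y where "lip1 U" "sol U y" "y 0 = N_pole" "x = rotx (sin \<alpha> * U t) (y t)"
    using assms by (rule reachE)
  then show thesis
    using that[OF reachI] traj_lipschitz[of U y t t'] by simp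
qed

text \<open>Each point is moved along its own trajectory to the common time t0, at a cost of 2 |t n
  - t0|; there the uniform limit of the primitives decides. Variable times are allowed for the sake
  of \<open>reach_first_time\<close>.\<close>

lemma reach_seq_compact:
  assumes x: "\<And>n::nat. x n \<in> reach (t n)" and t: "\<And>n. 0 \<le> t n" "t \<longlonglongrightarrow> t0"
  obtains k l where "strict_mono (k :: nat \<Rightarrow> nat)" "l \<in> reach t0" "(\<lambda>n. x (k n)) \<longlonglongrightarrow> l"
proof -
  have "\<exists>U y. lip1 U \<and> sol U y \<and> y 0 = N_pole \<and> x n = rotx (sin \<alpha> * U (t n)) (y (t n))" for n
    using x[of n] by (auto simp: reach_def)
  then obtain U y where U: "\<And>n. lip1 (U n)" "\<And>n. sol (U n) (y n)" "\<And>n. y n 0 = N_pole"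
    and xe: "\<And>n. x n = rotx (sin \<alpha> * U n (t n)) (y n (t n))" by metis
  have "0 \<le> t0" using t LIMSEQ_le_const by blast
  obtain k V where k: "strict_mono (k :: nat \<Rightarrow> nat)" and V: "lip1 V"
    and conv: "\<forall>e>0. \<exists>N. \<forall>n\<ge>N. \<forall>s\<in>{0..t0}. \<bar>U (k n) s - V s\<bar> < e"
    by (rule lip1_seq_compact[of U t0, OF U(1) \<open>0 \<le> t0\<close>])
  obtain z where z: "sol V z" "z 0 = N_pole"
    using sol_exists[OF lip1_continuous[OF V]] by blast
  let ?l = "rotx (sin \<alpha> * V t0) (z t0)"
  have "(\<lambda>n. x (k n)) \<longlonglongrightarrow> ?l"
  proof (rule tendstoI)
    fix e :: real assume "0 < e"
    have "((\<lambda>d. d + sqrt (2 * t0 * d)) \<longlongrightarrow> 0 + sqrt (2 * t0 * 0)) (at_right 0)"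
      by (intro tendsto_intros)
    then have "\<forall>\<^sub>F d in at_right 0. d + sqrt (2 * t0 * d) < e / 2"
      by (rule order_tendstoD) (use \<open>0 < e\<close> in auto)
    then obtain b where "0 < b" "\<And>d. 0 < d \<Longrightarrow> d < b \<Longrightarrow> d + sqrt (2 * t0 * d) < e / 2"
      unfolding eventually_at_right_field by blast
    then obtain d where d: "0 < d" "d + sqrt (2 * t0 * d) < e / 2"
      by (meson dense)
    have "\<forall>\<^sub>F n in sequentially. \<forall>s\<in>{0..t0}. \<bar>U (k n) s - V s\<bar> < d"
      using conv d(1) by (simp add: eventually_sequentially)
    moreover have "\<forall>\<^sub>F n in sequentially. dist (t (k n)) t0 < e / 4"
      using tendstoD[OF LIMSEQ_subseq_LIMSEQ[OF t(2) k], of "e / 4"] \<open>0 < e\<close> by (simp add: o_def)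
    ultimately show "\<forall>\<^sub>F n in sequentially. dist (x (k n)) ?l < e"
    proof eventually_elim
      case (elim n)
      let ?m = "rotx (sin \<alpha> * U (k n) t0) (y (k n) t0)"
      have "norm (x (k n) - ?m) \<le> 2 * \<bar>t (k n) - t0\<bar>"
        unfolding xe by (rule traj_lipschitz[OF U(1,2)]) (simp add: U(3))
      moreover have "norm (?m - ?l) \<le> d + sqrt (2 * t0 * d)"
        by (rule traj_dist[OF U(2) z(1) \<open>0 \<le> t0\<close>]) (use elim in \<open>auto simp: U(3) z(2) intro: less_imp_le\<close>)
      moreover have "norm (x (k n) - ?l) \<le> norm (x (k n) - ?m) + norm (?m - ?l)"
        using norm_triangle_ineq[of "x (k n) - ?m" "?m - ?l"] by simp
      ultimately show ?case using elim(2) d(2) by (simp add: dist_norm)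
    qed
  qed
  with k show thesis by (intro that[OF k _]) (auto intro!: reachI V z)
qed

lemma compact_reach: "0 \<le> T \<Longrightarrow> compact (reach T)"
  unfolding compact_def
proof (intro allI impI)
  fix f :: "nat \<Rightarrow> real^3"
  assume "0 \<le> T" and f: "\<forall>n. f n \<in> reach T"
  obtain k l where "strict_mono (k :: nat \<Rightarrow> nat)" "l \<in> reach T" "(\<lambda>n. f (k n)) \<longlonglongrightarrow> l"
    using reach_seq_compact[of f "\<lambda>_. T" T] f \<open>0 \<le> T\<close> by auto
  then show "\<exists>l\<in>reach T. \<exists>r. strict_mono r \<and> (f \<circ> r) \<longlonglongrightarrow> l"
    by (auto simp: o_def)
qed

text \<open>Run backwards from x', the control that steers the pole to x in time t ends at distance
  |x' - x| from the pole, because the flow is isometric. That point is reached in time s, and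
  concatenation then steers to x'. With x' = x this gives monotonicity in time, with x' near x it
  carries an interior point along the trajectory.\<close>

lemma reach_extend:
  assumes ball: "\<And>w. norm w = 1 \<Longrightarrow> norm (w - N_pole) = norm (x' - x) \<Longrightarrow> w \<in> reach s"
    and "x \<in> reach t" "0 \<le> s" "0 \<le> t" and x': "norm x' = 1"
  shows "x' \<in> reach (s + t)"
proof -
  obtain U' y' where U': "lip1 U'" "sol U' y'" "y' 0 = N_pole" "x = rotx (sin \<alpha> * U' t) (y' t)"
    using assms(2) by (rule reachE)
  obtain z where z: "sol U' z" "z t = rotx (- (sin \<alpha> * U' t)) x'"
    using sol_exists[OF lip1_continuous[OF U'(1)]] by blast
  have "y' t = rotx (- (sin \<alpha> * U' t)) x"
    by (simp add: U'(4) rotx_rotx)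
  then have "norm (z t - y' t) = norm (x' - x)"
    by (simp add: z(2) flip: linear_diff[OF linear_rotx])
  then have "norm (z 0 - N_pole) = norm (x' - x)"
    using sol_norm[OF sol_diff[OF z(1) U'(2)], of t 0] x' U'(3) by simp
  moreover have "norm (z 0) = 1"
    using sol_norm[OF z(1), of 0 t] x' z(2) by simp
  ultimately obtain U1 y1 where U1: "lip1 U1" "sol U1 y1" "y1 0 = N_pole"
    and z0: "z 0 = rotx (sin \<alpha> * U1 s) (y1 s)"
    using reachE[OF ball] by metis
  define U where "U \<tau> = (if \<tau> \<le> s then U1 \<tau> else U1 s + U' (\<tau> - s))" for \<tau>
  have U: "lip1 U"
    unfolding lip1_def
  proof (intro conjI allI)
    show "U 0 = 0" using \<open>0 \<le> s\<close> by (simp add: U_def lip1_zero U1)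
    have le: "\<bar>U a - U b\<bar> \<le> b - a" if "a \<le> b" for a b
    proof -
      consider "b \<le> s" | "a \<le> s" "s < b" | "s < a" using that by linarith
      then show ?thesis
      proof cases
        case 1
        then show ?thesis using lip1_le[OF U1(1), of a b] that by (simp add: U_def)
      next
        case 2
        then show ?thesis
          using lip1_le[OF U1(1), of a s] lip1_abs_le[OF U'(1), of "b - s"] by (simp add: U_def)
      next
        case 3
        then show ?thesis using lip1_le[OF U'(1), of "a - s" "b - s"] that by (simp add: U_def)
      qed
    qed
    show "\<bar>U a - U b\<bar> \<le> \<bar>a - b\<bar>" for a b
      using le[of a b] le[of b a] by linarith
  qed
  obtain y where y: "sol U y" "y 0 = N_pole"
    using sol_exists[OF lip1_continuous[OF U]] by blast
  have "y s = y1 s"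
    by (rule sol_agree[OF y(1) U1(2) \<open>0 \<le> s\<close>]) (auto simp: y U1 U_def)
  have "rotx (sin \<alpha> * U1 s) (y (s + t)) = z t"
  proof (rule sol_agree[OF sol_shift[OF y(1), of s "U1 s"] z(1) \<open>0 \<le> t\<close>])
    show "rotx (sin \<alpha> * U1 s) (y (s + 0)) = z 0" by (simp add: z0 \<open>y s = y1 s\<close>)
    show "U (s + \<tau>) - U1 s = U' \<tau>" if "\<tau> \<in> {0..t}" for \<tau>
      using that lip1_zero[OF U'(1)] by (cases "\<tau> = 0") (auto simp: U_def)
  qed
  moreover have "U (s + t) = U' t + U1 s"
    using lip1_zero[OF U'(1)] \<open>0 \<le> t\<close> by (cases "t = 0") (auto simp: U_def)
  ultimately have "rotx (sin \<alpha> * U (s + t)) (y (s + t)) = rotx (sin \<alpha> * U' t) (z t)"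
    using rotx_rotx[of "sin \<alpha> * U' t" "sin \<alpha> * U1 s" "y (s + t)"] by (simp add: distrib_left)
  also have "\<dots> = x'" by (simp add: z rotx_rotx)
  finally show ?thesis using reachI[OF U y, of "s + t"] by simp
qed

end

section \<open>First variation\<close>

lemma difference_quotient_tendsto:
  fixes f :: "real \<Rightarrow> 'a::real_normed_vector"
  assumes f: "(f has_vector_derivative f') (at p)" and e: "e \<longlonglongrightarrow> 0" "\<And>n::nat. 0 < e n"
  shows "(\<lambda>n. (f (p + e n * h) - f p) /\<^sub>R e n) \<longlonglongrightarrow> h *\<^sub>R f'"
proof -
  define g where "g \<epsilon> = f (p + \<epsilon> * h)" for \<epsilon>
  have "((\<lambda>\<epsilon>. p + \<epsilon> * h) has_vector_derivative h) (at 0)"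
    by (auto intro!: derivative_eq_intros)
  from vector_diff_chain_at[OF this] f have "(g has_vector_derivative h *\<^sub>R f') (at 0)"
    by (simp add: g_def[abs_def] o_def)
  then have lim: "((\<lambda>y. (1 / norm (y - 0)) *\<^sub>R (g y - (g 0 + (y - 0) *\<^sub>R (h *\<^sub>R f')))) \<longlongrightarrow> 0) (at 0)"
    unfolding has_vector_derivative_def has_derivative_at2 by blast
  have "filterlim e (at 0) sequentially"
    using e by (auto simp: filterlim_at less_imp_neq[symmetric])
  from filterlim_compose[OF lim this]
  have "(\<lambda>n. (1 / norm (e n)) *\<^sub>R (g (e n) - (g 0 + e n *\<^sub>R (h *\<^sub>R f')))) \<longlonglongrightarrow> 0"
    by simp
  moreover have "(1 / norm (e n)) *\<^sub>R (g (e n) - (g 0 + e n *\<^sub>R (h *\<^sub>R f'))) = (f (p + e n * h) - f p) /\<^sub>R e n - h *\<^sub>R f'" for n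
    using e(2)[of n] by (simp add: g_def scaleR_diff_right scaleR_add_right divide_inverse)
  ultimately show ?thesis
    by (simp add: LIM_zero_iff)
qed

lemma drift_axis_has_vector_derivative:
  "(drift_axis has_vector_derivative vector [0, cos p, - sin p]) (at p)"
  unfolding has_vector_derivative_vec3_iff
  by (auto intro!: derivative_eq_intros simp flip: has_real_derivative_iff_has_vector_derivative)

lemma rotx_minus_has_vector_derivative:
  "((\<lambda>p. rotx (- p) z) has_vector_derivative vector [0, rotx (- p) z $ 3, - rotx (- p) z $ 2]) (at p)"
  unfolding has_vector_derivative_vec3_iff
  by (auto intro!: derivative_eq_intros simp flip: has_real_derivative_iff_has_vector_derivative)

context bang
begin

lemma sol_component_1:
  "sol U m \<Longrightarrow> ((\<lambda>t. m t $ 1) has_real_derivative cos \<alpha> * (drift_axis (sin \<alpha> * U t) \<times> m t) $ 1) (at t within S)"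
  using solD[of U m t S] unfolding has_vector_derivative_vec3_iff
  by (simp add: has_real_derivative_iff_has_vector_derivative)

lemma sol_inner_integral:
  assumes "lip1 U" "lip1 V" "sol U q" "sol V y" "0 \<le> T"
  shows "((\<lambda>t. cos \<alpha> * (((drift_axis (sin \<alpha> * U t) - drift_axis (sin \<alpha> * V t)) \<times> q t) \<bullet> y t))
    has_integral (q T \<bullet> y T - q 0 \<bullet> y 0)) {0..T}"
proof (rule fundamental_theorem_of_calculus[OF \<open>0 \<le> T\<close>])
  fix t assume "t \<in> {0..T}"
  have "(drift_axis (sin \<alpha> * V t) \<times> y t) \<bullet> q t = - ((drift_axis (sin \<alpha> * V t) \<times> q t) \<bullet> y t)"
    by (simp add: inner3 cross_components algebra_simps)
  then show "((\<lambda>t. q t \<bullet> y t) has_vector_derivative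
    cos \<alpha> * (((drift_axis (sin \<alpha> * U t) - drift_axis (sin \<alpha> * V t)) \<times> q t) \<bullet> y t)) (at t within {0..T})"
    using has_real_derivative_inner[OF solD[OF assms(3)] solD[OF assms(4)], of t "{0..T}"]
    by (simp add: has_real_derivative_iff_has_vector_derivative Cross3.left_diff_distrib inner_diff_left inner_commute algebra_simps)
qed

text \<open>The variation U + e (V - U) stays 1-Lipschitz by convexity. Its effect on z . x(T) has
  two parts: the change of the final rotation, and the change of the axis along the way. The second
  contains the derivative of the first component m_1 of y \<times> q, so integration by parts would
  turn the inequality into the maximum principle, the integral of m_1 (V' - U') being \<le> 0. The
  form chosen involves V - U itself and not its derivative.\<close>

lemma reach_first_variation:
  assumes "0 \<le> T" and U: "lip1 U" and y: "sol U y" "y 0 = N_pole" and V: "lip1 V"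
    and q: "sol U q" "q T = rotx (- (sin \<alpha> * U T)) z"
    and max: "\<And>w. w \<in> reach T \<Longrightarrow> z \<bullet> w \<le> z \<bullet> rotx (sin \<alpha> * U T) (y T)"
  shows "(y T \<times> q T) $ 1 * (V T - U T)
    \<le> integral {0..T} (\<lambda>t. (V t - U t) * (cos \<alpha> * (drift_axis (sin \<alpha> * U t) \<times> (y t \<times> q t)) $ 1))"
proof -
  define e where "e n = inverse (real (Suc n))" for n
  have e: "0 < e n" "e n \<le> 1" for n by (auto simp: e_def inverse_le_1_iff)
  have e0: "e \<longlonglongrightarrow> 0" unfolding e_def by (rule LIMSEQ_inverse_real_of_nat)
  define W where "W n t = U t + e n * (V t - U t)" for n t
  have W: "lip1 (W n)" for n
    unfolding W_def[abs_def] using e[of n] by (intro lip1_convex U V) auto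
  have sW: "sin \<alpha> * W n t = sin \<alpha> * U t + e n * (sin \<alpha> * (V t - U t))" for n t
    by (simp add: W_def algebra_simps)
  have "\<exists>y. sol (W n) y \<and> y 0 = N_pole" for n
    using sol_exists[OF lip1_continuous[OF W[of n]], of 0 N_pole] by metis
  then obtain ys where ys: "\<And>n. sol (W n) (ys n)" "\<And>n. ys n 0 = N_pole" by metis
  have D: "\<bar>V t - U t\<bar> \<le> 2 * T" if "t \<in> {0..T}" for t
    using lip1_abs_le[OF U, of t] lip1_abs_le[OF V, of t] that by auto
  have ys_lim: "(\<lambda>n. ys n t) \<longlonglongrightarrow> y t" if t: "t \<in> {0..T}" for t
  proof -
    have le: "norm (ys n t - y t) \<le> sqrt (2 * t * (e n * (2 * T)))" for n
    proof (rule sol_dist[OF ys(1) y(1)])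
      fix s assume "s \<in> {0..t}"
      then have "\<bar>V s - U s\<bar> \<le> 2 * T" using D t by auto
      then show "\<bar>W n s - U s\<bar> \<le> e n * (2 * T)"
        using e(1)[of n] by (simp add: W_def abs_mult)
    qed (use t ys(2) y(2) in auto)
    have "(\<lambda>n. sqrt (2 * t * (e n * (2 * T)))) \<longlonglongrightarrow> sqrt (2 * t * (0 * (2 * T)))"
      by (intro tendsto_intros e0)
    then have "(\<lambda>n. sqrt (2 * t * (e n * (2 * T)))) \<longlonglongrightarrow> 0" by simp
    from Lim_null_comparison[OF always_eventually[OF allI[OF le]] this]
    have "(\<lambda>n. ys n t - y t) \<longlonglongrightarrow> 0" .
    then show ?thesis by (simp add: LIM_zero_iff)
  qed
  \<comment> \<open>The integrand of the difference quotient: its integral over [0, T] is exactly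
    the quotient of q T . y T along the variation.\<close>
  define F where "F n t = cos \<alpha> * ((((drift_axis (sin \<alpha> * U t) - drift_axis (sin \<alpha> * W n t)) /\<^sub>R e n) \<times> q t) \<bullet> ys n t)" for n t
  define f where "f t = cos \<alpha> * (drift_axis (sin \<alpha> * U t) \<times> (y t \<times> q t)) $ 1" for t
  have F_int: "(F n has_integral ((q T \<bullet> ys n T - q 0 \<bullet> N_pole) / e n)) {0..T}" for n
    using has_integral_mult_left[OF sol_inner_integral[OF U W q(1) ys(1) \<open>0 \<le> T\<close>, of n], of "inverse (e n)"]
    by (simp add: F_def[abs_def] cross_mult_left divide_inverse mult_ac ys(2))
  have F_le: "norm (F n t) \<le> 2 * T * norm z" if t: "t \<in> {0..T}" for n t
  proof -
    let ?d = "(drift_axis (sin \<alpha> * U t) - drift_axis (sin \<alpha> * W n t)) /\<^sub>R e n"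
    have "norm (drift_axis (sin \<alpha> * U t) - drift_axis (sin \<alpha> * W n t)) \<le> \<bar>e n * (sin \<alpha> * (V t - U t))\<bar>"
      using norm_drift_axis_diff_le[of "sin \<alpha> * U t" "sin \<alpha> * W n t"] by (simp add: sW)
    also have "\<dots> = e n * (\<bar>sin \<alpha>\<bar> * \<bar>V t - U t\<bar>)"
      using e(1)[of n] by (simp add: abs_mult)
    finally have "norm ?d \<le> \<bar>sin \<alpha>\<bar> * \<bar>V t - U t\<bar>"
      unfolding norm_scaleR using e(1)[of n] by (simp add: field_simps)
    also have "\<dots> \<le> 1 * (2 * T)" using D[OF t] by (intro mult_mono) auto
    finally have d: "norm ?d \<le> 2 * T" by simp
    have "\<bar>(?d \<times> q t) \<bullet> ys n t\<bar> \<le> norm (?d \<times> q t) * norm (ys n t)" by (rule Cauchy_Schwarz_ineq2)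
    also have "\<dots> \<le> norm ?d * norm (q t) * norm (ys n t)" by (intro mult_right_mono norm_cross_le) auto
    also have "\<dots> \<le> 2 * T * norm z"
      using d sol_norm[OF ys(1)[of n], of t 0] sol_norm[OF q(1), of t T]
      by (simp add: ys(2) q(2) mult_right_mono)
    finally have "1 * \<bar>(?d \<times> q t) \<bullet> ys n t\<bar> \<le> 2 * T * norm z" by simp
    moreover have "\<bar>cos \<alpha>\<bar> * \<bar>(?d \<times> q t) \<bullet> ys n t\<bar> \<le> 1 * \<bar>(?d \<times> q t) \<bullet> ys n t\<bar>"
      by (intro mult_right_mono) auto
    ultimately show ?thesis unfolding F_def real_norm_def abs_mult by linarith
  qed
  have F_lim: "(\<lambda>n. F n t) \<longlonglongrightarrow> - sin \<alpha> * ((V t - U t) * f t)" if t: "t \<in> {0..T}" for t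
  proof -
    let ?p = "sin \<alpha> * U t" and ?h = "sin \<alpha> * (V t - U t)"
    let ?v = "vector [0, cos ?p, - sin ?p] :: real^3"
    have "(\<lambda>n. - ((drift_axis (?p + e n * ?h) - drift_axis ?p) /\<^sub>R e n)) \<longlonglongrightarrow> - (?h *\<^sub>R ?v)"
      by (intro tendsto_minus difference_quotient_tendsto drift_axis_has_vector_derivative e0 e)
    then have "(\<lambda>n. (drift_axis ?p - drift_axis (sin \<alpha> * W n t)) /\<^sub>R e n) \<longlonglongrightarrow> - (?h *\<^sub>R ?v)"
      by (simp add: sW scaleR_diff_right)
    then have "(\<lambda>n. F n t) \<longlonglongrightarrow> cos \<alpha> * (((- (?h *\<^sub>R ?v)) \<times> q t) \<bullet> y t)"
      unfolding F_def
      by (intro tendsto_intros bounded_bilinear.tendsto[OF bounded_bilinear_cross3] ys_lim[OF t])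
    moreover have "(?v \<times> q t) \<bullet> y t = (drift_axis ?p \<times> (y t \<times> q t)) $ 1"
      by (simp add: inner3 cross_components algebra_simps)
    ultimately show ?thesis
      by (simp add: f_def cross_mult_left mult_ac)
  qed
  have I: "(\<lambda>n. integral {0..T} (F n)) \<longlonglongrightarrow> integral {0..T} (\<lambda>t. - sin \<alpha> * ((V t - U t) * f t))"
    by (rule dominated_convergence(2)[where h = "\<lambda>_. 2 * T * norm z"])
       (use F_int F_le F_lim in \<open>auto simp: has_integral_iff\<close>)
  let ?p = "sin \<alpha> * U T" and ?h = "sin \<alpha> * (V T - U T)"
  let ?v = "vector [0, q T $ 3, - q T $ 2] :: real^3"
  have "(\<lambda>n. (rotx (- (?p + e n * ?h)) z - rotx (- ?p) z) /\<^sub>R e n) \<longlonglongrightarrow> ?h *\<^sub>R ?v"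
    unfolding q(2) by (intro difference_quotient_tendsto[where f = "\<lambda>p. rotx (- p) z"] rotx_minus_has_vector_derivative e0 e)
  then have "(\<lambda>n. (rotx (- (sin \<alpha> * W n T)) z - q T) /\<^sub>R e n) \<longlonglongrightarrow> ?h *\<^sub>R ?v"
    unfolding sW q(2) .
  then have "(\<lambda>n. ((rotx (- (sin \<alpha> * W n T)) z - q T) /\<^sub>R e n) \<bullet> ys n T) \<longlonglongrightarrow> (?h *\<^sub>R ?v) \<bullet> y T"
    using \<open>0 \<le> T\<close> by (intro tendsto_inner ys_lim) auto
  moreover have "?v \<bullet> y T = (y T \<times> q T) $ 1"
    by (simp add: inner3 cross_components algebra_simps)
  ultimately have conv: "(\<lambda>n. ((rotx (- (sin \<alpha> * W n T)) z - q T) /\<^sub>R e n) \<bullet> ys n T + integral {0..T} (F n))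
     \<longlonglongrightarrow> ?h * (y T \<times> q T) $ 1 + integral {0..T} (\<lambda>t. - sin \<alpha> * ((V t - U t) * f t))"
    using I by (intro tendsto_add) auto
  \<comment> \<open>The two summands add up to (z . x_n(T) - z . x(T)) / e n, where x_n is the
    trajectory of W n; maximality makes this nonpositive.\<close>
  have "((rotx (- (sin \<alpha> * W n T)) z - q T) /\<^sub>R e n) \<bullet> ys n T + integral {0..T} (F n) \<le> 0" for n
  proof -
    have "rotx (- (sin \<alpha> * W n T)) z \<bullet> ys n T = z \<bullet> rotx (sin \<alpha> * W n T) (ys n T)"
      by (simp add: inner_rotx_left)
    also have "\<dots> \<le> z \<bullet> rotx (sin \<alpha> * U T) (y T)"
      by (intro max reachI W ys)
    also have "\<dots> = q T \<bullet> y T"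
      by (simp add: q(2) inner_rotx_left)
    also have "\<dots> = q 0 \<bullet> N_pole"
      using sol_inner[OF q(1) y(1), of T 0] by (simp add: y(2))
    finally have "(rotx (- (sin \<alpha> * W n T)) z - q T) \<bullet> ys n T + (q T \<bullet> ys n T - q 0 \<bullet> N_pole) \<le> 0"
      by (simp add: inner_diff_left)
    then have "inverse (e n) * ((rotx (- (sin \<alpha> * W n T)) z - q T) \<bullet> ys n T + (q T \<bullet> ys n T - q 0 \<bullet> N_pole)) \<le> 0"
      using e(1)[of n] by (intro mult_nonneg_nonpos) auto
    moreover have "integral {0..T} (F n) = (q T \<bullet> ys n T - q 0 \<bullet> N_pole) / e n"
      using F_int[of n] by (rule integral_unique)
    ultimately show ?thesis by (simp add: distrib_left divide_inverse mult.commute)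
  qed
  then have "?h * (y T \<times> q T) $ 1 + integral {0..T} (\<lambda>t. - sin \<alpha> * ((V t - U t) * f t)) \<le> 0"
    by (intro LIMSEQ_le_const2[OF conv]) auto
  then have "sin \<alpha> * ((y T \<times> q T) $ 1 * (V T - U T)) \<le> sin \<alpha> * integral {0..T} (\<lambda>t. (V t - U t) * f t)"
    by (simp add: mult_ac)
  then show ?thesis
    using sin_pos by (simp add: f_def)
qed

text \<open>The competitor V has slope \<epsilon> on [a, b] and the increments of U elsewhere, so V
  - U = \<epsilon> g, where g measures by how much U falls short of slope \<epsilon> up to each
  time. As g is monotone, the second mean value theorem evaluates the first variation, and what
  remains is g b times a positive value of the switching function.\<close>

lemma maximizer_bang:
  assumes "0 \<le> T" and U: "lip1 U" and y: "sol U y" "y 0 = N_pole"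
    and q: "sol U q" "q T = rotx (- (sin \<alpha> * U T)) z"
    and max: "\<And>w. w \<in> reach T \<Longrightarrow> z \<bullet> w \<le> z \<bullet> rotx (sin \<alpha> * U T) (y T)"
    and \<epsilon>: "\<epsilon> = 1 \<or> \<epsilon> = - 1" and ab: "0 \<le> a" "a \<le> b" "b \<le> T"
    and pos: "\<And>t. t \<in> {a..b} \<Longrightarrow> 0 < \<epsilon> * (y t \<times> q t) $ 1"
  shows "U b - U a = \<epsilon> * (b - a)"
proof -
  have \<epsilon>2: "\<epsilon> * \<epsilon> = 1" using \<epsilon> by auto
  define c where "c t = max a (min b t)" for t
  define g where "g t = c t - a - \<epsilon> * (U (c t) - U a)" for t
  define V where "V t = U t + \<epsilon> * g t" for t
  have g_mono: "g s \<le> g t" if "s \<le> t" for s t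
  proof -
    have "c s \<le> c t" using that by (auto simp: c_def)
    then show ?thesis
      using lip1_le[OF U, of "c t" "c s"] \<epsilon> by (auto simp: g_def abs_if split: if_splits)
  qed
  have g_0: "g t = 0" if "t \<le> a" for t
    using that ab by (simp add: g_def c_def)
  have g_b: "g t = g b" if "b \<le> t" for t
    using that ab by (simp add: g_def c_def)
  have V_eq: "V t = U t - U (c t) + U a + \<epsilon> * (c t - a)" for t
    unfolding V_def g_def using \<epsilon>2 by (simp add: algebra_simps flip: mult.assoc)
  have "lip1 V"
    unfolding lip1_def
  proof (intro conjI allI)
    show "V 0 = 0" using g_0[of 0] ab by (simp add: V_def lip1_zero[OF U])
    have le: "\<bar>V t - V s\<bar> \<le> t - s" if "s \<le> t" for s t
    proof -
      have "\<bar>(U t - U (c t)) - (U s - U (c s))\<bar> \<le> (t - s) - (c t - c s)"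
        using that ab lip1_le[OF U, of s t] lip1_le[OF U, of s a] lip1_le[OF U, of b t]
        by (auto simp: c_def max_def min_def)
      moreover have "\<bar>\<epsilon> * (c t - c s)\<bar> = c t - c s"
        using that \<epsilon> by (auto simp: c_def)
      moreover have "V t - V s = ((U t - U (c t)) - (U s - U (c s))) + \<epsilon> * (c t - c s)"
        by (simp add: V_eq algebra_simps)
      ultimately show ?thesis by linarith
    qed
    show "\<bar>V s - V t\<bar> \<le> \<bar>s - t\<bar>" for s t
      using le[of s t] le[of t s] by linarith
  qed
  define m where "m t = y t \<times> q t" for t
  define f where "f t = cos \<alpha> * (drift_axis (sin \<alpha> * U t) \<times> m t) $ 1" for t
  have m: "sol U m" unfolding m_def[abs_def] by (rule sol_cross[OF y(1) q(1)])
  have f_int: "(f has_integral m t $ 1 - m s $ 1) {s..t}" if "s \<le> t" for s t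
    unfolding f_def[abs_def] using that sol_component_1[OF m]
    by (intro fundamental_theorem_of_calculus) (auto simp: has_real_derivative_iff_has_vector_derivative)
  have gf: "((\<lambda>t. g t * f t) has_integral 0) {0..a}"
    by (rule has_integral_is_0) (auto simp: g_0)
  \<comment> \<open>Second mean value theorem for the monotone weight g; the term with g a drops out
    since g a = 0.\<close>
  obtain k where k: "k \<in> {a..b}"
    "((\<lambda>t. g t * f t) has_integral (g a * integral {a..k} f + g b * integral {k..b} f)) {a..b}"
    using second_mean_value_theorem_full[of f a b g] f_int[OF ab(2)] ab(2) g_mono
    by (auto simp: has_integral_iff)
  have gf2: "((\<lambda>t. g t * f t) has_integral g b * (m b $ 1 - m k $ 1)) {a..b}"
    using k f_int[of k b] g_0[of a] by (simp add: integral_unique)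
  have "((\<lambda>t. g b * f t) has_integral g b * (m T $ 1 - m b $ 1)) {b..T}"
    by (intro has_integral_mult_right f_int ab)
  then have gf3: "((\<lambda>t. g t * f t) has_integral g b * (m T $ 1 - m b $ 1)) {b..T}"
  proof (rule has_integral_eq[rotated])
    fix t assume "t \<in> {b..T}"
    then have "g t = g b" by (intro g_b) auto
    then show "g b * f t = g t * f t" by simp
  qed
  have "((\<lambda>t. g t * f t) has_integral 0 + g b * (m b $ 1 - m k $ 1) + g b * (m T $ 1 - m b $ 1)) {0..T}"
    using ab by (intro has_integral_combine[of 0 b T] has_integral_combine[of 0 a b] gf gf2 gf3) auto
  from has_integral_mult_right[OF this, of \<epsilon>]
  have "integral {0..T} (\<lambda>t. (V t - U t) * f t) = \<epsilon> * (g b * (m T $ 1 - m k $ 1))"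
    by (simp add: V_def mult.assoc has_integral_iff Rings.right_diff_distrib)
  moreover have "m T $ 1 * (V T - U T) \<le> integral {0..T} (\<lambda>t. (V t - U t) * f t)"
    using reach_first_variation[OF \<open>0 \<le> T\<close> U y \<open>lip1 V\<close> q max] by (simp add: m_def f_def)
  \<comment> \<open>The boundary terms with m T on the two sides cancel.\<close>
  ultimately have "g b * (\<epsilon> * m k $ 1) \<le> 0"
    using g_b[OF ab(3)] by (simp add: V_def algebra_simps)
  moreover have "0 < \<epsilon> * m k $ 1"
    using pos[OF k(1)] by (simp add: m_def)
  ultimately have "g b \<le> 0"
    by (meson mult_pos_pos not_le)
  moreover have "0 \<le> g b"
    using g_mono[OF ab(2)] g_0[of a] by simp
  ultimately have "b - a = \<epsilon> * (U b - U a)"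
    using ab by (simp add: g_def c_def)
  then show ?thesis using \<epsilon> by auto
qed

(* m plays the role of y \<times> p for the adjoint covector p; p is orthogonal to y, and m 0 to y 0, the north
   pole. The first component of m is the switching function. *)
definition extremal :: "real \<Rightarrow> (real \<Rightarrow> real) \<Rightarrow> (real \<Rightarrow> real^3) \<Rightarrow> bool" where
  "extremal T U m \<longleftrightarrow> lip1 U \<and> sol U m \<and> m 0 \<noteq> 0 \<and> m 0 $ 3 = 0 \<and>
    (\<forall>\<epsilon>\<in>{1, -1}. \<forall>a b. 0 \<le> a \<longrightarrow> a \<le> b \<longrightarrow> b \<le> T \<longrightarrow> (\<forall>t\<in>{a..b}. 0 < \<epsilon> * m t $ 1) \<longrightarrow> U b - U a = \<epsilon> * (b - a))"

text \<open>On the sphere the maximizer of z . w is the point of \<open>reach T\<close> nearest to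
  z. It differs from z, which is outside, and from -z, because some w satisfies - 1 < z . w; hence y
  T and q T are independent and the switching vector does not vanish.\<close>

lemma reach_maximizer:
  assumes "0 \<le> T" "norm z = 1" "z \<notin> reach T" and w: "w \<in> reach T" "- 1 < z \<bullet> w"
  obtains U y m where "extremal T U m" "sol U y" "y 0 = N_pole"
    "\<And>w. w \<in> reach T \<Longrightarrow> z \<bullet> w \<le> z \<bullet> rotx (sin \<alpha> * U T) (y T)"
proof -
  have "\<exists>x\<in>reach T. \<forall>w\<in>reach T. z \<bullet> w \<le> z \<bullet> x"
    using w by (intro continuous_attains_sup compact_reach \<open>0 \<le> T\<close> continuous_intros) auto
  then obtain x where x: "x \<in> reach T" "\<And>w. w \<in> reach T \<Longrightarrow> z \<bullet> w \<le> z \<bullet> x" by blast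
  obtain U y where U: "lip1 U" and y: "sol U y" "y 0 = N_pole" and xe: "x = rotx (sin \<alpha> * U T) (y T)"
    using x(1) by (rule reachE)
  obtain q where q: "sol U q" "q T = rotx (- (sin \<alpha> * U T)) z"
    using sol_exists[OF lip1_continuous[OF U]] by blast
  define m where "m t = y t \<times> q t" for t
  have m: "sol U m" unfolding m_def[abs_def] by (rule sol_cross[OF y(1) q(1)])
  have "norm (y T) = 1" "norm (q T) = 1"
    using sol_norm[OF y(1), of T 0] y(2) assms(2) by (auto simp: q(2))
  moreover have "y T \<bullet> q T = z \<bullet> x"
    unfolding inner_commute[of "y T"] by (simp add: q(2) xe inner_rotx_left)
  ultimately have "(norm (m T))\<^sup>2 + (z \<bullet> x)\<^sup>2 = 1"
    using norm_cross_dot[of "y T" "q T"] by (simp add: m_def)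
  moreover have "(z \<bullet> x)\<^sup>2 < 1"
  proof -
    have "- 1 < z \<bullet> x" using x(2)[OF w(1)] w(2) by linarith
    moreover have "z \<bullet> x < 1"
    proof -
      have "0 < (norm (z - x))\<^sup>2" using assms(3) x(1) by auto
      then show ?thesis using assms(2) norm_reach[OF x(1)] by (simp add: norm_diff_sq_unit)
    qed
    ultimately show ?thesis by (simp add: abs_square_less_1)
  qed
  ultimately have "norm (m T) \<noteq> 0" by auto
  then have "m 0 \<noteq> 0" using sol_norm[OF m, of T 0] by auto
  moreover have "m 0 $ 3 = 0" by (simp add: m_def y(2) cross_components)
  moreover have "U b - U a = \<epsilon> * (b - a)"
    if "\<epsilon> \<in> {1, -1}" "0 \<le> a" "a \<le> b" "b \<le> T" "\<forall>t\<in>{a..b}. 0 < \<epsilon> * m t $ 1" for \<epsilon> a b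
    using that x(2) by (intro maximizer_bang[OF \<open>0 \<le> T\<close> U y q]) (auto simp: m_def xe)
  ultimately have "extremal T U m"
    using U m by (auto simp: extremal_def)
  then show thesis
    by (rule that[OF _ y]) (use x(2) in \<open>simp add: xe\<close>)
qed

end

text \<open>The function is the distance to the nearest multiple of 2 pi, a triangular wave with
  slopes 1 and -1; this gives \<open>wave\<close> its Lipschitz constant.\<close>

lemma arccos_cos_lipschitz: "\<bar>arccos (cos x) - arccos (cos y)\<bar> \<le> \<bar>x - y\<bar>"
proof (cases "\<bar>x - y\<bar> < pi")
  case True
  let ?a = "arccos (cos x)" and ?b = "arccos (cos y)"
  have bnd: "0 \<le> ?a" "?a \<le> pi" "0 \<le> ?b" "?b \<le> pi"
    by (auto intro!: arccos_lbound arccos_ubound)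
  have sin_eq: "sin ?a = \<bar>sin x\<bar>" "sin ?b = \<bar>sin y\<bar>"
    by (auto simp: sin_arccos_abs sin_squared_eq[symmetric])
  have "cos (x - y) \<le> cos x * cos y + \<bar>sin x\<bar> * \<bar>sin y\<bar>"
    unfolding cos_diff abs_mult[symmetric] by simp
  also have "\<dots> = cos (?a - ?b)"
    by (simp add: cos_diff sin_eq)
  finally have "cos \<bar>x - y\<bar> \<le> cos \<bar>?a - ?b\<bar>" by simp
  then show ?thesis
    using True bnd by (subst (asm) cos_mono_le_eq) auto
next
  case False
  have "0 \<le> arccos (cos x)" "arccos (cos x) \<le> pi" "0 \<le> arccos (cos y)" "arccos (cos y) \<le> pi"
    by (auto intro!: arccos_lbound arccos_ubound)
  with False show ?thesis by linarith
qed

lemma rotx_has_vector_derivative: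
  assumes X: "(X has_vector_derivative X') (at t within S)" and p: "(p has_real_derivative p') (at t within S)"
  shows "((\<lambda>t. rotx (p t) (X t)) has_vector_derivative rotx (p t) (X' + p' *\<^sub>R (axis 1 1 \<times> X t))) (at t within S)"
proof -
  have X: "((\<lambda>t. X t $ i) has_real_derivative X' $ i) (at t within S)" for i
    using exhaust_3[of i] X unfolding has_vector_derivative_vec3_iff
    by (auto simp: has_real_derivative_iff_has_vector_derivative)
  show ?thesis
    unfolding has_vector_derivative_vec3_iff has_real_derivative_iff_has_vector_derivative[symmetric]
    by (auto intro!: derivative_eq_intros X p simp: cross_components axis_def algebra_simps)
qed

context bang
begin

section \<open>Bang-bang extremals\<close>

text \<open>F + e G is the cross product with this vector (\<open>field_eq_cross\<close>). For e = 1
  and e = - 1 it is the unit rotation axis of X_+ and X_-.\<close>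

definition axis_of :: "real \<Rightarrow> real^3" where
  "axis_of e = vector [e * sin \<alpha>, 0, cos \<alpha>]"

lemma axis_of_nth [simp]: "axis_of e $ 1 = e * sin \<alpha>" "axis_of e $ 2 = 0" "axis_of e $ 3 = cos \<alpha>"
  by (simp_all add: axis_of_def)

text \<open>Where U has constant slope e, undoing the substitution brings back the autonomous field
  of the constant control e.\<close>

lemma sol_arc:
  assumes y: "sol U y" and U: "\<And>t. t \<in> {a..b} \<Longrightarrow> U t = U a + e * (t - a)"
    and X: "\<And>t. (X has_vector_derivative (axis_of e \<times> X t)) (at t)"
    and Xa: "X a = rotx (sin \<alpha> * U a) (y a)" and t: "t \<in> {a..b}"
  shows "rotx (sin \<alpha> * U t) (y t) = X t"
proof -
  define z where "z r = rotx (- (sin \<alpha> * (e * r))) (X (a + r))" for r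
  have "sol (\<lambda>r. e * r) z"
    unfolding sol_def
  proof
    fix r
    have "((\<lambda>r. X (a + r)) has_vector_derivative axis_of e \<times> X (a + r)) (at r)"
    proof -
      have "((\<lambda>r. a + r) has_vector_derivative 1) (at r)" by (auto intro!: derivative_eq_intros)
      from vector_diff_chain_at[OF this X] show ?thesis by (simp add: o_def)
    qed
    moreover have "((\<lambda>r. - (sin \<alpha> * (e * r))) has_real_derivative - (sin \<alpha> * e)) (at r)"
      by (auto intro!: derivative_eq_intros)
    ultimately have "(z has_vector_derivative rotx (- (sin \<alpha> * (e * r)))
       (axis_of e \<times> X (a + r) + (- (sin \<alpha> * e)) *\<^sub>R (axis 1 1 \<times> X (a + r)))) (at r)"
      unfolding z_def[abs_def] by (rule rotx_has_vector_derivative)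
    moreover have "axis_of e \<times> X (a + r) + (- (sin \<alpha> * e)) *\<^sub>R (axis 1 1 \<times> X (a + r)) = cos \<alpha> *\<^sub>R (drift_axis 0 \<times> X (a + r))"
      by (simp add: eq3_iff cross_components axis_def algebra_simps)
    ultimately show "(z has_vector_derivative cos \<alpha> *\<^sub>R (drift_axis (sin \<alpha> * (e * r)) \<times> z r)) (at r)"
      by (simp add: z_def linear_cmul[OF linear_rotx] rotx_cross rotx_drift_axis)
  qed
  have "rotx (sin \<alpha> * U a) (y (a + (t - a))) = z (t - a)"
  proof (rule sol_agree[OF sol_shift[OF y, of a "U a"] \<open>sol (\<lambda>r. e * r) z\<close>])
    show "U (a + r) - U a = e * r" if "r \<in> {0..t - a}" for r
      using U[of "a + r"] that t by simp
  qed (use t in \<open>auto simp: z_def Xa\<close>)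
  then have "rotx (sin \<alpha> * U a) (y t) = z (t - a)" by simp
  then have "rotx (sin \<alpha> * (e * (t - a))) (rotx (sin \<alpha> * U a) (y t)) = X t"
    by (simp add: z_def rotx_rotx)
  moreover have "sin \<alpha> * (e * (t - a)) + sin \<alpha> * U a = sin \<alpha> * U t"
    by (subst U[OF t]) (simp add: algebra_simps)
  ultimately show ?thesis by (simp add: rotx_rotx)
qed

text \<open>Rodrigues' formula for the rotation by t about \<open>axis_of e\<close>, e being 1 or
  -1.\<close>

definition arc :: "real \<Rightarrow> real^3 \<Rightarrow> real \<Rightarrow> real^3" where
  "arc e x t = cos t *\<^sub>R x + sin t *\<^sub>R (axis_of e \<times> x) + ((1 - cos t) * (axis_of e \<bullet> x)) *\<^sub>R axis_of e"

lemma arc_has_vector_derivative: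
  assumes "e = 1 \<or> e = - 1"
  shows "((\<lambda>t. arc e x (t - a)) has_vector_derivative (axis_of e \<times> arc e x (t - a))) (at t)"
proof -
  have "axis_of e \<bullet> axis_of e = 1"
    using assms by (auto simp: inner3 add.commute simp flip: power2_eq_square)
  then have aa: "axis_of e \<times> (axis_of e \<times> x) = (axis_of e \<bullet> x) *\<^sub>R axis_of e - x"
    by (simp add: Lagrange)
  have "axis_of e \<times> arc e x (t - a) = (- sin (t - a)) *\<^sub>R x + cos (t - a) *\<^sub>R (axis_of e \<times> x)
      + (sin (t - a) * (axis_of e \<bullet> x)) *\<^sub>R axis_of e"
    unfolding arc_def cross_add_right cross_mult_right aa by (simp add: scaleR_diff_right)
  moreover have sc: "((\<lambda>t. f t *\<^sub>R v) has_vector_derivative f' *\<^sub>R v) (at t)"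
    if "(f has_real_derivative f') (at t)" for f f' and v :: "real^3"
    using bounded_linear.has_vector_derivative[OF bounded_linear_scaleR_left, of f f' "at t" v] that
    by (simp add: has_real_derivative_iff_has_vector_derivative)
  have "((\<lambda>t. arc e x (t - a)) has_vector_derivative (- sin (t - a)) *\<^sub>R x + cos (t - a) *\<^sub>R (axis_of e \<times> x)
      + (sin (t - a) * (axis_of e \<bullet> x)) *\<^sub>R axis_of e) (at t)"
    unfolding arc_def
    by (intro has_vector_derivative_add sc) (auto intro!: derivative_eq_intros)
  ultimately show ?thesis by simp
qed

lemma arc_0 [simp]: "arc e x 0 = x"
  by (simp add: arc_def)

lemma axis_inner_arc: "e = 1 \<or> e = - 1 \<Longrightarrow> axis_of e \<bullet> arc e x t = axis_of e \<bullet> x"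
proof -
  assume "e = 1 \<or> e = - 1"
  then have "axis_of e \<bullet> axis_of e = 1"
    by (auto simp: inner3 add.commute simp flip: power2_eq_square)
  then show ?thesis
    by (simp add: arc_def inner_add_right dot_cross_self algebra_simps)
qed

(* gap s = sin s / (cos s + cot^2 \<alpha>), so that period s is the duration v(s) of the interior arcs. *)
definition gap :: "real \<Rightarrow> real" where
  "gap s = (sin \<alpha>)\<^sup>2 * sin s / ((cos \<alpha>)\<^sup>2 + (sin \<alpha>)\<^sup>2 * cos s)"

definition period :: "real \<Rightarrow> real" where
  "period s = pi + 2 * arctan (gap s)"

(* The primitive of a bang-bang control as a single formula, which makes it jointly continuous in s and t. *)
definition wave :: "real \<Rightarrow> real \<Rightarrow> real" where
  "wave s t = s - period s / pi * arccos (cos (pi * (t - s) / period s))"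

text \<open>This is where \<alpha> < pi / 4 enters: the expression is at least cos^2 \<alpha> -
  sin^2 \<alpha>.\<close>

lemma denom_pos: "0 < (cos \<alpha>)\<^sup>2 + (sin \<alpha>)\<^sup>2 * cos s"
proof -
  have "(sin \<alpha>)\<^sup>2 < (cos \<alpha>)\<^sup>2"
    using sin_less_cos sin_pos by (intro power_strict_mono) auto
  moreover have "(sin \<alpha>)\<^sup>2 * (- 1) \<le> (sin \<alpha>)\<^sup>2 * cos s"
    by (intro mult_left_mono) auto
  ultimately show ?thesis by linarith
qed

lemma gap_nonneg: "s \<in> {0..pi} \<Longrightarrow> 0 \<le> gap s"
  unfolding gap_def using denom_pos[of s] by (auto intro!: divide_nonneg_pos mult_nonneg_nonneg sin_ge_zero)

lemma period_ge: "s \<in> {0..pi} \<Longrightarrow> pi \<le> period s"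
  using gap_nonneg[of s] by (simp add: period_def)

lemma period_less: "period s < 2 * pi"
  using arctan_ubound[of "gap s"] by (simp add: period_def)

lemma period_pos: "s \<in> {0..pi} \<Longrightarrow> 0 < period s"
  using period_ge[of s] pi_gt_zero by linarith

lemma wave_lip1:
  assumes "s \<in> {0..pi}"
  shows "lip1 (wave s)"
  unfolding lip1_def
proof (intro conjI allI)
  let ?v = "period s"
  have v: "0 < ?v" "s \<le> ?v" using period_pos period_ge[of s] assms by auto
  have "cos (pi * (0 - s) / ?v) = cos (pi * s / ?v)"
    by simp
  moreover have "arccos (cos (pi * s / ?v)) = pi * s / ?v"
    using v assms by (intro arccos_cos) (auto simp: field_simps)
  ultimately show "wave s 0 = 0"
    using v by (simp add: wave_def)
  fix a b
  have "wave s a - wave s b = ?v / pi * (arccos (cos (pi * (b - s) / ?v)) - arccos (cos (pi * (a - s) / ?v)))"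
    by (simp add: wave_def algebra_simps)
  then have "\<bar>wave s a - wave s b\<bar> = ?v / pi * \<bar>arccos (cos (pi * (b - s) / ?v)) - arccos (cos (pi * (a - s) / ?v))\<bar>"
    using v by (simp add: abs_mult)
  also have "\<dots> \<le> ?v / pi * \<bar>pi * (b - s) / ?v - pi * (a - s) / ?v\<bar>"
    using v by (intro mult_left_mono arccos_cos_lipschitz) auto
  also have "\<dots> = \<bar>?v / pi * (pi * (b - s) / ?v - pi * (a - s) / ?v)\<bar>"
    using v by (simp add: abs_mult)
  also have "?v / pi * (pi * (b - s) / ?v - pi * (a - s) / ?v) = b - a"
    using v by (simp add: field_simps)
  finally show "\<bar>wave s a - wave s b\<bar> \<le> \<bar>a - b\<bar>" by simp
qed

lemma wave_first_arc:
  assumes "s \<in> {0..pi}" "t \<in> {0..s}"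
  shows "wave s t = t"
proof -
  let ?v = "period s"
  have v: "0 < ?v" "s \<le> ?v" using period_pos period_ge[of s] assms by auto
  have "cos (pi * (t - s) / ?v) = cos (pi * (s - t) / ?v)"
    using cos_minus[of "pi * (s - t) / ?v"] by (simp add: algebra_simps minus_divide_left)
  moreover have "arccos (cos (pi * (s - t) / ?v)) = pi * (s - t) / ?v"
    using v assms by (intro arccos_cos) (auto simp: pos_divide_le_eq intro!: mult_left_mono)
  ultimately show ?thesis
    using v by (simp add: wave_def field_simps)
qed

definition switch :: "real \<Rightarrow> nat \<Rightarrow> real" where
  "switch s j = s + j * period s"

lemma wave_arc_value:
  assumes s: "s \<in> {0..pi}" and t: "t \<in> {switch s j..switch s (Suc j)}"
  shows "wave s t = (if even j then s - (t - switch s j) else s - period s + (t - switch s j))"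
proof -
  let ?v = "period s" and ?x = "pi * (t - switch s j) / period s"
  have v: "0 < ?v" using period_pos s by auto
  have "0 \<le> t - switch s j" "t - switch s j \<le> ?v"
    using t by (auto simp: switch_def algebra_simps)
  then have x: "0 \<le> ?x" "?x \<le> pi"
    using v by (auto simp: pos_divide_le_eq)
  have "cos (pi * (t - s) / ?v) = cos (?x + j * pi)"
    using v by (simp add: switch_def field_simps)
  also have "\<dots> = cos (j * pi) * cos ?x"
    by (simp add: cos_add sin_npi)
  finally have c: "cos (pi * (t - s) / ?v) = (- 1) ^ j * cos ?x"
    by (simp add: cos_npi)
  show ?thesis
  proof (cases "even j")
    case True
    then have "arccos (cos (pi * (t - s) / ?v)) = ?x"
      using c x by (simp add: arccos_cos)
    with True v show ?thesis by (simp add: wave_def)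
  next
    case False
    then have "cos (pi * (t - s) / ?v) = cos (pi - ?x)"
      using c by simp
    then have "arccos (cos (pi * (t - s) / ?v)) = pi - ?x"
      using x by (simp only:) (intro arccos_cos; simp)
    with False v show ?thesis by (simp add: wave_def field_simps)
  qed
qed

lemma wave_arc:
  assumes s: "s \<in> {0..pi}" and t: "t \<in> {switch s j..switch s (Suc j)}"
  shows "wave s t = wave s (switch s j) + (- 1) ^ Suc j * (t - switch s j)"
  using wave_arc_value[OF s t] wave_arc_value[OF s, of "switch s j" j] t by auto

lemma switch_mono: "s \<in> {0..pi} \<Longrightarrow> switch s j < switch s (Suc j)"
  using period_pos[of s] by (simp add: switch_def algebra_simps)

lemma switch_unbounded: "s \<in> {0..pi} \<Longrightarrow> \<exists>j. T < switch s j"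
proof -
  assume s: "s \<in> {0..pi}"
  obtain j :: nat where "T / period s < j" using reals_Archimedean2 by blast
  then have "T < j * period s" using period_pos[OF s] by (simp add: field_simps)
  then show ?thesis using s by (intro exI[of _ j]) (auto simp: switch_def)
qed

lemma continuous_on_wave: "continuous_on {p. fst p \<in> {0..pi}} (\<lambda>p. wave (fst p) (snd p))"
proof -
  have p: "continuous_on {p. fst p \<in> {0..pi}} (\<lambda>x::real \<times> real. period (fst x))"
    unfolding period_def gap_def using denom_pos
    by (intro continuous_intros) (auto simp: less_imp_neq[symmetric])
  show ?thesis
    unfolding wave_def
    using period_pos by (intro continuous_intros p) (auto simp: less_imp_neq[symmetric])
qed

lemma sol_arc_arc:
  assumes "sol U y" "\<And>t. t \<in> {a..b} \<Longrightarrow> U t = U a + e * (t - a)" "e = 1 \<or> e = - 1" "t \<in> {a..b}"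
  shows "rotx (sin \<alpha> * U t) (y t) = arc e (rotx (sin \<alpha> * U a) (y a)) (t - a)"
  by (rule sol_arc[OF assms(1,2)]) (use assms(3,4) arc_has_vector_derivative in auto)

text \<open>The sign of m_1 dictates the control, and the control determines m. A continuation
  argument resolves the circle: as long as the sign has been right, m follows the explicit arc in
  \<open>pos\<close>, so the sign cannot be lost before b. If m_1 vanishes at a, its derivative
  there, - cos \<alpha> times the second component of the rotated m, decides; this is the second
  alternative of \<open>init\<close>.\<close>

lemma extremal_arc:
  assumes ext: "extremal T U m" and e: "e = 1 \<or> e = - 1" and ab: "0 \<le> a" "a < b" "b \<le> T"
    and pos: "\<And>t. t \<in> {a<..<b} \<Longrightarrow> 0 < e * arc e (rotx (sin \<alpha> * U a) (m a)) (t - a) $ 1"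
    and init: "0 < e * m a $ 1 \<or> m a $ 1 = 0 \<and> 0 < - e * rotx (sin \<alpha> * U a) (m a) $ 2"
    and t: "t \<in> {a..b}"
  shows "U t = U a + e * (t - a)"
proof -
  have U: "lip1 U" and m: "sol U m" using ext by (auto simp: extremal_def)
  have bang: "U q - U p = e * (q - p)" if "0 \<le> p" "p \<le> q" "q \<le> T" "\<And>r. r \<in> {p..q} \<Longrightarrow> 0 < e * m r $ 1" for p q
    using ext e that unfolding extremal_def by auto
  have cont: "continuous_on UNIV (\<lambda>t. e * m t $ 1)"
    by (intro continuous_intros sol_continuous[OF m])
  have open_pos: "\<exists>d>0. \<forall>r\<in>{x - d<..<x + d}. 0 < e * m r $ 1" if x: "0 < e * m x $ 1" for x
  proof -
    have "open {r. 0 < e * m r $ 1}"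
      by (intro open_Collect_less continuous_on_const cont)
    then obtain d where "0 < d" "ball x d \<subseteq> {r. 0 < e * m r $ 1}"
      using x by (auto simp: open_contains_ball)
    then show ?thesis by (intro exI[of _ d]) (auto simp: ball_eq_greaterThanLessThan)
  qed
  have aff: "U r = U a + e * (r - a)"
    if c: "c \<le> b" "\<And>r. r \<in> {a<..<c} \<Longrightarrow> 0 < e * m r $ 1" and r: "r \<in> {a..c}" "a < c" for c r
  proof -
    \<comment> \<open>\<open>bang\<close> asks for a strict sign on a closed interval, but m_1 may
      vanish at a. So f is shown to be constant in the open interval, and continuity extends this to
      the endpoints.\<close>
    define f where "f r = U r - e * r" for r
    obtain x0 where x0: "x0 \<in> {a<..<c}" using dense[OF r(2)] by auto
    have le: "f q = f p" if "p \<in> {a<..<c}" "q \<in> {a<..<c}" "p \<le> q" for p q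
      using bang[of p q] that c ab by (simp add: f_def algebra_simps)
    have "f x = f x0" if "x \<in> {a<..<c}" for x
      using le[OF x0 that] le[OF that x0] by linarith
    moreover have "continuous_on (closure {a<..<c}) f"
      unfolding f_def by (intro continuous_intros lip1_continuous U)
    ultimately have "f x = f x0" if "x \<in> closure {a<..<c}" for x
      using continuous_constant_on_closure[of "{a<..<c}" f "f x0" x] that by blast
    then have "f r = f a" using r by (metis atLeastAtMost_iff closure_greaterThanLessThan less_imp_le order_refl)
    then show ?thesis by (simp add: f_def algebra_simps)
  qed
  define S where "S = {c. a < c \<and> c \<le> b \<and> (\<forall>r\<in>{a<..<c}. 0 < e * m r $ 1)}"
  have "\<exists>d>0. \<forall>r\<in>{a<..<a + d}. 0 < e * m r $ 1"
    using init
  proof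
    assume "0 < e * m a $ 1"
    then obtain d where "d > 0" "\<forall>r\<in>{a - d<..<a + d}. 0 < e * m r $ 1" using open_pos by blast
    then show ?thesis by (intro exI[of _ d]) auto
  next
    assume A: "m a $ 1 = 0 \<and> 0 < - e * rotx (sin \<alpha> * U a) (m a) $ 2"
    have der: "((\<lambda>t. e * m t $ 1) has_real_derivative e * (cos \<alpha> * (drift_axis (sin \<alpha> * U a) \<times> m a) $ 1)) (at a)"
      by (intro DERIV_cmult sol_component_1 m)
    have "(drift_axis (sin \<alpha> * U a) \<times> m a) $ 1 = - rotx (sin \<alpha> * U a) (m a) $ 2"
      by (simp add: cross_components)
    moreover have "0 < cos \<alpha> * (- e * rotx (sin \<alpha> * U a) (m a) $ 2)"
      by (rule mult_pos_pos[OF cos_pos conjunct2[OF A]])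
    ultimately have "0 < e * (cos \<alpha> * (drift_axis (sin \<alpha> * U a) \<times> m a) $ 1)"
      by (simp only: mult_minus_left mult_minus_right mult.left_commute)
    from DERIV_pos_inc_right[OF der this]
    obtain d where "0 < d" "\<And>h. 0 < h \<Longrightarrow> h < d \<Longrightarrow> e * m a $ 1 < e * m (a + h) $ 1"
      by blast
    then have "0 < e * m r $ 1" if "r \<in> {a<..<a + d}" for r
      using A that \<open>\<And>h. 0 < h \<Longrightarrow> h < d \<Longrightarrow> e * m a $ 1 < e * m (a + h) $ 1\<close>[of "r - a"] by simp
    then show ?thesis using \<open>0 < d\<close> by blast
  qed
  then obtain d where d: "d > 0" "\<forall>r\<in>{a<..<a + d}. 0 < e * m r $ 1" by blast
  have "min b (a + d) \<in> S" using d ab by (auto simp: S_def)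
  then have ne: "S \<noteq> {}" by blast
  have bdd: "bdd_above S" by (auto simp: S_def bdd_above_def)
  define c where "c = Sup S"
  have "a < c" using cSup_upper[OF \<open>min b (a + d) \<in> S\<close> bdd] d ab by (auto simp: c_def)
  moreover have "c \<le> b" unfolding c_def using ne by (intro cSup_least) (auto simp: S_def)
  moreover have c_pos: "0 < e * m r $ 1" if "r \<in> {a<..<c}" for r
  proof -
    have "\<exists>c'\<in>S. r < c'" using that less_cSup_iff[OF ne bdd, of r] by (simp add: c_def)
    then obtain c' where "c' \<in> S" "r < c'" by blast
    then show ?thesis using that by (auto simp: S_def)
  qed
  moreover have "c = b"
  proof (rule ccontr)
    assume "c \<noteq> b"
    then have "c < b" using \<open>c \<le> b\<close> by simp
    have "rotx (sin \<alpha> * U c) (m c) = arc e (rotx (sin \<alpha> * U a) (m a)) (c - a)"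
      by (rule sol_arc_arc[OF m aff[OF \<open>c \<le> b\<close> c_pos]]) (use \<open>a < c\<close> e in auto)
    then have "m c $ 1 = arc e (rotx (sin \<alpha> * U a) (m a)) (c - a) $ 1"
      by (metis rotx_nth(1))
    then have "0 < e * m c $ 1" using pos[of c] \<open>a < c\<close> \<open>c < b\<close> by simp
    then obtain d where d: "d > 0" "\<forall>r\<in>{c - d<..<c + d}. 0 < e * m r $ 1" using open_pos by blast
    have "min b (c + d) \<in> S"
      unfolding S_def
    proof (intro CollectI conjI ballI)
      fix r assume "r \<in> {a<..<min b (c + d)}"
      then show "0 < e * m r $ 1"
        using c_pos[of r] d by (cases "r < c") auto
    qed (use d \<open>a < c\<close> \<open>c < b\<close> in auto)
    from cSup_upper[OF this bdd] show False using d \<open>c < b\<close> by (auto simp: c_def[symmetric])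
  qed
  ultimately show ?thesis using aff[of c t] t by simp
qed

text \<open>The direction in the plane m_3 = 0 that the rotation about \<open>axis_of 1\<close> by
  the angle s carries into m_1 = 0 (\<open>arc_mu_end\<close>): the initial switching vector with
  first switch at time s.\<close>

definition mu :: "real \<Rightarrow> real^3" where
  "mu s = vector [cos \<alpha> * sin s, (cos \<alpha>)\<^sup>2 * cos s + (sin \<alpha>)\<^sup>2, 0]"

text \<open>The rotated switching vector at the j-th switch (\<open>wave_costate_node\<close>); only
  its second component alternates in sign.\<close>

definition node :: "real \<Rightarrow> nat \<Rightarrow> real^3" where
  "node s j = vector [0, (- 1) ^ j * ((cos \<alpha>)\<^sup>2 + (sin \<alpha>)\<^sup>2 * cos s), sin \<alpha> * sin s]"

lemma mu_nth [simp]: "mu s $ 1 = cos \<alpha> * sin s" "mu s $ 2 = (cos \<alpha>)\<^sup>2 * cos s + (sin \<alpha>)\<^sup>2" "mu s $ 3 = 0"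
  by (simp_all add: mu_def)

lemma node_nth [simp]: "node s j $ 1 = 0" "node s j $ 2 = (- 1) ^ j * ((cos \<alpha>)\<^sup>2 + (sin \<alpha>)\<^sup>2 * cos s)"
  "node s j $ 3 = sin \<alpha> * sin s"
  by (simp_all add: node_def)

lemma arc_nth:
  "arc e x t $ 1 = cos t * x$1 - sin t * (cos \<alpha> * x$2) + (1 - cos t) * (e * sin \<alpha> * x$1 + cos \<alpha> * x$3) * (e * sin \<alpha>)"
  "arc e x t $ 2 = cos t * x$2 + sin t * (cos \<alpha> * x$1 - e * sin \<alpha> * x$3)"
  "arc e x t $ 3 = cos t * x$3 + sin t * (e * sin \<alpha> * x$2) + (1 - cos t) * (e * sin \<alpha> * x$1 + cos \<alpha> * x$3) * cos \<alpha>"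
  by (simp_all add: arc_def cross_components inner3)

lemma arc_mu_1:
  "arc 1 (mu s) t $ 1 = cos \<alpha> * (2 * sin ((s - t) / 2) * ((sin \<alpha>)\<^sup>2 * cos ((s + t) / 2) + (cos \<alpha>)\<^sup>2 * cos ((s - t) / 2)))"
proof -
  have 1: "2 * sin ((s - t) / 2) * cos ((s + t) / 2) = sin s - sin t"
    using sin_diff_sin[of s t] by (simp add: mult_ac)
  have 2: "2 * sin ((s - t) / 2) * cos ((s - t) / 2) = sin s * cos t - cos s * sin t"
  proof -
    have "2 * ((s - t) / 2) = s - t" by simp
    from sin_double[of "(s - t) / 2", unfolded this] show ?thesis by (simp add: sin_diff)
  qed
  have "arc 1 (mu s) t $ 1 = cos \<alpha> * ((sin \<alpha>)\<^sup>2 * (sin s - sin t) + (cos \<alpha>)\<^sup>2 * (sin s * cos t - cos s * sin t))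
    + cos \<alpha> * sin s * cos t * (1 - (sin \<alpha>)\<^sup>2 - (cos \<alpha>)\<^sup>2)"
    by (simp only: arc_nth mu_nth) algebra
  also have "1 - (sin \<alpha>)\<^sup>2 - (cos \<alpha>)\<^sup>2 = 0" by (simp add: cos_squared_eq)
  finally show ?thesis
    unfolding 1[symmetric] 2[symmetric] by (simp add: algebra_simps)
qed

text \<open>In \<open>arc_mu_1\<close> the bracket is at least (cos^2 \<alpha> - sin^2 \<alpha>) cos
  ((s - t) / 2), because the two cosines have a nonnegative sum. The bound s - t < pi excludes s =
  pi, t = 0, where the switching function starts from zero.\<close>

lemma arc_mu_pos:
  assumes "0 \<le> t" "t < s" "s \<le> pi" "s - t < pi"
  shows "0 < arc 1 (mu s) t $ 1"
proof -
  have "0 < sin ((s - t) / 2)" "0 < cos ((s - t) / 2)"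
    using assms by (auto intro!: sin_gt_zero cos_gt_zero_pi)
  moreover have "0 \<le> cos ((s + t) / 2) + cos ((s - t) / 2)"
    unfolding cos_plus_cos using assms by (auto intro!: mult_nonneg_nonneg cos_ge_zero simp: field_simps)
  moreover have "(sin \<alpha>)\<^sup>2 < (cos \<alpha>)\<^sup>2"
    using sin_less_cos sin_pos by (intro power_strict_mono) auto
  ultimately have "0 < (cos \<alpha>)\<^sup>2 * cos ((s - t) / 2) - (sin \<alpha>)\<^sup>2 * cos ((s - t) / 2)"
     "0 \<le> (sin \<alpha>)\<^sup>2 * (cos ((s + t) / 2) + cos ((s - t) / 2))"
    by (auto simp flip: Rings.left_diff_distrib)
  then have "0 < (sin \<alpha>)\<^sup>2 * cos ((s + t) / 2) + (cos \<alpha>)\<^sup>2 * cos ((s - t) / 2)"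
    by (simp add: algebra_simps)
  then show ?thesis
    unfolding arc_mu_1 using \<open>0 < sin ((s - t) / 2)\<close> cos_pos by simp
qed

lemma arc_mu_end: "arc 1 (mu s) s = node s 0"
proof -
  have a: "(sin \<alpha>)\<^sup>2 + (cos \<alpha>)\<^sup>2 = 1" and b: "(sin s)\<^sup>2 + (cos s)\<^sup>2 = 1" by simp_all
  have "arc 1 (mu s) s $ 2 = (cos \<alpha>)\<^sup>2 * ((sin s)\<^sup>2 + (cos s)\<^sup>2) + (sin \<alpha>)\<^sup>2 * cos s"
    by (simp only: arc_nth mu_nth) algebra
  moreover have "arc 1 (mu s) s $ 3 = sin \<alpha> * sin s * ((sin \<alpha>)\<^sup>2 + (cos \<alpha>)\<^sup>2)"
    by (simp only: arc_nth mu_nth) algebra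
  ultimately show ?thesis
    by (simp add: eq3_iff arc_mu_1)
qed

lemma gap_denom: "gap s * ((cos \<alpha>)\<^sup>2 + (sin \<alpha>)\<^sup>2 * cos s) = (sin \<alpha>)\<^sup>2 * sin s"
  using denom_pos[of s] by (simp add: gap_def)

lemma arc_node_1:
  "(- 1) ^ Suc j * arc ((- 1) ^ Suc j) (node s j) t $ 1
    = cos \<alpha> * ((cos \<alpha>)\<^sup>2 + (sin \<alpha>)\<^sup>2 * cos s) * (sin t + gap s * (1 - cos t))"
proof -
  have "cos \<alpha> * ((cos \<alpha>)\<^sup>2 + (sin \<alpha>)\<^sup>2 * cos s) * (sin t + gap s * (1 - cos t))
    = cos \<alpha> * (((cos \<alpha>)\<^sup>2 + (sin \<alpha>)\<^sup>2 * cos s) * sin t + (1 - cos t) * (gap s * ((cos \<alpha>)\<^sup>2 + (sin \<alpha>)\<^sup>2 * cos s)))"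
    by (simp add: algebra_simps)
  then show ?thesis
    unfolding gap_denom
    by (cases "even j") (simp_all add: arc_nth algebra_simps power2_eq_square)
qed

lemma gap_period: "sin (period s / 2) = cos (arctan (gap s))" "cos (period s / 2) = - (gap s * cos (arctan (gap s)))"
proof -
  have h: "period s / 2 = pi / 2 + arctan (gap s)" by (simp add: period_def field_simps)
  show "sin (period s / 2) = cos (arctan (gap s))"
    unfolding h by (simp add: sin_add)
  have "sin (arctan (gap s)) = gap s * cos (arctan (gap s))"
    using tan_arctan[of "gap s"] cos_arctan_not_zero[of "gap s"] by (simp add: tan_def field_simps)
  then show "cos (period s / 2) = - (gap s * cos (arctan (gap s)))"
    unfolding h by (simp add: cos_add)
qed

text \<open>In half angles the expression is 2 sin (t/2) (cos (t/2) + gap s sin (t/2)), and the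
  bracket is proportional to cos (t/2 - arctan (gap s)), which first vanishes at t =
  \<open>period s\<close>. This is the origin of the duration of the interior arcs.\<close>

lemma sin_gap_pos:
  assumes s: "s \<in> {0..pi}" and "0 < t" "t < period s"
  shows "0 < sin t + gap s * (1 - cos t)"
proof -
  let ?A = "arctan (gap s)"
  have A: "0 \<le> ?A" "?A < pi / 2" using gap_nonneg[OF s] arctan_ubound[of "gap s"] by simp_all
  have t: "0 < t / 2" "t / 2 < pi" using assms(2,3) period_less[of s] by auto
  have "0 < cos (t / 2 - ?A)"
    using assms(2,3) A by (intro cos_gt_zero_pi) (auto simp: period_def)
  moreover have "cos (t / 2 - ?A) = cos ?A * (cos (t / 2) + gap s * sin (t / 2))"
    using tan_arctan[of "gap s"] cos_arctan_not_zero[of "gap s"] unfolding cos_diff by (simp add: tan_def field_simps)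
  moreover have "0 < cos ?A" using A pi_gt_zero by (intro cos_gt_zero_pi) linarith+
  ultimately have "0 < cos (t / 2) + gap s * sin (t / 2)" by (simp add: zero_less_mult_iff)
  moreover have "sin t + gap s * (1 - cos t) = 2 * sin (t / 2) * (cos (t / 2) + gap s * sin (t / 2))"
  proof -
    have "sin t = 2 * sin (t / 2) * cos (t / 2)" "1 - cos t = 2 * (sin (t / 2))\<^sup>2"
      using sin_double[of "t / 2"] cos_double_sin[of "t / 2"] by simp_all
    then show ?thesis by (simp only:) (simp add: algebra_simps power2_eq_square)
  qed
  moreover have "0 < sin (t / 2)" using t by (rule sin_gt_zero)
  ultimately show ?thesis by simp
qed

lemma arc_node_pos:
  assumes "s \<in> {0..pi}" "0 < t" "t < period s"
  shows "0 < (- 1) ^ Suc j * arc ((- 1) ^ Suc j) (node s j) t $ 1"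
  unfolding arc_node_1 using sin_gap_pos[OF assms] denom_pos[of s] cos_pos by simp

lemma gap_period_full: "sin (period s) + gap s * (1 - cos (period s)) = 0" "cos (period s) + gap s * sin (period s) = - 1"
    "gap s * (1 + cos (period s)) + gap s * gap s * sin (period s) = 0"
proof -
  let ?c = "cos (arctan (gap s))"
  have c: "?c\<^sup>2 * (1 + (gap s)\<^sup>2) = 1"
    using cos_arctan[of "gap s"] by (simp add: power_divide add_pos_nonneg less_imp_neq[symmetric])
  have s2: "sin (period s) = - 2 * gap s * ?c\<^sup>2" "cos (period s) = 1 - 2 * ?c\<^sup>2"
    using sin_double[of "period s / 2"] cos_double_sin[of "period s / 2"]
    by (simp_all add: gap_period power2_eq_square)
  show "sin (period s) + gap s * (1 - cos (period s)) = 0" unfolding s2 by (simp add: algebra_simps)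
  show 2: "cos (period s) + gap s * sin (period s) = - 1" 
    using c unfolding s2 by (simp add: algebra_simps power2_eq_square)
  show "gap s * (1 + cos (period s)) + gap s * gap s * sin (period s) = 0"
    using 2 by algebra
qed

text \<open>The first component vanishes by the choice of \<open>period\<close>, the third is
  preserved because the component along the axis is, and the second follows from
  \<open>gap_period_full\<close>.\<close>

lemma arc_node_end: "arc ((- 1) ^ Suc j) (node s j) (period s) = node s (Suc j)"
proof -
  let ?e = "(- 1) ^ Suc j :: real" and ?D = "(cos \<alpha>)\<^sup>2 + (sin \<alpha>)\<^sup>2 * cos s"
  have e: "?e * ?e = 1" by (simp flip: power_mult_distrib)
  have e': "?e = 1 \<or> ?e = - 1" by (cases "even j") auto
  have 1: "arc ?e (node s j) (period s) $ 1 = 0"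
    using arc_node_1[of j s "period s"] e' by (auto simp: gap_period_full)
  have "arc ?e (node s j) (period s) $ 2 = - ?e * (cos (period s) * ?D + sin (period s) * ((sin \<alpha>)\<^sup>2 * sin s))"
    by (cases "even j") (simp_all add: arc_nth algebra_simps power2_eq_square)
  also have "\<dots> = - ?e * ((cos (period s) + gap s * sin (period s)) * ?D)"
    unfolding gap_denom[symmetric] by (simp add: algebra_simps)
  also have "\<dots> = ?e * ?D"
    unfolding gap_period_full by (simp only: mult_minus_left mult_minus_right mult_1_left minus_minus)
  finally have 2: "arc ?e (node s j) (period s) $ 2 = ?e * ?D" .
  have "cos \<alpha> * arc ?e (node s j) (period s) $ 3 = cos \<alpha> * (sin \<alpha> * sin s)"
    using axis_inner_arc[OF e', of "node s j" "period s"] unfolding inner3 axis_of_nth node_nth 1 by simp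
  then have "arc ?e (node s j) (period s) $ 3 = sin \<alpha> * sin s"
    using cos_pos by simp
  with 1 2 show ?thesis unfolding eq3_iff node_nth by simp
qed

end

(* Conjugation by mirror preserves F and changes the sign of G, hence exchanges u and - u. *)
definition mirror :: "real^3 \<Rightarrow> real^3" where
  "mirror x = vector [- x$1, - x$2, x$3]"

lemma mirror_nth [simp]: "mirror x $ 1 = - x$1" "mirror x $ 2 = - x$2" "mirror x $ 3 = x$3"
  by (simp_all add: mirror_def)

lemma linear_mirror: "linear mirror"
  by (rule linearI) (auto simp: eq3_iff)

lemma mirror_rotx: "mirror (rotx p x) = rotx (- p) (mirror x)"
  by (simp add: eq3_iff)

lemma lip1_uminus: "lip1 U \<Longrightarrow> lip1 (\<lambda>t. - U t)"
  by (simp add: lip1_def abs_minus_commute)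

section \<open>The extremal with a given first switching time\<close>

context bang
begin

lemma sol_mirror:
  assumes "sol U y"
  shows "sol (\<lambda>t. - U t) (\<lambda>t. mirror (y t))"
  unfolding sol_def
proof
  fix t
  have "((\<lambda>t. mirror (y t)) has_vector_derivative mirror (cos \<alpha> *\<^sub>R (drift_axis (sin \<alpha> * U t) \<times> y t))) (at t)"
    by (intro bounded_linear.has_vector_derivative[OF linear_conv_bounded_linear[THEN iffD1, OF linear_mirror]] solD assms)
  moreover have "mirror (cos \<alpha> *\<^sub>R (drift_axis (sin \<alpha> * U t) \<times> y t)) = cos \<alpha> *\<^sub>R (drift_axis (sin \<alpha> * - U t) \<times> mirror (y t))"
    by (simp add: eq3_iff cross_components algebra_simps)
  ultimately show "((\<lambda>t. mirror (y t)) has_vector_derivative cos \<alpha> *\<^sub>R (drift_axis (sin \<alpha> * - U t) \<times> mirror (y t))) (at t)"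
    by simp
qed

lemma extremal_mirror:
  assumes "extremal T U m"
  shows "extremal T (\<lambda>t. - U t) (\<lambda>t. mirror (m t))"
proof -
  have *: "lip1 U" "sol U m" "m 0 \<noteq> 0" "m 0 $ 3 = 0"
    and bang: "\<And>\<epsilon> a b. \<lbrakk>\<epsilon> \<in> {1, -1}; 0 \<le> a; a \<le> b; b \<le> T; \<forall>t\<in>{a..b}. 0 < \<epsilon> * m t $ 1\<rbrakk> \<Longrightarrow> U b - U a = \<epsilon> * (b - a)"
    using assms unfolding extremal_def by blast+
  have "mirror (m 0) \<noteq> 0" using *(3) by (simp add: eq3_iff)
  moreover have "- U b - - U a = \<epsilon> * (b - a)"
    if "\<epsilon> \<in> {1, -1}" "0 \<le> a" "a \<le> b" "b \<le> T" "\<forall>t\<in>{a..b}. 0 < \<epsilon> * mirror (m t) $ 1" for \<epsilon> a b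
    using bang[of "- \<epsilon>" a b] that by auto
  ultimately show ?thesis
    using * unfolding extremal_def by (auto simp: lip1_uminus sol_mirror)
qed

lemma extremal_scaleR:
  assumes "extremal T U m" "0 < k"
  shows "extremal T U (\<lambda>t. k *\<^sub>R m t)"
proof -
  have "0 < \<epsilon> * (k *\<^sub>R m t) $ 1 \<longleftrightarrow> 0 < \<epsilon> * m t $ 1" for \<epsilon> t
  proof -
    have "\<epsilon> * (k *\<^sub>R m t) $ 1 = k * (\<epsilon> * m t $ 1)" by simp
    then show ?thesis using \<open>0 < k\<close> by (metis mult_pos_pos zero_less_mult_pos)
  qed
  then show ?thesis
    using assms unfolding extremal_def by (auto simp: sol_scaleR)
qed

lemma wave_traj_first:
  assumes "sol U y" "s \<in> {0..pi}" "\<And>t. t \<in> {0..T} \<Longrightarrow> U t = wave s t" "t \<in> {0..s}" "t \<le> T"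
  shows "rotx (sin \<alpha> * U t) (y t) = arc 1 (y 0) t"
proof -
  have "U 0 = 0" using assms wave_first_arc[OF assms(2), of 0] by auto
  then have "rotx (sin \<alpha> * U t) (y t) = arc 1 (rotx (sin \<alpha> * U 0) (y 0)) (t - 0)"
    using assms by (intro sol_arc_arc[where b = t]) (auto simp: wave_first_arc)
  then show ?thesis using \<open>U 0 = 0\<close> by simp
qed

lemma switch_nonneg: "s \<in> {0..pi} \<Longrightarrow> 0 \<le> switch s j"
  using period_pos[of s] by (auto simp: switch_def)

lemma wave_traj_arc:
  assumes "sol U y" "s \<in> {0..pi}" "\<And>t. t \<in> {0..T} \<Longrightarrow> U t = wave s t"
    "t \<in> {switch s j..switch s (Suc j)}" "t \<le> T"
  shows "rotx (sin \<alpha> * U t) (y t) = arc ((- 1) ^ Suc j) (rotx (sin \<alpha> * U (switch s j)) (y (switch s j))) (t - switch s j)"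
proof (rule sol_arc_arc[OF assms(1), where b = t])
  fix r assume "r \<in> {switch s j..t}"
  then show "U r = U (switch s j) + (- 1) ^ Suc j * (r - switch s j)"
    using assms(3)[of r] assms(3)[of "switch s j"] wave_arc[OF assms(2), of r j] switch_nonneg[OF assms(2), of j] assms(4,5)
    by auto
next
  show "(- 1) ^ Suc j = (1::real) \<or> (- 1) ^ Suc j = (- 1 :: real)"
    by (cases "even j") auto
next
  show "t \<in> {switch s j..t}" using assms(4) by simp
qed

lemma wave_costate_node:
  assumes "sol U m" "s \<in> {0..pi}" "\<And>t. t \<in> {0..T} \<Longrightarrow> U t = wave s t" "m 0 = mu s" "switch s j \<le> T"
  shows "rotx (sin \<alpha> * U (switch s j)) (m (switch s j)) = node s j"
  using assms(5)
proof (induction j)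
  case 0
  then show ?case
    using wave_traj_first[OF assms(1-3), of s] assms(2,4) by (simp add: switch_def arc_mu_end)
next
  case (Suc j)
  then have "rotx (sin \<alpha> * U (switch s j)) (m (switch s j)) = node s j"
    using switch_mono[OF assms(2), of j] by simp
  moreover have "rotx (sin \<alpha> * U (switch s (Suc j))) (m (switch s (Suc j)))
      = arc ((- 1) ^ Suc j) (rotx (sin \<alpha> * U (switch s j)) (m (switch s j))) (switch s (Suc j) - switch s j)"
    using Suc.prems switch_mono[OF assms(2), of j] by (intro wave_traj_arc[OF assms(1-3)]) auto
  moreover have "switch s (Suc j) - switch s j = period s"
    by (simp add: switch_def algebra_simps)
  ultimately show ?case by (simp only: arc_node_end)
qed

text \<open>Induction over the switches: from one node on, the explicit arc has a switching function
  of the right sign up to the next node, so \<open>extremal_arc\<close> fixes the control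
  there.\<close>

lemma extremal_eq_wave:
  assumes ext: "extremal T U m" and s: "s \<in> {0<..pi}" and m0: "m 0 = mu s" and "t \<in> {0..T}"
  shows "U t = wave s t"
proof -
  have s': "s \<in> {0..pi}" using s by auto
  have U: "lip1 U" and m: "sol U m" using ext by (auto simp: extremal_def)
  have sc: "(sin \<alpha>)\<^sup>2 < (cos \<alpha>)\<^sup>2"
    using sin_less_cos sin_pos by (intro power_strict_mono) auto
  have "\<forall>t\<in>{0..min T (switch s j)}. U t = wave s t" for j
  proof (induction j)
    case 0
    show ?case
    proof
      fix t assume t: "t \<in> {0..min T (switch s 0)}"
      have "U t = U 0 + 1 * (t - 0)" if "0 < t"
      proof (rule extremal_arc[OF ext, where b = t])
        show "0 < 1 * arc 1 (rotx (sin \<alpha> * U 0) (m 0)) (r - 0) $ 1" if "r \<in> {0<..<t}" for r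
          using arc_mu_pos[of r s] that t s by (simp add: lip1_zero[OF U] m0 switch_def)
        show "0 < 1 * m 0 $ 1 \<or> m 0 $ 1 = 0 \<and> 0 < - 1 * rotx (sin \<alpha> * U 0) (m 0) $ 2"
        proof (cases "s < pi")
          case True
          then have "0 < sin s" using s by (intro sin_gt_zero) auto
          then show ?thesis using cos_pos by (simp add: m0)
        next
          \<comment> \<open>For s = pi the switching function vanishes at time 0; the second
            component sin^2 \<alpha> - cos^2 \<alpha> < 0 of \<open>mu pi\<close> decides its sign
            afterwards.\<close>
          case False
          then have "s = pi" using s by auto
          then show ?thesis using sc by (simp add: m0 lip1_zero[OF U])
        qed
      qed (use t that in auto)
      then show "U t = wave s t"
        using t wave_first_arc[OF s', of t] lip1_zero[OF U] by (cases "t = 0") (auto simp: switch_def)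
    qed
  next
    case (Suc j)
    let ?a = "switch s j" and ?e = "(- 1) ^ Suc j :: real"
    have e: "?e = 1 \<or> ?e = - 1" by (cases "even j") auto
    show ?case
    proof
      fix t assume t: "t \<in> {0..min T (switch s (Suc j))}"
      show "U t = wave s t"
      proof (cases "t \<le> ?a")
        case True
        with t Suc.IH show ?thesis by auto
      next
        case False
        have IH: "U r = wave s r" if "r \<in> {0..?a}" for r
          using Suc.IH that t False by auto
        have nd: "rotx (sin \<alpha> * U ?a) (m ?a) = node s j"
          using m0 IH by (intro wave_costate_node[OF m s', where T = ?a]) auto
        have "U t = U ?a + ?e * (t - ?a)"
        proof (rule extremal_arc[OF ext e, where b = t])
          show "0 < ?e * arc ?e (rotx (sin \<alpha> * U ?a) (m ?a)) (r - ?a) $ 1" if "r \<in> {?a<..<t}" for r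
            unfolding nd using that t by (intro arc_node_pos s') (auto simp: switch_def algebra_simps)
          have "m ?a $ 1 = 0" using nd by (metis node_nth(1) rotx_nth(1))
          moreover have "0 < - ?e * node s j $ 2"
            using denom_pos[of s] by (simp add: mult.assoc[symmetric] flip: power_add power2_eq_square)
          ultimately show "0 < ?e * m ?a $ 1 \<or> m ?a $ 1 = 0 \<and> 0 < - ?e * rotx (sin \<alpha> * U ?a) (m ?a) $ 2"
            unfolding nd by blast
        qed (use t False switch_nonneg[OF s'] in auto)
        then show ?thesis
          using wave_arc[OF s', of t j] IH[of ?a] t False switch_nonneg[OF s'] by auto
      qed
    qed
  qed
  moreover obtain j where "T < switch s j" using switch_unbounded[OF s'] by blast
  ultimately show ?thesis using \<open>t \<in> {0..T}\<close> by (metis min.absorb1 less_imp_le)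
qed

text \<open>Between s = 0 and s = pi the vector \<open>mu s\<close> turns from the positive to the
  negative second axis, so its positive and negative multiples fill the whole plane.\<close>

lemma mu_direction:
  assumes "x $ 3 = 0" "x \<noteq> 0"
  obtains s k where "s \<in> {0<..pi}" "0 < k" "x = k *\<^sub>R mu s \<or> x = (- k) *\<^sub>R mu s"
proof (cases "x $ 1 = 0")
  case True
  have sc: "0 < (cos \<alpha>)\<^sup>2 - (sin \<alpha>)\<^sup>2"
    using sin_less_cos sin_pos by (simp add: power_strict_mono)
  have "x $ 2 \<noteq> 0" using assms True by (auto simp: eq3_iff)
  show thesis
  proof (rule that[of pi "\<bar>x $ 2\<bar> / ((cos \<alpha>)\<^sup>2 - (sin \<alpha>)\<^sup>2)"])
    show "0 < \<bar>x $ 2\<bar> / ((cos \<alpha>)\<^sup>2 - (sin \<alpha>)\<^sup>2)" using sc \<open>x $ 2 \<noteq> 0\<close> by simp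
    have "\<bar>x $ 2\<bar> / ((cos \<alpha>)\<^sup>2 - (sin \<alpha>)\<^sup>2) * ((sin \<alpha>)\<^sup>2 - (cos \<alpha>)\<^sup>2) = - \<bar>x $ 2\<bar>"
      using sc by (simp add: field_simps)
    then show "x = (\<bar>x $ 2\<bar> / ((cos \<alpha>)\<^sup>2 - (sin \<alpha>)\<^sup>2)) *\<^sub>R mu pi \<or> x = (- (\<bar>x $ 2\<bar> / ((cos \<alpha>)\<^sup>2 - (sin \<alpha>)\<^sup>2))) *\<^sub>R mu pi"
      using assms True by (simp add: eq3_iff abs_if)
  qed auto
next
  case False
  \<comment> \<open>The determinant of x and \<open>mu t\<close>; at a zero the two vectors are
    parallel.\<close>
  define f where "f t = x$1 * ((cos \<alpha>)\<^sup>2 * cos t + (sin \<alpha>)\<^sup>2) - x$2 * (cos \<alpha> * sin t)" for t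
  have sc: "0 < (cos \<alpha>)\<^sup>2 - (sin \<alpha>)\<^sup>2"
    using sin_less_cos sin_pos by (simp add: power_strict_mono)
  have f0: "f 0 = x$1" and fpi: "f pi = - (x$1 * ((cos \<alpha>)\<^sup>2 - (sin \<alpha>)\<^sup>2))"
    by (simp_all add: f_def algebra_simps)
  have cf: "continuous_on {0..pi} f" unfolding f_def by (intro continuous_intros)
  have "\<exists>s. 0 \<le> s \<and> s \<le> pi \<and> f s = 0"
  proof (cases "0 < x$1")
    case True
    then show ?thesis using sc by (intro IVT2'[OF _ _ _ cf]) (auto simp: f0 fpi)
  next
    case False
    then show ?thesis using sc by (intro IVT'[OF _ _ _ cf]) (auto simp: f0 fpi mult_le_0_iff)
  qed
  then obtain s where s: "0 \<le> s" "s \<le> pi" "f s = 0" by blast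
  have "s \<noteq> 0" "s \<noteq> pi" using s f0 fpi False sc by auto
  then have "0 < sin s" using s by (intro sin_gt_zero) auto
  then have cs: "0 < cos \<alpha> * sin s" using cos_pos by simp
  let ?k = "x$1 / (cos \<alpha> * sin s)"
  have "x = ?k *\<^sub>R mu s"
    using s(3) \<open>0 < sin s\<close> cos_pos assms(1) by (simp add: eq3_iff f_def field_simps)
  moreover have "0 < \<bar>?k\<bar>" using cs False by simp
  ultimately show thesis using s \<open>s \<noteq> 0\<close> by (intro that[of s "\<bar>?k\<bar>"]) (auto simp: abs_if)
qed

lemma extremal_cases:
  assumes ext: "extremal T U m"
  obtains s e where "s \<in> {0<..pi}" "e = 1 \<or> e = - 1" "\<And>t. t \<in> {0..T} \<Longrightarrow> U t = e * wave s t"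
proof -
  have "m 0 $ 3 = 0" "m 0 \<noteq> 0" using ext by (auto simp: extremal_def)
  then obtain s k where s: "s \<in> {0<..pi}" and k: "0 < k" "m 0 = k *\<^sub>R mu s \<or> m 0 = (- k) *\<^sub>R mu s"
    by (rule mu_direction)
  from k(2) show thesis
  proof
    assume m: "m 0 = k *\<^sub>R mu s"
    have "extremal T U (\<lambda>t. inverse k *\<^sub>R m t)"
      by (rule extremal_scaleR[OF ext]) (use k in auto)
    from extremal_eq_wave[OF this s] show thesis
      using k m by (intro that[OF s, of 1]) auto
  next
    assume m: "m 0 = (- k) *\<^sub>R mu s"
    have "mirror (m 0) = k *\<^sub>R mu s" by (simp add: m eq3_iff)
    moreover have "extremal T (\<lambda>t. - U t) (\<lambda>t. inverse k *\<^sub>R mirror (m t))"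
      by (rule extremal_scaleR[OF extremal_mirror[OF ext]]) (use k in auto)
    ultimately have w: "- U t = wave s t" if "t \<in> {0..T}" for t
      using extremal_eq_wave[OF _ s _ that, of "\<lambda>t. - U t"] k by auto
    have "U t = - 1 * wave s t" if "t \<in> {0..T}" for t
      using w[OF that] by linarith
    then show thesis
      by (intro that[OF s, of "- 1"]) auto
  qed
qed

section \<open>The front bounds the reachable set\<close>

text \<open>The range of s is closed to make the parameter set compact. By
  \<open>wave_zero_eq\<close>, s = 0 is s = pi with the opposite sign, so the two half fronts close
  up to one curve.\<close>

definition front :: "real \<Rightarrow> (real^3) set" where
  "front T = {rotx (sin \<alpha> * (e * wave s T)) (y T) | e s y.
     (e = 1 \<or> e = - 1) \<and> s \<in> {0..pi} \<and> sol (\<lambda>t. e * wave s t) y \<and> y 0 = N_pole}"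

lemma lip1_signed_wave: "e = 1 \<or> e = - 1 \<Longrightarrow> s \<in> {0..pi} \<Longrightarrow> lip1 (\<lambda>t. e * wave s t)"
  using wave_lip1[of s] by (auto simp: lip1_uminus)

lemma extremal_end_in_front:
  assumes "extremal T U m" "0 \<le> T" "sol U y" "y 0 = N_pole"
  shows "rotx (sin \<alpha> * U T) (y T) \<in> front T"
proof -
  obtain s e where s: "s \<in> {0<..pi}" and e: "e = 1 \<or> e = - 1" and U: "\<And>t. t \<in> {0..T} \<Longrightarrow> U t = e * wave s t"
    using extremal_cases[OF assms(1)] by metis
  have s': "s \<in> {0..pi}" using s by auto
  obtain z where z: "sol (\<lambda>t. e * wave s t) z" "z 0 = N_pole"
    using sol_exists[OF lip1_continuous[OF lip1_signed_wave[OF e s']]] by blast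
  have "y T = z T"
    by (rule sol_agree[OF assms(3) z(1) \<open>0 \<le> T\<close>]) (use assms(4) z(2) U in auto)
  moreover have "U T = e * wave s T" using U \<open>0 \<le> T\<close> by auto
  ultimately show ?thesis
    unfolding front_def using e s' z by (intro CollectI exI[of _ e] exI[of _ s] exI[of _ z]) simp
qed

text \<open>The parameters range over a compact set, on which \<open>wave\<close> is uniformly
  continuous; convergent parameters thus give uniformly convergent primitives.\<close>

lemma front_closed:
  assumes x: "\<And>n::nat. x n \<in> front (t n)" "x \<longlonglongrightarrow> l" and t: "\<And>n. 0 \<le> t n" "t \<longlonglongrightarrow> t0"
  shows "l \<in> front t0"
proof -
  have "0 \<le> t0" using t LIMSEQ_le_const by blast
  have "\<exists>p y. p \<in> Sigma {-1, 1::real} (\<lambda>_. {0..pi}) \<and> sol (\<lambda>t. fst p * wave (snd p) t) y \<and> y 0 = N_pole \<and>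
      x n = rotx (sin \<alpha> * (fst p * wave (snd p) (t n))) (y (t n))" for n
    using x(1)[of n] unfolding front_def by force
  then obtain p y where p: "\<And>n. p n \<in> Sigma {-1, 1::real} (\<lambda>_. {0..pi})"
    and y: "\<And>n. sol (\<lambda>t. fst (p n) * wave (snd (p n)) t) (y n)" "\<And>n. y n 0 = N_pole"
    and xe: "\<And>n. x n = rotx (sin \<alpha> * (fst (p n) * wave (snd (p n)) (t n))) (y n (t n))"
    by metis
  have "compact (Sigma {-1, 1::real} (\<lambda>_. {0..pi}))"
    by (intro compact_Times) auto
  then obtain q k where q: "q \<in> Sigma {-1, 1::real} (\<lambda>_. {0..pi})" and k: "strict_mono (k :: nat \<Rightarrow> nat)"
    and lim: "(p \<circ> k) \<longlonglongrightarrow> q"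
    using p unfolding compact_def by metis
  have q': "fst q = 1 \<or> fst q = - 1" "snd q \<in> {0..pi}" using q by auto
  have p': "fst (p n) = 1 \<or> fst (p n) = - 1" "snd (p n) \<in> {0..pi}" for n using p[of n] by auto
  let ?W = "\<lambda>q t. fst q * wave (snd q) t"
  obtain z where z: "sol (?W q) z" "z 0 = N_pole"
    using sol_exists[OF lip1_continuous[OF lip1_signed_wave[OF q']]] by blast
  have "uniformly_continuous_on (Sigma (Sigma {-1, 1} (\<lambda>_. {0..pi})) (\<lambda>_. {0..t0})) (\<lambda>r. ?W (fst r) (snd r))"
    by (intro compact_uniformly_continuous compact_Times continuous_intros
        continuous_on_compose2[OF continuous_on_wave, where f = "\<lambda>r. (snd (fst r), snd r)", simplified]) auto
  note ucont = this
  have uc: "\<exists>d>0. \<forall>u\<in>Sigma {-1, 1} (\<lambda>_. {0..pi}). \<forall>s\<in>{0..t0}. dist u q < d \<longrightarrow> \<bar>?W u s - ?W q s\<bar> < e"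
    if e: "0 < e" for e
  proof -
    let ?S = "Sigma (Sigma {-1, 1} (\<lambda>_. {0..pi})) (\<lambda>_. {0..t0})"
    obtain d where d: "0 < d" "\<forall>a\<in>?S. \<forall>b\<in>?S. dist b a < d \<longrightarrow> dist (?W (fst b) (snd b)) (?W (fst a) (snd a)) < e"
      using mp[OF spec[OF ucont[unfolded uniformly_continuous_on_def], of e] e] by blast
    have "\<bar>?W u s - ?W q s\<bar> < e" if "u \<in> Sigma {-1, 1} (\<lambda>_. {0..pi})" "s \<in> {0..t0}" "dist u q < d" for u s
    proof -
      have "(q, s) \<in> ?S" "(u, s) \<in> ?S" using that q by auto
      from d(2)[rule_format, OF this] show ?thesis
        using that(3) by (simp add: dist_Pair_Pair dist_real_def)
    qed
    with d(1) show ?thesis by blast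
  qed
  let ?l = "rotx (sin \<alpha> * ?W q t0) (z t0)"
  have "(\<lambda>n. x (k n)) \<longlonglongrightarrow> ?l"
  proof (rule tendstoI)
    fix e :: real assume "0 < e"
    have "((\<lambda>d. d + sqrt (2 * t0 * d)) \<longlongrightarrow> 0 + sqrt (2 * t0 * 0)) (at_right 0)"
      by (intro tendsto_intros)
    then have "\<forall>\<^sub>F d in at_right 0. d + sqrt (2 * t0 * d) < e / 2"
      by (rule order_tendstoD) (use \<open>0 < e\<close> in auto)
    then obtain b where "0 < b" "\<And>d. 0 < d \<Longrightarrow> d < b \<Longrightarrow> d + sqrt (2 * t0 * d) < e / 2"
      unfolding eventually_at_right_field by blast
    then obtain d where d: "0 < d" "d + sqrt (2 * t0 * d) < e / 2"
      by (meson dense)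
    obtain d' where d': "0 < d'" "\<And>u s. u \<in> Sigma {-1, 1} (\<lambda>_. {0..pi}) \<Longrightarrow> s \<in> {0..t0} \<Longrightarrow> dist u q < d' \<Longrightarrow> \<bar>?W u s - ?W q s\<bar> < d"
      using uc[OF d(1)] by blast
    have "\<forall>\<^sub>F n in sequentially. dist (p (k n)) q < d'"
      using tendstoD[OF lim d'(1)] by simp
    moreover have "\<forall>\<^sub>F n in sequentially. dist (t (k n)) t0 < e / 4"
      using tendstoD[OF LIMSEQ_subseq_LIMSEQ[OF t(2) k], of "e / 4"] \<open>0 < e\<close> by simp
    ultimately show "\<forall>\<^sub>F n in sequentially. dist (x (k n)) ?l < e"
    proof eventually_elim
      case (elim n)
      let ?m = "rotx (sin \<alpha> * ?W (p (k n)) t0) (y (k n) t0)"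
      have "norm (x (k n) - ?m) \<le> 2 * \<bar>t (k n) - t0\<bar>"
        unfolding xe by (rule traj_lipschitz[OF lip1_signed_wave[OF p'] y(1)]) (simp add: y(2))
      moreover have "norm (?m - ?l) \<le> d + sqrt (2 * t0 * d)"
        by (rule traj_dist[OF y(1) z(1) \<open>0 \<le> t0\<close>]) (use d'(2)[OF p _ elim(1)] in \<open>auto simp: y(2) z(2) intro: less_imp_le\<close>)
      moreover have "norm (x (k n) - ?l) \<le> norm (x (k n) - ?m) + norm (?m - ?l)"
        using norm_triangle_ineq[of "x (k n) - ?m" "?m - ?l"] by simp
      ultimately show ?case using elim(2) d(2) by (simp add: dist_norm)
    qed
  qed
  moreover have "(\<lambda>n. x (k n)) \<longlonglongrightarrow> l"
    using LIMSEQ_subseq_LIMSEQ[OF x(2) k] by (simp add: o_def)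
  ultimately have "l = ?l" by (rule LIMSEQ_unique[rotated])
  then show ?thesis
    unfolding front_def using q' z by (intro CollectI exI[of _ "fst q"] exI[of _ "snd q"] exI[of _ z]) simp
qed

text \<open>The point of \<open>reach (t n)\<close> nearest to z n ends an extremal, and it tends to
  y because y is within 2 |t0 - t n| of \<open>reach (t n)\<close>. A constant sequence t yields
  boundary points of the reachable set, a constant sequence z the first time at which y is
  reached.\<close>

lemma reach_limit_in_front:
  assumes y: "y \<in> reach t0" and z: "\<And>n::nat. norm (z n) = 1" "\<And>n. z n \<notin> reach (t n)" "z \<longlonglongrightarrow> y"
    and t: "\<And>n. 0 \<le> t n" "t \<longlonglongrightarrow> t0"
  shows "y \<in> front t0"
proof -
  have "\<exists>w. w \<in> reach (t n) \<and> norm (y - w) \<le> 2 * \<bar>t0 - t n\<bar>" for n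
    using reach_near[OF y, of "t n"] by metis
  then obtain w where w: "\<And>n. w n \<in> reach (t n)" "\<And>n. norm (y - w n) \<le> 2 * \<bar>t0 - t n\<bar>"
    by metis
  have "(\<lambda>n. 2 * \<bar>t0 - t n\<bar>) \<longlonglongrightarrow> 2 * \<bar>t0 - t0\<bar>"
    by (intro tendsto_intros t)
  then have "(\<lambda>n. 2 * \<bar>t0 - t n\<bar>) \<longlonglongrightarrow> 0" by simp
  from Lim_null_comparison[OF always_eventually[OF allI[OF w(2)]] this]
  have "(\<lambda>n. y - w n) \<longlonglongrightarrow> 0" .
  moreover have "(\<lambda>n. z n - y) \<longlonglongrightarrow> 0" using z(3) by (simp add: LIM_zero)
  ultimately have zw: "(\<lambda>n. z n - w n) \<longlonglongrightarrow> 0"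
    using tendsto_add[of "\<lambda>n. z n - y" 0 sequentially "\<lambda>n. y - w n" 0] by simp
  from tendstoD[OF zw, of 1] obtain n0 where n0: "\<And>n. n0 \<le> n \<Longrightarrow> norm (z n - w n) < 1"
    by (auto simp: eventually_sequentially)
  have "\<exists>x. x \<in> front (t n) \<and> norm (z n - x) \<le> norm (z n - w n)" if "n0 \<le> n" for n
  proof -
    \<comment> \<open>Distance below 1 means inner product above 1/2, so w n is not antipodal to z
      n, as \<open>reach_maximizer\<close> requires.\<close>
    have "(norm (z n - w n))\<^sup>2 < 1" using n0[OF that] by (simp add: abs_square_less_1)
    then have "- 1 < z n \<bullet> w n"
      using norm_diff_sq_unit[OF z(1) norm_reach[OF w(1)], of n n] by simp
    then obtain U m v where ext: "extremal (t n) U m" and v: "sol U v" "v 0 = N_pole"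
      and max: "\<And>w. w \<in> reach (t n) \<Longrightarrow> z n \<bullet> w \<le> z n \<bullet> rotx (sin \<alpha> * U (t n)) (v (t n))"
      using reach_maximizer[OF t(1) z(1) z(2) w(1)] by metis
    let ?x = "rotx (sin \<alpha> * U (t n)) (v (t n))"
    have x: "?x \<in> front (t n)" by (rule extremal_end_in_front[OF ext t(1) v])
    have "norm ?x = 1" using sol_norm[OF v(1), of "t n" 0] v(2) by simp
    then have "(norm (z n - ?x))\<^sup>2 \<le> (norm (z n - w n))\<^sup>2"
      using max[OF w(1)] by (simp add: norm_diff_sq_unit z(1) norm_reach[OF w(1)])
    then show ?thesis using x power2_le_imp_le[OF _ norm_ge_zero] by blast
  qed
  then have "\<forall>n. \<exists>x. x \<in> front (t (n + n0)) \<and> norm (z (n + n0) - x) \<le> norm (z (n + n0) - w (n + n0))"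
    by simp
  then obtain x where x: "\<And>n. x n \<in> front (t (n + n0))" "\<And>n. norm (z (n + n0) - x n) \<le> norm (z (n + n0) - w (n + n0))"
    by metis
  have "(\<lambda>n. norm (z (n + n0) - w (n + n0))) \<longlonglongrightarrow> 0"
    using LIMSEQ_ignore_initial_segment[OF tendsto_norm_zero[OF zw]] .
  from Lim_null_comparison[OF always_eventually[OF allI[OF x(2)]] this]
  have "(\<lambda>n. z (n + n0) - x n) \<longlonglongrightarrow> 0" .
  from tendsto_diff[OF LIMSEQ_ignore_initial_segment[OF z(3), of n0] this]
  have "x \<longlonglongrightarrow> y" by simp
  from front_closed[OF x(1) this] show ?thesis
    using t LIMSEQ_ignore_initial_segment[OF t(2)] by simp
qed

text \<open>The infimum of the reaching times is attained by compactness. At slightly earlier times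
  y is unreachable, which puts it on the front.\<close>

lemma reach_first_time:
  assumes "y \<in> reach t" "0 \<le> t"
  obtains t0 where "0 \<le> t0" "t0 \<le> t" "y \<in> reach t0" "y \<in> front t0"
proof -
  define A where "A = {r. 0 \<le> r \<and> r \<le> t \<and> y \<in> reach r}"
  define t0 where "t0 = Inf A"
  have "t \<in> A" using assms by (simp add: A_def)
  have bdd: "bdd_below A" by (auto simp: A_def bdd_below_def)
  have t0: "0 \<le> t0" "t0 \<le> t"
    using \<open>t \<in> A\<close> bdd unfolding t0_def by (auto intro!: cInf_greatest cInf_lower simp: A_def)
  have "\<exists>r. r \<in> A \<and> r < t0 + inverse (real (Suc n))" for n
    using cInf_less_iff[of A "t0 + inverse (real (Suc n))"] \<open>t \<in> A\<close> bdd by (auto simp: t0_def)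
  then obtain r where r: "\<And>n. r n \<in> A" "\<And>n. r n < t0 + inverse (real (Suc n))" by metis
  have r_ge: "t0 \<le> r n" for n using r(1) bdd by (auto simp: t0_def intro: cInf_lower)
  have "r \<longlonglongrightarrow> t0"
  proof (rule tendsto_sandwich[OF _ _ tendsto_const])
    show "(\<lambda>n. t0 + inverse (real (Suc n))) \<longlonglongrightarrow> t0"
      using LIMSEQ_inverse_real_of_nat_add by blast
  qed (use r_ge r(2) in \<open>auto intro!: always_eventually less_imp_le\<close>)
  obtain k l where "l \<in> reach t0" "(\<lambda>n::nat. y) \<longlonglongrightarrow> l"
    using reach_seq_compact[of "\<lambda>_. y" r t0] r(1) \<open>r \<longlonglongrightarrow> t0\<close> unfolding A_def by auto
  then have y: "y \<in> reach t0" by (simp add: LIMSEQ_const_iff)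
  have "y \<in> front t0"
  proof (cases "t0 = 0")
    case True
    obtain z where z: "sol (\<lambda>t. 1 * wave 0 t) z" "z 0 = N_pole"
      using sol_exists[OF lip1_continuous[OF lip1_signed_wave[of 1 0]]] by auto
    have "y = N_pole"
      using y True by (auto simp: reach_def lip1_zero)
    then show ?thesis
      unfolding front_def using z True lip1_zero[OF wave_lip1[of 0]]
      by (intro CollectI exI[of _ 1] exI[of _ 0] exI[of _ z]) simp
  next
    case False
    define s where "s n = t0 - t0 * inverse (real (Suc n))" for n
    have s: "0 \<le> s n" "s n < t0" for n
      using False t0 by (auto simp: s_def field_simps)
    have "(\<lambda>n. t0 - t0 * inverse (real (Suc n))) \<longlonglongrightarrow> t0 - t0 * 0"
      by (intro tendsto_intros LIMSEQ_inverse_real_of_nat)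
    then have "s \<longlonglongrightarrow> t0" by (simp add: s_def[abs_def])
    moreover have "y \<notin> reach (s n)" for n
    proof
      assume "y \<in> reach (s n)"
      then have "s n \<in> A" using s[of n] t0 by (auto simp: A_def)
      then have "t0 \<le> s n" using bdd by (auto simp: t0_def intro: cInf_lower)
      then show False using s(2)[of n] by simp
    qed
    ultimately show ?thesis
      using norm_reach[OF y] s(1) by (intro reach_limit_in_front[OF y, of "\<lambda>_. y" s]) auto
  qed
  with t0 y show thesis by (rule that)
qed

text \<open>Interior arcs last at least pi, so before time pi there is at most one switch. A return
  to the pole on the second arc preserves the component along its axis; the first arc must then end
  with the same component as the pole, which forces s = 0. A single arc shorter than pi does not
  close up.\<close>

lemma pole_notin_front:
  assumes "0 < t" "t < pi"
  shows "N_pole \<notin> front t"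
proof
  have *: False if s: "s \<in> {0..pi}" and y: "sol (wave s) y" "y 0 = N_pole"
    and N: "rotx (sin \<alpha> * wave s t) (y t) = N_pole" for s y
  proof (cases "t \<le> s")
    case True
    then have "arc 1 N_pole t = N_pole"
      using wave_traj_first[OF y(1) s, of t t] y(2) N assms by simp
    then have "sin t * sin \<alpha> = 0"
      unfolding eq3_iff arc_nth by simp
    then show False using sin_pos sin_gt_zero[OF assms] by simp
  next
    case False
    have "period s \<ge> pi" by (rule period_ge[OF s])
    have 1: "rotx (sin \<alpha> * wave s s) (y s) = arc 1 N_pole s"
      using wave_traj_first[OF y(1) s, of s s] s y(2) by simp
    have 2: "arc (- 1) (arc 1 N_pole s) (t - s) = N_pole"
      using wave_traj_arc[OF y(1) s, where T = t and t = t and j = 0] s False assms \<open>period s \<ge> pi\<close> N 1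
      by (simp add: switch_def)
    have "axis_of (- 1) \<bullet> arc 1 N_pole s = axis_of (- 1) \<bullet> N_pole"
      using axis_inner_arc[of "- 1" "arc 1 N_pole s" "t - s"] 2 by simp
    then have "cos \<alpha> * (1 - cos s) * (1 - ((cos \<alpha>)\<^sup>2 - (sin \<alpha>)\<^sup>2)) = 0"
      unfolding inner3 arc_nth by (simp add: algebra_simps power2_eq_square)
    moreover have "1 - ((cos \<alpha>)\<^sup>2 - (sin \<alpha>)\<^sup>2) \<noteq> 0"
      using sin_pos by (simp add: cos_squared_eq)
    ultimately have "cos s = 1" using cos_pos by simp
    then have "s = 0" using cos_monotone_0_pi[of 0 s] s by (cases "s = 0") auto
    with 2 have "sin t * sin \<alpha> = 0"
      unfolding eq3_iff arc_nth by simp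
    then show False using sin_pos sin_gt_zero[OF assms] by simp
  qed
  assume "N_pole \<in> front t"
  then obtain e s y where e: "e = 1 \<or> e = - 1" and s: "s \<in> {0..pi}" and y: "sol (\<lambda>t. e * wave s t) y" "y 0 = N_pole"
    and N: "N_pole = rotx (sin \<alpha> * (e * wave s t)) (y t)"
    by (auto simp: front_def)
  have mN: "mirror N_pole = N_pole" by (simp add: eq3_iff)
  from e show False
  proof
    assume "e = 1"
    with *[OF s, of y] y N show False by simp
  next
    assume "e = - 1"
    then have "sol (wave s) (\<lambda>t. mirror (y t))" using sol_mirror[OF y(1)] by simp
    moreover have "rotx (sin \<alpha> * wave s t) (mirror (y t)) = N_pole"
      using N mN \<open>e = - 1\<close> mirror_rotx[of "- (sin \<alpha> * wave s t)" "y t"] by simp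
    ultimately show False using *[OF s, of "\<lambda>t. mirror (y t)"] y(2) mN by simp
  qed
qed

text \<open>Local controllability at the pole: it is reachable at every time with U = 0 and is not
  on the front, so unreachable points cannot accumulate there.\<close>

lemma pole_interior:
  assumes "0 < t" "t < pi"
  obtains d where "0 < d" "\<And>w. norm w = 1 \<Longrightarrow> norm (w - N_pole) < d \<Longrightarrow> w \<in> reach t"
proof -
  have "\<exists>d>0. \<forall>w. norm w = 1 \<longrightarrow> norm (w - N_pole) < d \<longrightarrow> w \<in> reach t"
  proof (rule ccontr)
    assume neg: "\<not> ?thesis"
    have "\<exists>w. norm w = 1 \<and> norm (w - N_pole) < inverse (real (Suc n)) \<and> w \<notin> reach t" for n
    proof -
      have "0 < inverse (real (Suc n))" by simp
      with neg show ?thesis by blast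
    qed
    then obtain w where w: "\<And>n. norm (w n) = 1" "\<And>n. norm (w n - N_pole) < inverse (real (Suc n))" "\<And>n. w n \<notin> reach t"
      by metis
    from Lim_null_comparison[OF always_eventually[OF allI[OF less_imp_le[OF w(2)]]] LIMSEQ_inverse_real_of_nat]
    have "w \<longlonglongrightarrow> N_pole" by (simp add: LIM_zero_iff)
    from reach_limit_in_front[OF N_pole_in_reach[of t] w(1,3) this] assms pole_notin_front[OF assms]
    show False by simp
  qed
  then show thesis using that by blast
qed

lemma reach_mono:
  assumes "x \<in> reach s" "0 \<le> s" "s \<le> t"
  shows "x \<in> reach t"
proof -
  have "x \<in> reach ((t - s) + s)"
    by (rule reach_extend[OF _ assms(1)]) (use assms norm_reach[OF assms(1)] N_pole_in_reach in auto)
  then show ?thesis by simp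
qed

lemma reach_interior:
  assumes "x \<in> reach s" "0 \<le> s" "s < t"
  obtains d where "0 < d" "\<And>w. norm w = 1 \<Longrightarrow> norm (w - x) < d \<Longrightarrow> w \<in> reach t"
proof -
  \<comment> \<open>The cap 1 keeps r below pi, the range of \<open>pole_interior\<close>.\<close>
  define r where "r = min 1 (t - s)"
  have r: "0 < r" "r < pi" "r + s \<le> t" using assms pi_gt3 by (auto simp: r_def)
  obtain d where d: "0 < d" "\<And>w. norm w = 1 \<Longrightarrow> norm (w - N_pole) < d \<Longrightarrow> w \<in> reach r"
    using pole_interior[OF r(1,2)] by metis
  have "w \<in> reach t" if w: "norm w = 1" "norm (w - x) < d" for w
  proof -
    have "w \<in> reach (r + s)"
      by (rule reach_extend[OF _ assms(1)]) (use d(2) w r assms in auto)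
    then show ?thesis by (rule reach_mono) (use r assms in auto)
  qed
  with d(1) show thesis by (rule that)
qed

lemma front_subset_reach: "front t \<subseteq> reach t"
  by (auto simp: front_def intro!: reachI lip1_signed_wave)

(* On the way from the south pole to y, the first point of the compact set reach T lies on the front, in the
   direction of y, so it is y itself; hence y is not interior to reach T. *)
lemma star_shaped_front_optimal:
  assumes "0 \<le> T" and S: "- N_pole \<notin> reach T"
    and star: "\<And>x x' c. x \<in> front T \<Longrightarrow> x' \<in> front T \<Longrightarrow> 0 < c \<Longrightarrow> x' $ 1 = c * x $ 1 \<Longrightarrow> x' $ 2 = c * x $ 2 \<Longrightarrow> x' = x"
    and N: "N_pole \<notin> front T"
    and y: "y \<in> front T" and s: "0 \<le> s" "s < T"
  shows "y \<notin> reach s"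
proof
  assume "y \<in> reach s"
  then obtain d where d: "0 < d" "\<And>w. norm w = 1 \<Longrightarrow> norm (w - y) < d \<Longrightarrow> w \<in> reach T"
    using reach_interior[OF _ s] by metis
  have ny: "norm y = 1" using \<open>y \<in> reach s\<close> by (rule norm_reach)
  \<comment> \<open>The segment from the south pole to y, which g projects to the sphere. It avoids
    the origin because y is not the north pole.\<close>
  define v where "v r = r *\<^sub>R y + (1 - r) *\<^sub>R (- N_pole)" for r
  have v_nz: "v r \<noteq> 0" for r
  proof
    assume "v r = 0"
    then have e: "r *\<^sub>R y = (1 - r) *\<^sub>R N_pole" by (simp add: v_def)
    then have "norm (r *\<^sub>R y) = norm ((1 - r) *\<^sub>R N_pole)" by simp
    then have "\<bar>r\<bar> = \<bar>1 - r\<bar>" by (simp add: ny)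
    then have "r = 1 / 2" by linarith
    with e have "y = N_pole" by simp
    with y N show False by simp
  qed
  define g where "g r = v r /\<^sub>R norm (v r)" for r
  have cg: "continuous_on UNIV g"
    unfolding g_def v_def using v_nz[unfolded v_def] by (intro continuous_intros) auto
  have ng: "norm (g r) = 1" for r using v_nz[of r] by (simp add: g_def)
  have g1: "g 1 = y" by (simp add: g_def v_def ny)
  have g0: "g 0 = - N_pole" by (simp add: g_def v_def)
  define A where "A = {0..1} \<inter> g -` reach T"
  have "closed (reach T)" using compact_reach[OF \<open>0 \<le> T\<close>] by (rule compact_imp_closed)
  then have "closed A"
    unfolding A_def using cg by (intro continuous_closed_preimage continuous_on_subset[OF cg]) auto
  have "1 \<in> A" using g1 y front_subset_reach by (auto simp: A_def)
  have bdd: "bdd_below A" by (auto simp: A_def bdd_below_def)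
  define r0 where "r0 = Inf A"
  have "r0 \<in> A" unfolding r0_def using \<open>1 \<in> A\<close> bdd \<open>closed A\<close> by (intro closed_contains_Inf) auto
  then have r0: "0 < r0" "r0 \<le> 1" "g r0 \<in> reach T"
    using S g0 by (auto simp: A_def less_le)
  define z where "z n = g (r0 - r0 * inverse (real (Suc n)))" for n
  have "(\<lambda>n. r0 - r0 * inverse (real (Suc n))) \<longlonglongrightarrow> r0 - r0 * 0"
    by (intro tendsto_intros LIMSEQ_inverse_real_of_nat)
  then have "(\<lambda>n. g (r0 - r0 * inverse (real (Suc n)))) \<longlonglongrightarrow> g r0"
    using continuous_on_tendsto_compose[OF cg, of "\<lambda>n. r0 - r0 * inverse (real (Suc n))" r0] by simp
  then have z_lim: "z \<longlonglongrightarrow> g r0" by (simp add: z_def[abs_def])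
  have z_notin: "z n \<notin> reach T" for n
  proof
    assume "z n \<in> reach T"
    moreover have "0 \<le> r0 - r0 * inverse (real (Suc n))" "r0 - r0 * inverse (real (Suc n)) < r0"
      using r0(1) by (auto simp: field_simps)
    ultimately have "r0 - r0 * inverse (real (Suc n)) \<in> A" using r0(2) by (auto simp: A_def z_def)
    then have "r0 \<le> r0 - r0 * inverse (real (Suc n))" unfolding r0_def using bdd by (intro cInf_lower)
    then show False using r0(1) by (simp add: field_simps)
  qed
  have "g r0 \<in> front T"
    using reach_limit_in_front[OF r0(3), of z "\<lambda>_. T"] ng z_notin z_lim \<open>0 \<le> T\<close> by (simp add: z_def)
  \<comment> \<open>The south pole contributes nothing to the first two coordinates, so g r0 and y
    differ there by the factor r0 / |v r0|, and \<open>star\<close> applies.\<close>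
  then have "g r0 = y"
    using r0(1) v_nz[of r0]
    by (intro star[OF y _, of _ "r0 / norm (v r0)"]) (auto simp: g_def v_def divide_inverse mult_ac)
  with z_lim d(1) have "\<forall>\<^sub>F n in sequentially. dist (z n) y < d" by (auto dest: tendstoD)
  then obtain n where "dist (z n) y < d" by (auto simp: eventually_sequentially)
  then have "z n \<in> reach T" using d(2)[of "z n"] ng by (simp add: z_def dist_norm)
  with z_notin show False by blast
qed

end

section \<open>Measurable controls\<close>

lemma AE_lebesgue_on_iff_negligible:
  assumes "S \<in> sets lebesgue"
  shows "(AE t in lebesgue_on S. P t) \<longleftrightarrow> (\<exists>N. negligible N \<and> (\<forall>t\<in>S - N. P t))"
proof -
  have "(AE t in lebesgue_on S. P t) \<longleftrightarrow> (AE t in lebesgue. t \<in> S \<longrightarrow> P t)"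
    using assms by (intro AE_restrict_space_iff) auto
  also have "\<dots> \<longleftrightarrow> (\<exists>N\<in>null_sets lebesgue. {t. \<not> (t \<in> S \<longrightarrow> P t)} \<subseteq> N)"
    by (simp add: eventually_ae_filter)
  also have "\<dots> \<longleftrightarrow> (\<exists>N. negligible N \<and> (\<forall>t\<in>S - N. P t))"
    unfolding negligible_iff_null_sets by blast
  finally show ?thesis .
qed

lemma dominated_convergence_negligible:
  fixes f :: "nat \<Rightarrow> real \<Rightarrow> real"
  assumes f: "\<And>k. f k integrable_on S" and h: "h integrable_on S" and N: "negligible N"
    and le: "\<And>k x. x \<in> S - N \<Longrightarrow> \<bar>f k x\<bar> \<le> h x"
    and conv: "\<And>x. x \<in> S - N \<Longrightarrow> (\<lambda>k. f k x) \<longlonglongrightarrow> g x"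
  shows "g integrable_on S" "(\<lambda>k. integral S (f k)) \<longlonglongrightarrow> integral S g"
proof -
  have neg: "negligible ((S - N - S) \<union> (S - (S - N)))"
    by (rule negligible_subset[OF N]) auto
  have int: "F integrable_on S - N \<longleftrightarrow> F integrable_on S" for F :: "real \<Rightarrow> real"
    by (rule integrable_spike_set_eq[OF neg])
  have eq: "integral (S - N) F = integral S F" for F :: "real \<Rightarrow> real"
    by (rule integral_spike_set; rule negligible_subset[OF N]) auto
  show "g integrable_on S" "(\<lambda>k. integral S (f k)) \<longlonglongrightarrow> integral S g"
    using dominated_convergence[of f "S - N" h g] f h le conv by (simp_all add: int eq)
qed

(* The difference quotients of f are bounded by L, so dominated convergence applies. *)
lemma lipschitz_has_integral:
  fixes f :: "real \<Rightarrow> real"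
  assumes "0 \<le> T" and L: "L-lipschitz_on {0..T} f" and N: "negligible N"
    and der: "\<And>t. t \<in> {0..T} - N \<Longrightarrow> (f has_real_derivative g t) (at t within {0..T})"
  shows "(g has_integral f T - f 0) {0..T}"
proof -
  define c where "c t = max 0 (min T t)" for t
  define F where "F t = f (c t)" for t
  have c: "c t \<in> {0..T}" "\<bar>c s - c t\<bar> \<le> \<bar>s - t\<bar>" for s t
    using \<open>0 \<le> T\<close> by (auto simp: c_def)
  have "0 \<le> L" using L by (rule lipschitz_on_nonneg)
  have F_lip: "\<bar>F s - F t\<bar> \<le> L * \<bar>s - t\<bar>" for s t
    using lipschitz_onD[OF L c(1) c(1), of s t] mult_left_mono[OF c(2)[of s t] \<open>0 \<le> L\<close>]
    by (simp add: F_def dist_real_def)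
  have F_cont: "continuous_on UNIV F"
    by (rule lipschitz_on_continuous_on[of L]) (use F_lip \<open>0 \<le> L\<close> in \<open>auto simp: lipschitz_on_def dist_real_def\<close>)
  define \<Phi> where "\<Phi> = antideriv F"
  have \<Phi>: "(\<Phi> has_vector_derivative F t) (at t)" for t
    unfolding \<Phi>_def by (rule antideriv_has_vector_derivative[OF F_cont])
  define e where "e n = inverse (real (Suc n))" for n
  have e: "0 < e n" for n by (simp add: e_def)
  have e0: "e \<longlonglongrightarrow> 0" unfolding e_def by (rule LIMSEQ_inverse_real_of_nat)
  define h where "h n t = (F (t + e n) - F t) /\<^sub>R e n" for n t
  have h_int: "(h n has_integral (\<Phi> (T + e n) - \<Phi> T) /\<^sub>R e n - (\<Phi> (0 + e n) - \<Phi> 0) /\<^sub>R e n) {0..T}" for n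
  proof (rule fundamental_theorem_of_calculus[OF \<open>0 \<le> T\<close>])
    fix t
    have "((\<lambda>t. \<Phi> (t + e n)) has_vector_derivative F (t + e n)) (at t)"
    proof -
      have "((\<lambda>t. t + e n) has_vector_derivative 1) (at t)" by (auto intro!: derivative_eq_intros)
      from vector_diff_chain_at[OF this \<Phi>] show ?thesis by (simp add: o_def)
    qed
    then have "((\<lambda>t. (\<Phi> (t + e n) - \<Phi> t) /\<^sub>R e n) has_vector_derivative h n t) (at t)"
      unfolding h_def using \<Phi>[of t]
      by (intro bounded_linear.has_vector_derivative[OF bounded_linear_scaleR_right] has_vector_derivative_diff)
    then show "((\<lambda>t. (\<Phi> (t + e n) - \<Phi> t) /\<^sub>R e n) has_vector_derivative h n t) (at t within {0..T})"
      by (rule has_vector_derivative_at_within)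
  qed
  have h_le: "\<bar>h n t\<bar> \<le> L" for n t
    using F_lip[of "t + e n" t] e[of n] by (simp add: h_def abs_mult field_simps)
  have h_lim: "(\<lambda>n. h n t) \<longlonglongrightarrow> g t" if t: "t \<in> {0..T} - (N \<union> {0, T})" for t
  proof -
    have t': "0 < t" "t < T" "t \<in> {0..T} - N" using t by auto
    have "(f has_real_derivative g t) (at t)"
      using der[OF t'(3)] t' at_within_Icc_at[of 0 t T] by simp
    then have "(F has_real_derivative g t) (at t)"
      by (rule has_field_derivative_transform_within_open[where S = "{0<..<T}"])
         (use t' in \<open>auto simp: F_def c_def\<close>)
    then have "(F has_vector_derivative g t) (at t)"
      by (simp add: has_real_derivative_iff_has_vector_derivative)
    from difference_quotient_tendsto[OF this e0 e, of 1] show ?thesis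
      by (simp add: h_def)
  qed
  have N': "negligible (N \<union> {0, T})" using N by (intro negligible_Un) auto
  have g: "g integrable_on {0..T}" "(\<lambda>n. integral {0..T} (h n)) \<longlonglongrightarrow> integral {0..T} g"
    using dominated_convergence_negligible[OF _ _ N', of h "{0..T}" "\<lambda>_. L" g] h_int h_le h_lim
    by (auto simp: has_integral_iff)
  have "(\<lambda>n. (\<Phi> (T + e n) - \<Phi> T) /\<^sub>R e n - (\<Phi> (0 + e n) - \<Phi> 0) /\<^sub>R e n) \<longlonglongrightarrow> F T - F 0"
    using tendsto_diff[OF difference_quotient_tendsto[OF \<Phi> e0 e, of T 1] difference_quotient_tendsto[OF \<Phi> e0 e, of 0 1]]
    by simp
  then have "(\<lambda>n. integral {0..T} (h n)) \<longlonglongrightarrow> F T - F 0"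
    using h_int by (simp add: has_integral_iff)
  from LIMSEQ_unique[OF this g(2)] show ?thesis
    using g(1) \<open>0 \<le> T\<close> by (simp add: has_integral_iff F_def c_def)
qed

lemma control_lip1:
  assumes u: "u integrable_on {0..T}" "\<And>t. t \<in> {0..T} \<Longrightarrow> \<bar>u t\<bar> \<le> 1" and "0 \<le> T"
  shows "lip1 (\<lambda>t. integral {0..max 0 (min T t)} u)"
  unfolding lip1_def
proof (intro conjI allI)
  have le: "\<bar>integral {0..a} u - integral {0..b} u\<bar> \<le> b - a" if "0 \<le> a" "a \<le> b" "b \<le> T" for a b
  proof -
    have int: "u integrable_on {a..b}" "u integrable_on {0..b}"
      by (rule integrable_subinterval_real[OF u(1)]; use that in auto)+
    have "integral {0..a} u + integral {a..b} u = integral {0..b} u"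
      using that int by (intro Henstock_Kurzweil_Integration.integral_combine) auto
    moreover have "norm (integral {a..b} u) \<le> integral {a..b} (\<lambda>_. 1)"
      using that by (intro integral_norm_bound_integral int) (auto intro!: u(2))
    ultimately show ?thesis using that by simp
  qed
  fix s t
  show "\<bar>integral {0..max 0 (min T s)} u - integral {0..max 0 (min T t)} u\<bar> \<le> \<bar>s - t\<bar>"
    using le[of "max 0 (min T s)" "max 0 (min T t)"] le[of "max 0 (min T t)" "max 0 (min T s)"] \<open>0 \<le> T\<close>
    by (cases "s \<le> t") (auto simp: max_def min_def split: if_splits)
qed (use assms in simp)

text \<open>The continuous functions that come with \<open>measurable_on\<close> are truncated to
  [-1, 1]; this preserves the limit and provides the dominating constant 2.\<close>

lemma continuous_L1_approximation:
  fixes u :: "real \<Rightarrow> real"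
  assumes u: "u \<in> borel_measurable (lebesgue_on {0..T})" "\<And>t. t \<in> {0..T} \<Longrightarrow> \<bar>u t\<bar> \<le> 1"
  shows "\<exists>v :: nat \<Rightarrow> real \<Rightarrow> real. (\<forall>n. continuous_on UNIV (v n)) \<and> (\<forall>n t. \<bar>v n t\<bar> \<le> 1) \<and>
    (\<forall>n. (\<lambda>t. \<bar>u t - v n t\<bar>) integrable_on {0..T}) \<and>
    (\<lambda>n. integral {0..T} (\<lambda>t. \<bar>u t - v n t\<bar>)) \<longlonglongrightarrow> 0"
proof -
  have "u measurable_on {0..T}"
    using u(1) by (subst measurable_on_iff_borel_measurable) auto
  then obtain N g where N: "negligible N" and g: "\<And>n. continuous_on UNIV (g n)"
    and lim: "\<And>t. t \<notin> N \<Longrightarrow> (\<lambda>n. g n t) \<longlonglongrightarrow> (if t \<in> {0..T} then u t else 0)"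
    unfolding measurable_on_def by blast
  define v where "v n t = max (- 1) (min 1 (g n t))" for n :: nat and t
  have v: "continuous_on UNIV (v n)" "\<bar>v n t\<bar> \<le> 1" for n t
    unfolding v_def by (auto intro!: continuous_intros g)
  have int: "(\<lambda>t. \<bar>u t - v n t\<bar>) integrable_on {0..T}" for n
  proof (rule measurable_bounded_by_integrable_imp_integrable_real[where g = "\<lambda>_. 2"])
    have "v n \<in> borel_measurable (lebesgue_on {0..T})"
      by (intro continuous_imp_measurable_on_sets_lebesgue continuous_on_subset[OF v(1)]) auto
    then show "(\<lambda>t. \<bar>u t - v n t\<bar>) \<in> borel_measurable (lebesgue_on {0..T})"
      using u(1) by measurable
    show "\<bar>\<bar>u t - v n t\<bar>\<bar> \<le> 2" if "t \<in> {0..T}" for t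
      using u(2)[OF that] v(2)[of n t] by linarith
  qed auto
  have "(\<lambda>n. integral {0..T} (\<lambda>t. \<bar>u t - v n t\<bar>)) \<longlonglongrightarrow> integral {0..T} (\<lambda>t. 0)"
  proof (rule dominated_convergence_negligible(2)[OF int _ N])
    show "\<bar>\<bar>u t - v n t\<bar>\<bar> \<le> 2" if "t \<in> {0..T} - N" for n t
      using u(2)[of t] v(2)[of n t] that by auto
    fix t assume t: "t \<in> {0..T} - N"
    have "(\<lambda>n. \<bar>u t - v n t\<bar>) \<longlonglongrightarrow> \<bar>u t - max (- 1) (min 1 (u t))\<bar>"
      unfolding v_def using lim[of t] t by (intro tendsto_intros) auto
    then show "(\<lambda>n. \<bar>u t - v n t\<bar>) \<longlonglongrightarrow> 0"
      using u(2)[of t] t by (simp add: abs_le_iff max_def min_def split: if_splits)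
  qed auto
  with v int show ?thesis by (intro exI[of _ v]) auto
qed

lemma lipschitz_on_inner:
  fixes X Y :: "real \<Rightarrow> 'a::real_inner"
  assumes X: "L-lipschitz_on S X" "\<And>t. t \<in> S \<Longrightarrow> norm (X t) \<le> B"
    and Y: "M-lipschitz_on S Y" "\<And>t. t \<in> S \<Longrightarrow> norm (Y t) \<le> C" and "0 \<le> B" "0 \<le> C"
  shows "(L * C + B * M)-lipschitz_on S (\<lambda>t. X t \<bullet> Y t)"
proof (rule lipschitz_onI)
  have LM: "0 \<le> L" "0 \<le> M" using X(1) Y(1) by (auto dest: lipschitz_on_nonneg)
  then show "0 \<le> L * C + B * M" using assms by simp
  fix s t assume st: "s \<in> S" "t \<in> S"
  have "X s \<bullet> Y s - X t \<bullet> Y t = (X s - X t) \<bullet> Y s + X t \<bullet> (Y s - Y t)"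
    by (simp add: inner_diff_left inner_diff_right)
  then have "\<bar>X s \<bullet> Y s - X t \<bullet> Y t\<bar> \<le> norm (X s - X t) * norm (Y s) + norm (X t) * norm (Y s - Y t)"
    using Cauchy_Schwarz_ineq2[of "X s - X t" "Y s"] Cauchy_Schwarz_ineq2[of "X t" "Y s - Y t"] by linarith
  also have "\<dots> \<le> (L * dist s t) * C + B * (M * dist s t)"
    using lipschitz_onD[OF X(1) st] lipschitz_onD[OF Y(1) st] X(2)[OF st(2)] Y(2)[OF st(1)] LM assms
    by (intro add_mono mult_mono) (auto simp: dist_norm)
  finally show "dist (X s \<bullet> Y s) (X t \<bullet> Y t) \<le> (L * C + B * M) * dist s t"
    by (simp add: dist_real_def algebra_simps)
qed

context bang
begin

lemma field_eq_cross: "(F_mat \<alpha> + w *\<^sub>R G_mat \<alpha>) *v x = axis_of w \<times> x"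
  by (simp add: eq3_iff matrix_vector_mult_def sum_3 F_mat_def G_mat_def cross_components algebra_simps)

lemma covector_field_eq_cross: "- (p v* (F_mat \<alpha> + w *\<^sub>R G_mat \<alpha>)) = axis_of w \<times> p"
  by (simp add: eq3_iff vector_matrix_mult_def sum_3 F_mat_def G_mat_def cross_components algebra_simps)

lemma sol_has_vector_derivative:
  assumes "sol U y" "(U has_real_derivative w) (at t within S)"
  shows "((\<lambda>t. rotx (sin \<alpha> * U t) (y t)) has_vector_derivative (axis_of w \<times> rotx (sin \<alpha> * U t) (y t))) (at t within S)"
proof -
  have "((\<lambda>t. sin \<alpha> * U t) has_real_derivative sin \<alpha> * w) (at t within S)"
    by (intro DERIV_cmult assms)
  from rotx_has_vector_derivative[OF solD[OF assms(1)] this]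
  have "((\<lambda>t. rotx (sin \<alpha> * U t) (y t)) has_vector_derivative
     rotx (sin \<alpha> * U t) (cos \<alpha> *\<^sub>R (drift_axis (sin \<alpha> * U t) \<times> y t) + (sin \<alpha> * w) *\<^sub>R (axis 1 1 \<times> y t))) (at t within S)" .
  moreover have "cos \<alpha> *\<^sub>R (drift_axis (sin \<alpha> * U t) \<times> y t) + (sin \<alpha> * w) *\<^sub>R (axis 1 1 \<times> y t)
     = (cos \<alpha> *\<^sub>R drift_axis (sin \<alpha> * U t) + (sin \<alpha> * w) *\<^sub>R axis 1 1) \<times> y t"
    by (simp add: cross_add_left cross_mult_left)
  moreover have "rotx (sin \<alpha> * U t) (cos \<alpha> *\<^sub>R drift_axis (sin \<alpha> * U t) + (sin \<alpha> * w) *\<^sub>R axis 1 1) = axis_of w"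
    unfolding linear_add[OF linear_rotx] linear_cmul[OF linear_rotx] rotx_drift_axis
    by (simp add: eq3_iff axis_def)
  ultimately show ?thesis by (simp only: rotx_cross)
qed

lemma inner_axis_cross:
  "(axis_of a \<times> x) \<bullet> y + x \<bullet> (axis_of b \<times> y) = sin \<alpha> * (a - b) * ((axis 1 1 \<times> x) \<bullet> y)"
  by (simp add: inner3 cross_components axis_def algebra_simps)

text \<open>The primitive U of a measurable control is not differentiated. Instead u is approximated
  in L^1 by continuous controls, whose trajectories x n satisfy the equation everywhere: X t . x n t
  differs from 1 by at most the L^1 error, while x n t tends to the right-hand side. So two unit
  vectors have inner product 1.\<close>

lemma caratheodory_solution_eq:
  assumes "0 \<le> T" and u: "u \<in> borel_measurable (lebesgue_on {0..T})" "\<And>t. t \<in> {0..T} \<Longrightarrow> \<bar>u t\<bar> \<le> 1"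
    and X: "L-lipschitz_on {0..T} X" and N: "negligible N"
    and der: "\<And>t. t \<in> {0..T} - N \<Longrightarrow> (X has_vector_derivative (axis_of (u t) \<times> X t)) (at t within {0..T})"
    and X0: "norm (X 0) = 1" and U_def: "U = (\<lambda>t. integral {0..max 0 (min T t)} u)"
    and y: "sol U y" "y 0 = X 0" and t: "t \<in> {0..T}"
  shows "X t = rotx (sin \<alpha> * U t) (y t)"
proof -
  have u_int: "u integrable_on {0..T}"
    by (rule measurable_bounded_by_integrable_imp_integrable_real[OF u(1), of "\<lambda>_. 1"]) (use u(2) in auto)
  have "0 \<le> L" using X by (rule lipschitz_on_nonneg)
  have XB: "norm (X r) \<le> 1 + L * T" if "r \<in> {0..T}" for r
  proof -
    have "norm (X r - X 0) \<le> L * r"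
      using lipschitz_onD[OF X that, of 0] that by (simp add: dist_norm)
    also have "\<dots> \<le> L * T" using that \<open>0 \<le> L\<close> by (intro mult_left_mono) auto
    finally show ?thesis using norm_triangle_ineq[of "X r - X 0" "X 0"] X0 by simp
  qed
  \<comment> \<open>The inner product of X with another trajectory moves only through the difference
    of the controls. Z = X gives constant length, Z = x n the L^1 estimate.\<close>
  have inner_int: "((\<lambda>r. sin \<alpha> * (u r - w r) * ((axis 1 1 \<times> X r) \<bullet> Z r)) has_integral X s \<bullet> Z s - X 0 \<bullet> Z 0) {0..s}"
    if Z: "M-lipschitz_on {0..T} Z" "\<And>r. r \<in> {0..T} \<Longrightarrow> norm (Z r) \<le> C" "0 \<le> C" and s: "s \<in> {0..T}"
      and Zd: "\<And>r. r \<in> {0..T} - N \<Longrightarrow> (Z has_vector_derivative (axis_of (w r) \<times> Z r)) (at r within {0..T})" for M Z C w s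
  proof (rule lipschitz_has_integral[OF _ _ N])
    have "(L * C + (1 + L * T) * M)-lipschitz_on {0..T} (\<lambda>r. X r \<bullet> Z r)"
      using XB \<open>0 \<le> L\<close> \<open>0 \<le> T\<close> by (intro lipschitz_on_inner X Z) auto
    then show "(L * C + (1 + L * T) * M)-lipschitz_on {0..s} (\<lambda>r. X r \<bullet> Z r)"
      by (rule lipschitz_on_subset) (use s in auto)
    fix r assume r: "r \<in> {0..s} - N"
    then have r': "r \<in> {0..T} - N" using s by auto
    from has_real_derivative_inner[OF der[OF r'] Zd[OF r']]
    show "((\<lambda>r. X r \<bullet> Z r) has_real_derivative sin \<alpha> * (u r - w r) * ((axis 1 1 \<times> X r) \<bullet> Z r)) (at r within {0..s})"
      unfolding inner_axis_cross by (rule DERIV_subset) (use s in auto)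
  qed (use s in auto)
  have nX: "norm (X s) = 1" if "s \<in> {0..T}" for s
  proof -
    have "((\<lambda>r. 0) has_integral X s \<bullet> X s - X 0 \<bullet> X 0) {0..s}"
      using inner_int[OF X XB _ that der] \<open>0 \<le> L\<close> \<open>0 \<le> T\<close> by simp
    then have "X s \<bullet> X s = X 0 \<bullet> X 0"
      using has_integral_unique[OF _ has_integral_0] by fastforce
    then show ?thesis using X0 by (simp add: norm_eq_sqrt_inner)
  qed
  obtain v where v: "\<And>n::nat. continuous_on UNIV (v n)" "\<And>n t. \<bar>v n t\<bar> \<le> 1"
    and uv: "\<And>n. (\<lambda>t. \<bar>u t - v n t\<bar>) integrable_on {0..T}"
    "(\<lambda>n. integral {0..T} (\<lambda>t. \<bar>u t - v n t\<bar>)) \<longlonglongrightarrow> 0"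
    using continuous_L1_approximation[OF u] by blast
  define d where "d n = integral {0..T} (\<lambda>t. \<bar>u t - v n t\<bar>)" for n
  have d_ge: "integral {0..s} (\<lambda>t. \<bar>u t - v n t\<bar>) \<le> d n" if "s \<in> {0..T}" for s n
    unfolding d_def using that
    by (intro integral_subset_le integrable_subinterval_real[OF uv(1)] uv(1)) auto
  define W where "W n = antideriv (v n)" for n
  have W0: "W n 0 = 0" for n by (simp add: W_def antideriv_def)
  have W_der: "(W n has_real_derivative v n r) (at r within S)" for n r S
    using antideriv_has_vector_derivative[OF v(1), of n r]
    by (simp add: W_def has_real_derivative_iff_has_vector_derivative has_vector_derivative_at_within)
  have W: "lip1 (W n)" for n
    unfolding lip1_def
  proof (intro conjI allI W0)
    fix a b
    have "norm (W n a - W n b) \<le> 1 * norm (a - b)"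
      by (rule field_differentiable_bound[of UNIV "W n" "v n"]) (use W_der v(2) in auto)
    then show "\<bar>W n a - W n b\<bar> \<le> \<bar>a - b\<bar>" by simp
  qed
  have WU: "\<bar>W n s - U s\<bar> \<le> d n" if s: "s \<in> {0..T}" for n s
  proof -
    have v_int: "v n integrable_on {0..s}"
      by (intro integrable_continuous_real continuous_on_subset[OF v(1)]) auto
    have u_int': "u integrable_on {0..s}"
      by (rule integrable_subinterval_real[OF u_int]) (use s in auto)
    have "W n s = integral {0..s} (v n)"
      using s by (cases "s = 0") (auto simp: W_def antideriv_def)
    moreover have "U s = integral {0..s} u" using s by (simp add: U_def)
    ultimately have "\<bar>W n s - U s\<bar> = norm (integral {0..s} (\<lambda>r. v n r - u r))"
      using Henstock_Kurzweil_Integration.integral_diff[OF v_int u_int'] by simp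
    also have "\<dots> \<le> integral {0..s} (\<lambda>r. \<bar>u r - v n r\<bar>)"
      by (intro integral_norm_bound_integral integrable_diff v_int u_int' integrable_subinterval_real[OF uv(1)])
         (use s in auto)
    also have "\<dots> \<le> d n" by (rule d_ge[OF s])
    finally show ?thesis .
  qed
  have "\<exists>z. sol (W n) z \<and> z 0 = X 0" for n
    using sol_exists[OF lip1_continuous[OF W[of n]], of 0 "X 0"] by metis
  then obtain z where z: "\<And>n. sol (W n) (z n)" "\<And>n. z n 0 = X 0" by metis
  define x where "x n s = rotx (sin \<alpha> * W n s) (z n s)" for n s
  have nx: "norm (x n s) = 1" for n s
    using sol_norm[OF z(1), of n s 0] by (simp add: x_def z(2) X0)
  have x_int: "\<bar>X t \<bullet> x n t - 1\<bar> \<le> d n" for n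
  proof -
    have "2-lipschitz_on {0..T} (x n)"
      using traj_lipschitz[OF W z(1)] X0 by (auto simp: lipschitz_on_def dist_norm x_def z(2))
    moreover have "(x n has_vector_derivative (axis_of (v n r) \<times> x n r)) (at r within {0..T})" for r
      unfolding x_def[abs_def] by (rule sol_has_vector_derivative[OF z(1) W_der])
    ultimately have I: "((\<lambda>r. sin \<alpha> * (u r - v n r) * ((axis 1 1 \<times> X r) \<bullet> x n r)) has_integral X t \<bullet> x n t - X 0 \<bullet> x n 0) {0..t}"
      using nx by (intro inner_int[of 2 "x n" 1] t) auto
    have "X 0 \<bullet> x n 0 = 1" using X0 by (simp add: x_def W0 z(2) norm_eq_1)
    then have "\<bar>X t \<bullet> x n t - 1\<bar> = norm (integral {0..t} (\<lambda>r. sin \<alpha> * (u r - v n r) * ((axis 1 1 \<times> X r) \<bullet> x n r)))"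
      using I by (simp add: has_integral_iff)
    also have "\<dots> \<le> integral {0..t} (\<lambda>r. \<bar>u r - v n r\<bar>)"
    proof (rule integral_norm_bound_integral)
      fix r assume r: "r \<in> {0..t}"
      have "\<bar>(axis 1 1 \<times> X r) \<bullet> x n r\<bar> \<le> norm (axis 1 1 \<times> X r) * norm (x n r)" by (rule Cauchy_Schwarz_ineq2)
      also have "\<dots> \<le> norm (axis 1 1 :: real^3) * norm (X r) * norm (x n r)" by (intro mult_right_mono norm_cross_le) auto
      also have "\<dots> = 1" using nX[of r] nx[of n r] r t by auto
      finally have "\<bar>sin \<alpha>\<bar> * \<bar>u r - v n r\<bar> * \<bar>(axis 1 1 \<times> X r) \<bullet> x n r\<bar> \<le> 1 * \<bar>u r - v n r\<bar> * 1"
        by (intro mult_mono) auto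
      then show "norm (sin \<alpha> * (u r - v n r) * ((axis 1 1 \<times> X r) \<bullet> x n r)) \<le> \<bar>u r - v n r\<bar>"
        by (simp add: abs_mult)
    qed (use I t in \<open>auto simp: has_integral_iff intro!: integrable_subinterval_real[OF uv(1)]\<close>)
    also have "\<dots> \<le> d n" by (rule d_ge[OF t])
    finally show ?thesis .
  qed
  have d0: "d \<longlonglongrightarrow> 0" using uv(2) by (simp add: d_def[abs_def])
  let ?w = "rotx (sin \<alpha> * U t) (y t)"
  have le: "norm (x n t - ?w) \<le> d n + sqrt (2 * t * d n)" for n
    unfolding x_def using t by (intro traj_dist[OF z(1) y(1)]) (auto simp: z(2) y(2) X0 intro!: WU)
  have "(\<lambda>n. d n + sqrt (2 * t * d n)) \<longlonglongrightarrow> 0 + sqrt (2 * t * 0)"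
    by (intro tendsto_intros d0)
  then have "(\<lambda>n. d n + sqrt (2 * t * d n)) \<longlonglongrightarrow> 0" by simp
  from Lim_null_comparison[OF always_eventually[OF allI[OF le]] this]
  have "(\<lambda>n. x n t) \<longlonglongrightarrow> ?w" by (simp add: LIM_zero_iff)
  then have "(\<lambda>n. X t \<bullet> x n t) \<longlonglongrightarrow> X t \<bullet> ?w" by (intro tendsto_intros)
  moreover have "(\<lambda>n. X t \<bullet> x n t - 1) \<longlonglongrightarrow> 0"
    by (rule Lim_null_comparison[OF always_eventually d0]) (use x_int in simp)
  then have "(\<lambda>n. X t \<bullet> x n t) \<longlonglongrightarrow> 1" by (simp add: LIM_zero_iff)
  ultimately have "X t \<bullet> ?w = 1" by (rule LIMSEQ_unique)
  moreover have "norm ?w = 1" using sol_norm[OF y(1), of t 0] by (simp add: y(2) X0)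
  ultimately have "(norm (X t - ?w))\<^sup>2 = 0"
    using nX[OF t] by (simp add: norm_diff_sq_unit)
  then show ?thesis by simp
qed

section \<open>Extremal trajectories\<close>

lemma admissible_traj_eq:
  assumes adm: "admissible_traj \<alpha> T u x" and U_def: "U = (\<lambda>t. integral {0..max 0 (min T t)} u)"
  shows "lip1 U" "\<And>y t. sol U y \<Longrightarrow> y 0 = N_pole \<Longrightarrow> t \<in> {0..T} \<Longrightarrow> x t = rotx (sin \<alpha> * U t) (y t)"
proof -
  have T: "0 \<le> T" and u: "u \<in> borel_measurable (lebesgue_on {0..T})" "\<And>t. t \<in> {0..T} \<Longrightarrow> \<bar>u t\<bar> \<le> 1"
    and x0: "x 0 = N_pole"
    using adm by (auto simp: admissible_traj_def)
  obtain L where L: "L-lipschitz_on {0..T} x"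
    using adm by (auto simp: admissible_traj_def)
  have "AE t in lebesgue_on {0..T}. (x has_vector_derivative axis_of (u t) \<times> x t) (at t within {0..T})"
    using adm by (simp add: admissible_traj_def field_eq_cross)
  then obtain N where N: "negligible N"
    "\<And>t. t \<in> {0..T} - N \<Longrightarrow> (x has_vector_derivative axis_of (u t) \<times> x t) (at t within {0..T})"
    by (subst (asm) AE_lebesgue_on_iff_negligible) auto
  have u_int: "u integrable_on {0..T}"
    by (rule measurable_bounded_by_integrable_imp_integrable_real[OF u(1), of "\<lambda>_. 1"]) (use u(2) in auto)
  show "lip1 U" unfolding U_def by (rule control_lip1[OF u_int u(2) T])
  show "x t = rotx (sin \<alpha> * U t) (y t)" if "sol U y" "y 0 = N_pole" "t \<in> {0..T}" for y t
    by (rule caratheodory_solution_eq[OF T u L N _ U_def]) (use that x0 in auto)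
qed

lemma admissible_in_reach:
  assumes "admissible_traj \<alpha> T u x"
  shows "x T \<in> reach T"
proof -
  define U where "U = (\<lambda>t. integral {0..max 0 (min T t)} u)"
  note U = admissible_traj_eq[OF assms U_def]
  obtain y where "sol U y" "y 0 = N_pole"
    using sol_exists[OF lip1_continuous[OF U(1)]] by blast
  with U(1) U(2)[OF this, of T] assms show ?thesis
    by (simp add: admissible_traj_def reachI)
qed

lemma hamiltonian_eq: "pmp_hamiltonian \<alpha> x p w = cos \<alpha> * (x \<times> p) $ 3 + w * (sin \<alpha> * (x \<times> p) $ 1)"
  unfolding pmp_hamiltonian_def field_eq_cross by (simp add: inner3 cross_components algebra_simps)

text \<open>By \<open>hamiltonian_eq\<close> the Hamiltonian is affine in w, with slope a positive
  multiple of m_1. Pointwise maximality therefore fixes u wherever m_1 has a sign, and integration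
  over such intervals gives \<open>extremal\<close>.\<close>

lemma extremal_front_subset: "extremal_front \<alpha> T \<subseteq> front T"
proof
  fix z assume "z \<in> extremal_front \<alpha> T"
  then obtain u x where z: "z = x T" and adm: "admissible_traj \<alpha> T u x" and pmp: "satisfies_PMP \<alpha> T u x"
    by (auto simp: extremal_front_def extremal_traj_def)
  have T: "0 \<le> T" and u: "u \<in> borel_measurable (lebesgue_on {0..T})" "\<And>t. t \<in> {0..T} \<Longrightarrow> \<bar>u t\<bar> \<le> 1"
    and x0: "x 0 = N_pole"
    using adm by (auto simp: admissible_traj_def)
  obtain p p0 L where p: "\<And>t. t \<in> {0..T} \<Longrightarrow> p t \<noteq> 0 \<and> p t \<bullet> x t = 0" "L-lipschitz_on {0..T} p"
    and ae: "AE t in lebesgue_on {0..T}. (p has_vector_derivative axis_of (u t) \<times> p t) (at t within {0..T}) \<and>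
       pmp_hamiltonian \<alpha> (x t) (p t) (u t) + p0 = 0 \<and>
       (\<forall>w\<in>{-1..1}. pmp_hamiltonian \<alpha> (x t) (p t) w \<le> pmp_hamiltonian \<alpha> (x t) (p t) (u t))"
    using pmp unfolding satisfies_PMP_def covector_field_eq_cross by blast
  obtain N where N: "negligible N"
    and pd: "\<And>t. t \<in> {0..T} - N \<Longrightarrow> (p has_vector_derivative axis_of (u t) \<times> p t) (at t within {0..T})"
    and mx: "\<And>t w. t \<in> {0..T} - N \<Longrightarrow> w \<in> {-1..1} \<Longrightarrow> pmp_hamiltonian \<alpha> (x t) (p t) w \<le> pmp_hamiltonian \<alpha> (x t) (p t) (u t)"
    using ae by (subst (asm) AE_lebesgue_on_iff_negligible) auto
  define U where "U = (\<lambda>t. integral {0..max 0 (min T t)} u)"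
  note U = admissible_traj_eq[OF adm U_def]
  obtain y where y: "sol U y" "y 0 = N_pole"
    using sol_exists[OF lip1_continuous[OF U(1)]] by blast
  \<comment> \<open>\<open>caratheodory_solution_eq\<close> is about unit initial vectors, and the
    maximum condition does not change under positive scaling of the covector.\<close>
  define k where "k = inverse (norm (p 0))"
  have k: "0 < k" using p(1)[of 0] T by (simp add: k_def)
  define P where "P t = k *\<^sub>R p t" for t
  obtain q where q: "sol U q" "q 0 = P 0"
    using sol_exists[OF lip1_continuous[OF U(1)]] by blast
  have nP: "norm (P 0) = 1" using p(1)[of 0] T by (simp add: P_def k_def)
  have Pq: "P t = rotx (sin \<alpha> * U t) (q t)" if "t \<in> {0..T}" for t
  proof -
    have Pl: "(\<bar>k\<bar> * L)-lipschitz_on {0..T} P"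
      unfolding P_def[abs_def] by (rule lipschitz_on_cmult[OF p(2)])
    have Pd: "(P has_vector_derivative axis_of (u t) \<times> P t) (at t within {0..T})" if "t \<in> {0..T} - N" for t
      using bounded_linear.has_vector_derivative[OF bounded_linear_scaleR_right[of k] pd[OF that]]
      by (simp add: P_def[abs_def] cross_mult_right)
    show ?thesis
      by (rule caratheodory_solution_eq[OF T u(1,2) Pl N Pd nP U_def q that])
  qed
  define m where "m t = y t \<times> q t" for t
  have m: "sol U m" unfolding m_def[abs_def] by (rule sol_cross[OF y(1) q(1)])
  have M: "x t \<times> P t = rotx (sin \<alpha> * U t) (m t)" if "t \<in> {0..T}" for t
    using U(2)[OF y that] Pq[OF that] by (simp add: m_def rotx_cross)
  have "N_pole \<bullet> P 0 = 0" using p(1)[of 0] T x0 by (simp add: P_def inner_commute)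
  then have "(norm (m 0))\<^sup>2 = 1"
    using norm_cross_dot[of N_pole "P 0"] nP by (simp add: m_def y(2) q(2))
  then have "m 0 \<noteq> 0" by auto
  moreover have "m 0 $ 3 = 0" by (simp add: m_def y(2) cross_components)
  moreover have "U b - U a = \<epsilon> * (b - a)"
    if \<epsilon>: "\<epsilon> \<in> {1, -1}" and ab: "0 \<le> a" "a \<le> b" "b \<le> T" and pos: "\<forall>t\<in>{a..b}. 0 < \<epsilon> * m t $ 1" for \<epsilon> a b
  proof -
    have ue: "u t = \<epsilon>" if t: "t \<in> {a..b} - N" for t
    proof -
      have t': "t \<in> {0..T} - N" "t \<in> {0..T}" using t ab by auto
      have "\<epsilon> * (sin \<alpha> * (x t \<times> p t) $ 1) \<le> u t * (sin \<alpha> * (x t \<times> p t) $ 1)"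
        using mx[OF t'(1), of \<epsilon>] \<epsilon> by (auto simp: hamiltonian_eq)
      then have "0 \<le> sin \<alpha> * ((u t - \<epsilon>) * (x t \<times> p t) $ 1)"
        by (simp add: algebra_simps)
      then have "0 \<le> (u t - \<epsilon>) * (x t \<times> p t) $ 1"
        using sin_pos by (simp add: zero_le_mult_iff)
      then have "0 \<le> k * ((u t - \<epsilon>) * (x t \<times> p t) $ 1)"
        using k by simp
      also have "\<dots> = (u t - \<epsilon>) * (x t \<times> P t) $ 1"
        by (simp add: P_def cross_mult_right)
      also have "(x t \<times> P t) $ 1 = m t $ 1" by (simp add: M[OF t'(2)])
      finally have "0 \<le> (u t - \<epsilon>) * m t $ 1" .
      moreover have "0 < \<epsilon> * m t $ 1" using pos t by auto
      ultimately show ?thesis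
        using \<epsilon> u(2)[OF t'(2)] by (auto simp: zero_le_mult_iff abs_le_iff)
    qed
    have u_int: "u integrable_on {0..T}"
      by (rule measurable_bounded_by_integrable_imp_integrable_real[OF u(1), of "\<lambda>_. 1"]) (use u(2) in auto)
    have "integral {0..a} u + integral {a..b} u = integral {0..b} u"
      using ab by (intro Henstock_Kurzweil_Integration.integral_combine integrable_subinterval_real[OF u_int]) auto
    moreover have "integral {a..b} u = integral {a..b} (\<lambda>_. \<epsilon>)"
      by (rule integral_spike[OF N(1)]) (use ue in auto)
    ultimately show ?thesis using ab by (simp add: U_def mult.commute)
  qed
  ultimately have "extremal T U m"
    unfolding extremal_def using U(1) m by blast
  from extremal_end_in_front[OF this T y] show "z \<in> front T"
    using U(2)[OF y, of T] T by (simp add: z)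
qed

text \<open>\<open>gap\<close> vanishes at 0 and at pi, so both waves have arcs of length pi and
  differ in sign only.\<close>

lemma wave_zero_eq: "wave 0 t = - wave pi t"
proof -
  have "cos (t - pi) = - cos t" by (simp add: cos_diff)
  moreover have "arccos (- cos t) = pi - arccos (cos t)"
    by (rule arccos_minus) auto
  ultimately show ?thesis by (simp add: wave_def period_def gap_def)
qed

text \<open>On each arc the Hamiltonian is the component of the rotated switching vector along the
  rotation axis. The rotation preserves it, and it takes the same value at \<open>mu s\<close> and
  at every node.\<close>

lemma wave_costate:
  assumes s: "s \<in> {0<..pi}" and m: "sol (wave s) m" "m 0 = mu s" and t: "0 < t" "t \<notin> range (switch s)"
  shows "(wave s has_real_derivative sgn (m t $ 1)) (at t)"
    and "cos \<alpha> * rotx (sin \<alpha> * wave s t) (m t) $ 3 + sin \<alpha> * \<bar>m t $ 1\<bar> = sin \<alpha> * cos \<alpha> * sin s"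
proof -
  have s': "s \<in> {0..pi}" using s by auto
  have "(wave s has_real_derivative sgn (m t $ 1)) (at t) \<and>
    cos \<alpha> * rotx (sin \<alpha> * wave s t) (m t) $ 3 + sin \<alpha> * \<bar>m t $ 1\<bar> = sin \<alpha> * cos \<alpha> * sin s"
  proof (cases "t < s")
    case True
    have A: "rotx (sin \<alpha> * wave s t) (m t) = arc 1 (mu s) t"
      using wave_traj_first[OF m(1) s', of t t] m(2) t True by simp
    then have m1: "m t $ 1 = arc 1 (mu s) t $ 1" by (metis rotx_nth(1))
    also have "\<dots> > 0" using True t s by (intro arc_mu_pos) auto
    finally have pos: "0 < m t $ 1" .
    have "(wave s has_real_derivative 1) (at t)"
    proof (rule has_field_derivative_transform_within_open[where S = "{0<..<s}" and f = "\<lambda>t. t"])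
      show "r = wave s r" if "r \<in> {0<..<s}" for r using wave_first_arc[OF s', of r] that by simp
    qed (use True t in auto)
    moreover have "axis_of 1 \<bullet> arc 1 (mu s) t = axis_of 1 \<bullet> mu s" by (rule axis_inner_arc) simp
    ultimately show ?thesis using pos m1 by (simp add: A inner3 mult_ac add.commute)
  next
    case False
    have "t \<noteq> switch s 0" using t by blast
    then have ts: "s < t" using False by (simp add: switch_def)
    define j where "j = nat \<lfloor>(t - s) / period s\<rfloor>"
    have v: "0 < period s" using period_pos[OF s'] .
    have "real j \<le> (t - s) / period s" "(t - s) / period s < real j + 1"
      using ts v by (auto simp: j_def)
    then have tj: "switch s j \<le> t" "t < switch s (Suc j)"
      using v by (auto simp: switch_def field_simps)
    moreover have "t \<noteq> switch s j" using t by blast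
    ultimately have tj': "switch s j < t" by simp
    let ?e = "(- 1) ^ Suc j :: real" and ?a = "switch s j"
    have e: "?e = 1 \<or> ?e = - 1" by (cases "even j") auto
    have nd: "rotx (sin \<alpha> * wave s ?a) (m ?a) = node s j"
      using m(2) by (intro wave_costate_node[OF m(1) s', where T = ?a]) auto
    have A: "rotx (sin \<alpha> * wave s t) (m t) = arc ?e (node s j) (t - ?a)"
      using wave_traj_arc[OF m(1) s', where T = t and t = t and j = j] tj nd by simp
    then have m1: "m t $ 1 = arc ?e (node s j) (t - ?a) $ 1" by (metis rotx_nth(1))
    have pos: "0 < ?e * m t $ 1"
      unfolding m1 using tj tj' by (intro arc_node_pos s') (auto simp: switch_def algebra_simps)
    have sg: "sgn (m t $ 1) = ?e" and ab: "\<bar>m t $ 1\<bar> = ?e * m t $ 1"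
      using e pos by (auto simp: sgn_if)
    have "(wave s has_real_derivative ?e) (at t)"
    proof (rule has_field_derivative_transform_within_open[where S = "{?a<..<switch s (Suc j)}" and f = "\<lambda>r. wave s ?a + ?e * (r - ?a)"])
      show "wave s ?a + ?e * (r - ?a) = wave s r" if "r \<in> {?a<..<switch s (Suc j)}" for r
        using wave_arc[OF s', of r j] that by simp
      show "((\<lambda>r. wave s ?a + ?e * (r - ?a)) has_real_derivative ?e) (at t)"
        by (auto intro!: derivative_eq_intros)
    qed (use tj tj' in auto)
    moreover have "axis_of ?e \<bullet> arc ?e (node s j) (t - ?a) = axis_of ?e \<bullet> node s j" by (rule axis_inner_arc[OF e])
    ultimately show ?thesis
      unfolding sg ab unfolding A inner3 axis_of_nth node_nth m1 by (simp add: mult_ac)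
  qed
  then show "(wave s has_real_derivative sgn (m t $ 1)) (at t)"
    and "cos \<alpha> * rotx (sin \<alpha> * wave s t) (m t) $ 3 + sin \<alpha> * \<bar>m t $ 1\<bar> = sin \<alpha> * cos \<alpha> * sin s" by auto
qed

text \<open>Normalized form of \<open>wave_costate\<close> for both signs; -h becomes the constant
  p0 of the maximum principle.\<close>

lemma signed_wave_costate:
  assumes s: "s \<in> {0<..pi}" and e: "e = 1 \<or> e = - 1"
  shows "\<exists>m h. sol (\<lambda>t. e * wave s t) m \<and> norm (m 0) = 1 \<and> m 0 $ 3 = 0 \<and> 0 \<le> h \<and>
    (\<forall>t. 0 < t \<longrightarrow> t \<notin> range (switch s) \<longrightarrow> ((\<lambda>t. e * wave s t) has_real_derivative sgn (m t $ 1)) (at t) \<and>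
      cos \<alpha> * rotx (sin \<alpha> * (e * wave s t)) (m t) $ 3 + sin \<alpha> * \<bar>m t $ 1\<bar> = h)"
proof -
  have s': "s \<in> {0..pi}" using s by auto
  obtain m where m: "sol (wave s) m" "m 0 = mu s"
    using sol_exists[OF lip1_continuous[OF wave_lip1[OF s']]] by blast
  define k where "k = inverse (norm (mu s))"
  have "mu s \<noteq> 0"
  proof (cases "s = pi")
    case True
    have "(sin \<alpha>)\<^sup>2 < (cos \<alpha>)\<^sup>2" using sin_less_cos sin_pos by (intro power_strict_mono) auto
    then show ?thesis using True by (auto simp: eq3_iff)
  next
    case False
    then have "0 < sin s" using s by (intro sin_gt_zero) auto
    then show ?thesis using cos_pos by (auto simp: eq3_iff)
  qed
  then have k: "0 < k" by (simp add: k_def)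
  define m1 where "m1 t = k *\<^sub>R m t" for t
  have m1: "sol (wave s) m1" "norm (m1 0) = 1" "m1 0 $ 3 = 0"
    using sol_scaleR[OF m(1)] \<open>mu s \<noteq> 0\<close> by (auto simp: m1_def[abs_def] m(2) k_def)
  define h where "h = k * (sin \<alpha> * cos \<alpha> * sin s)"
  have "0 \<le> h" using k sin_pos cos_pos sin_ge_zero[of s] s by (simp add: h_def)
  have d1: "(wave s has_real_derivative sgn (m1 t $ 1)) (at t)" if "0 < t" "t \<notin> range (switch s)" for t
    using wave_costate(1)[OF s m that] k by (simp add: m1_def sgn_mult)
  have h1: "cos \<alpha> * rotx (sin \<alpha> * wave s t) (m1 t) $ 3 + sin \<alpha> * \<bar>m1 t $ 1\<bar> = h" if "0 < t" "t \<notin> range (switch s)" for t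
  proof -
    have "cos \<alpha> * rotx (sin \<alpha> * wave s t) (m1 t) $ 3 + sin \<alpha> * \<bar>m1 t $ 1\<bar>
      = k * (cos \<alpha> * rotx (sin \<alpha> * wave s t) (m t) $ 3 + sin \<alpha> * \<bar>m t $ 1\<bar>)"
      unfolding m1_def linear_cmul[OF linear_rotx] using k by (simp add: abs_mult algebra_simps del: rotx_nth)
    then show ?thesis unfolding wave_costate(2)[OF s m that] h_def .
  qed
  from e show ?thesis
  proof
    assume "e = 1"
    with m1 d1 h1 \<open>0 \<le> h\<close> show ?thesis by (intro exI[of _ m1] exI[of _ h]) simp
  next
    assume e: "e = - 1"
    show ?thesis
    proof (rule exI[of _ "\<lambda>t. mirror (m1 t)"], rule exI[of _ h], intro conjI allI impI)
      show "sol (\<lambda>t. e * wave s t) (\<lambda>t. mirror (m1 t))" using sol_mirror[OF m1(1)] e by simp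
      show "norm (mirror (m1 0)) = 1"
        using m1(2) by (simp add: norm_eq_sqrt_inner inner3)
      fix t :: real assume t: "0 < t" "t \<notin> range (switch s)"
      show "((\<lambda>t. e * wave s t) has_real_derivative sgn (mirror (m1 t) $ 1)) (at t)"
        using DERIV_minus[OF d1[OF t]] e by (simp add: sgn_minus)
      have "rotx (sin \<alpha> * (e * wave s t)) (mirror (m1 t)) = mirror (rotx (sin \<alpha> * wave s t) (m1 t))"
        using e by (simp add: mirror_rotx)
      then show "cos \<alpha> * rotx (sin \<alpha> * (e * wave s t)) (mirror (m1 t)) $ 3 + sin \<alpha> * \<bar>mirror (m1 t) $ 1\<bar> = h"
        using h1[OF t] by simp
    qed (use m1 \<open>0 \<le> h\<close> in auto)
  qed
qed

lemma front_subset_extremal_front: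
  assumes T: "0 \<le> T"
  shows "front T \<subseteq> extremal_front \<alpha> T"
proof
  fix z assume "z \<in> front T"
  then obtain e0 s0 y where e0: "e0 = 1 \<or> e0 = - 1" and s0: "s0 \<in> {0..pi}" and y0: "sol (\<lambda>t. e0 * wave s0 t) y" "y 0 = N_pole"
    and z0: "z = rotx (sin \<alpha> * (e0 * wave s0 T)) (y T)"
    by (auto simp: front_def)
  \<comment> \<open>The costate is built from \<open>mu s\<close> with a first arc of positive
    duration, so s0 = 0 is rewritten as s = pi with the opposite sign.\<close>
  obtain e s where e: "e = 1 \<or> e = - 1" and s: "s \<in> {0<..pi}" and eq: "(\<lambda>t. e0 * wave s0 t) = (\<lambda>t. e * wave s t)"
  proof (cases "s0 = 0")
    case True
    then show thesis using e0 by (intro that[of "- e0" pi]) (auto simp: wave_zero_eq)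
  next
    case False
    then show thesis using e0 s0 by (intro that[of e0 s0]) auto
  qed
  define U where "U = (\<lambda>t. e * wave s t)"
  have y: "sol U y" using y0(1) by (simp add: eq U_def)
  have z: "z = rotx (sin \<alpha> * U T) (y T)" using z0 fun_cong[OF eq, of T] by (simp add: U_def)
  have U: "lip1 U" unfolding U_def using s by (intro lip1_signed_wave e) auto
  obtain m h where m: "sol U m" "norm (m 0) = 1" "m 0 $ 3 = 0" "0 \<le> h"
    and mUh: "\<forall>t. 0 < t \<longrightarrow> t \<notin> range (switch s) \<longrightarrow> (U has_real_derivative sgn (m t $ 1)) (at t) \<and>
      cos \<alpha> * rotx (sin \<alpha> * (e * wave s t)) (m t) $ 3 + sin \<alpha> * \<bar>m t $ 1\<bar> = h"
    using signed_wave_costate[OF s e, folded U_def] by blast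
  have mU: "(U has_real_derivative sgn (m t $ 1)) (at t)"
    and mh: "cos \<alpha> * rotx (sin \<alpha> * U t) (m t) $ 3 + sin \<alpha> * \<bar>m t $ 1\<bar> = h"
    if "0 < t" "t \<notin> range (switch s)" for t
    using mUh that by (simp_all add: U_def)
  define x where "x t = rotx (sin \<alpha> * U t) (y t)" for t
  define M where "M t = rotx (sin \<alpha> * U t) (m t)" for t
  \<comment> \<open>Recovers the covector from the switching vector: x \<times> (M \<times> x) = M,
    since M is orthogonal to the unit vector x.\<close>
  define p where "p t = M t \<times> x t" for t
  define u where "u t = sgn (m t $ 1)" for t
  have nx: "norm (x t) = 1" and nM: "norm (M t) = 1" for t
    using sol_norm[OF y, of t 0] sol_norm[OF m(1), of t 0] by (simp_all add: x_def M_def y0(2) m(2))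
  have Mx: "M t \<bullet> x t = 0" for t
  proof -
    have "m 0 \<bullet> y 0 = 0" by (simp add: y0(2) inner3 m(3))
    then show ?thesis
      unfolding M_def x_def inner_rotx sol_inner[OF m(1) y, of t 0] .
  qed
  have xp: "x t \<times> p t = M t" for t
    unfolding p_def Lagrange using nx[of t] Mx[of t] by (simp add: norm_eq_1 inner_commute)
  have M1: "M t $ 1 = m t $ 1" for t by (simp add: M_def)
  have xl: "norm (x r - x t) \<le> 2 * \<bar>r - t\<bar>" and Ml: "norm (M r - M t) \<le> 2 * \<bar>r - t\<bar>" for r t
    unfolding x_def M_def by (rule traj_lipschitz[OF U]; simp add: y m y0)+
  have N: "negligible (insert 0 (range (switch s)))"
    using countable_imp_null_set_lborel[of "insert 0 (range (switch s))"]
    unfolding negligible_iff_null_sets by (intro null_sets_completionI) auto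
  have x_der: "(x has_vector_derivative axis_of (u t) \<times> x t) (at t within {0..T})"
    and M_der: "(M has_vector_derivative axis_of (u t) \<times> M t) (at t within {0..T})"
    if "t \<in> {0..T} - insert 0 (range (switch s))" for t
  proof -
    have "(U has_real_derivative u t) (at t within {0..T})"
      using mU[of t] that by (auto simp: u_def intro: has_field_derivative_at_within)
    from sol_has_vector_derivative[OF y this] sol_has_vector_derivative[OF m(1) this]
    show "(x has_vector_derivative axis_of (u t) \<times> x t) (at t within {0..T})"
      "(M has_vector_derivative axis_of (u t) \<times> M t) (at t within {0..T})"
      unfolding x_def[abs_def] M_def[abs_def] .
  qed
  have p_der: "(p has_vector_derivative axis_of (u t) \<times> p t) (at t within {0..T})"
    if "t \<in> {0..T} - insert 0 (range (switch s))" for t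
  proof -
    have "(axis_of (u t) \<times> M t) \<times> x t + M t \<times> (axis_of (u t) \<times> x t) = axis_of (u t) \<times> (M t \<times> x t)"
      unfolding eq3_iff cross_components vector_add_component by (simp add: algebra_simps)
    then show ?thesis
      using has_vector_derivative_cross[OF M_der[OF that] x_der[OF that]] by (simp add: p_def[abs_def])
  qed
  have ham: "pmp_hamiltonian \<alpha> (x t) (p t) w = cos \<alpha> * M t $ 3 + w * (sin \<alpha> * m t $ 1)" for t w
    unfolding hamiltonian_eq xp M1 ..
  have um: "u t * m t $ 1 = \<bar>m t $ 1\<bar>" for t by (simp add: u_def abs_sgn mult.commute)
  have "admissible_traj \<alpha> T u x"
    unfolding admissible_traj_def field_eq_cross
  proof (intro conjI ballI T)
    have "m \<in> borel_measurable borel"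
      by (rule borel_measurable_continuous_onI[OF sol_continuous[OF m(1)]])
    then have "u \<in> borel_measurable borel"
      unfolding u_def[abs_def] sgn_if by measurable
    then show "u \<in> borel_measurable (lebesgue_on {0..T})"
      by (intro measurable_restrict_space1 measurable_completion) simp
    show "\<bar>u t\<bar> \<le> 1" for t by (simp add: u_def sgn_if)
    show "x t \<in> sphere 0 1" for t using nx by simp
    show "x 0 = N_pole" using lip1_zero[OF U] by (simp add: x_def y0)
    show "\<exists>L. L-lipschitz_on {0..T} x"
      using xl by (intro exI[of _ 2]) (auto simp: lipschitz_on_def dist_norm)
    show "AE t in lebesgue_on {0..T}. (x has_vector_derivative axis_of (u t) \<times> x t) (at t within {0..T})"
    proof -
      have "\<exists>N. negligible N \<and> (\<forall>t\<in>{0..T} - N. (x has_vector_derivative axis_of (u t) \<times> x t) (at t within {0..T}))"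
        by (intro exI[of _ "insert 0 (range (switch s))"] conjI N ballI x_der)
      then show ?thesis by (subst AE_lebesgue_on_iff_negligible) auto
    qed
  qed
  moreover have "satisfies_PMP \<alpha> T u x"
    unfolding satisfies_PMP_def covector_field_eq_cross
  proof (rule exI[of _ p], rule exI[of _ "- h"], intro conjI ballI)
    show "- h \<le> 0" using m(4) by simp
    show "p t \<noteq> 0" for t using xp[of t] nM[of t] by auto
    show "p t \<bullet> x t = 0" for t by (simp add: p_def dot_cross_self)
    have "norm (p r - p t) \<le> 4 * \<bar>r - t\<bar>" for r t
    proof -
      have "p r - p t = (M r - M t) \<times> x r + M t \<times> (x r - x t)"
        by (simp add: p_def Cross3.left_diff_distrib Cross3.right_diff_distrib)
      then have "norm (p r - p t) \<le> norm (M r - M t) * norm (x r) + norm (M t) * norm (x r - x t)"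
        using norm_triangle_le[OF add_mono[OF norm_cross_le norm_cross_le]] by metis
      then show ?thesis using xl[of r t] Ml[of r t] by (simp add: nx nM)
    qed
    then show "\<exists>L. L-lipschitz_on {0..T} p"
      by (intro exI[of _ 4]) (auto simp: lipschitz_on_def dist_norm)
    show "AE t in lebesgue_on {0..T}. (p has_vector_derivative axis_of (u t) \<times> p t) (at t within {0..T}) \<and>
       pmp_hamiltonian \<alpha> (x t) (p t) (u t) + - h = 0 \<and>
       (\<forall>w\<in>{-1..1}. pmp_hamiltonian \<alpha> (x t) (p t) w \<le> pmp_hamiltonian \<alpha> (x t) (p t) (u t))"
    proof (subst AE_lebesgue_on_iff_negligible, simp, intro exI[of _ "insert 0 (range (switch s))"] conjI N ballI)
      fix t assume t: "t \<in> {0..T} - insert 0 (range (switch s))"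
      show "(p has_vector_derivative axis_of (u t) \<times> p t) (at t within {0..T})" by (rule p_der[OF t])
      have H: "pmp_hamiltonian \<alpha> (x t) (p t) (u t) = cos \<alpha> * M t $ 3 + sin \<alpha> * \<bar>m t $ 1\<bar>"
        unfolding ham um[symmetric] by (simp add: mult_ac)
      show "pmp_hamiltonian \<alpha> (x t) (p t) (u t) + - h = 0"
        unfolding H using mh[of t] t by (simp add: M_def)
      show "pmp_hamiltonian \<alpha> (x t) (p t) w \<le> pmp_hamiltonian \<alpha> (x t) (p t) (u t)" if "w \<in> {-1..1}" for w
      proof -
        have "\<bar>w\<bar> * \<bar>m t $ 1\<bar> \<le> 1 * \<bar>m t $ 1\<bar>" using that by (intro mult_right_mono) auto
        then have "w * m t $ 1 \<le> \<bar>m t $ 1\<bar>" using abs_ge_self[of "w * m t $ 1"] by (simp add: abs_mult)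
        then have "sin \<alpha> * (w * m t $ 1) \<le> sin \<alpha> * \<bar>m t $ 1\<bar>" using sin_pos by (intro mult_left_mono) auto
        then show ?thesis unfolding H unfolding ham by (simp add: mult_ac)
      qed
    qed
  qed
  ultimately show "z \<in> extremal_front \<alpha> T"
    unfolding extremal_front_def extremal_traj_def z x_def[of T, symmetric] by blast
qed

text \<open>For the inclusion from right to left, the endpoint of an optimal trajectory lies on the
  front of the first time t0 at which it is reached; an admissible trajectory reaches it at t0, so
  optimality forces t0 = T.\<close>

lemma extremal_front_eq_optimal_front:
  assumes T: "0 \<le> T" and opt: "\<And>x t. x \<in> front T \<Longrightarrow> 0 \<le> t \<Longrightarrow> t < T \<Longrightarrow> x \<notin> reach t"
  shows "extremal_front \<alpha> T = optimal_front \<alpha> T"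
proof (intro equalityI subsetI)
  fix z assume z: "z \<in> extremal_front \<alpha> T"
  then obtain u x where ux: "z = x T" "admissible_traj \<alpha> T u x"
    by (auto simp: extremal_front_def extremal_traj_def)
  have "T \<le> T'" if "admissible_traj \<alpha> T' u' x'" "x' T' = x T" for T' u' x'
  proof (rule ccontr)
    assume "\<not> T \<le> T'"
    moreover have "0 \<le> T'" using that by (simp add: admissible_traj_def)
    ultimately show False
      using opt[of z T'] z extremal_front_subset admissible_in_reach[OF that(1)] that(2) ux by auto
  qed
  with ux show "z \<in> optimal_front \<alpha> T"
    unfolding optimal_front_def time_optimal_traj_def by blast
next
  fix z assume "z \<in> optimal_front \<alpha> T"
  then obtain u x where ux: "z = x T" "admissible_traj \<alpha> T u x"
    and min: "\<And>T' u' x'. admissible_traj \<alpha> T' u' x' \<Longrightarrow> x' T' = x T \<Longrightarrow> T \<le> T'"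
    unfolding optimal_front_def time_optimal_traj_def by blast
  have "z \<in> reach T" using admissible_in_reach[OF ux(2)] ux(1) by simp
  then obtain t0 where t0: "0 \<le> t0" "t0 \<le> T" "z \<in> front t0"
    using reach_first_time[OF _ T] by metis
  then have "z \<in> extremal_front \<alpha> t0" using front_subset_extremal_front by blast
  then obtain u' x' where "z = x' t0" "admissible_traj \<alpha> t0 u' x'"
    by (auto simp: extremal_front_def extremal_traj_def)
  then have "T \<le> t0" using min ux by metis
  with t0 \<open>z \<in> extremal_front \<alpha> t0\<close> show "z \<in> extremal_front \<alpha> T" by simp
qed

end

section \<open>Spinor formula for the front\<close>

text \<open>The Hopf map from unit spinors to the sphere, with (1, 0) over the north pole. Rotations
  of the sphere act linearly on (A, B), and a common phase is invisible.\<close>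

definition hopf :: "complex \<Rightarrow> complex \<Rightarrow> real^3" where
  "hopf A B = vector [2 * Re (cnj A * B), 2 * Im (cnj A * B), (cmod A)\<^sup>2 - (cmod B)\<^sup>2]"

lemma hopf_nth [simp]:
  "hopf A B $ 1 = 2 * (Re A * Re B + Im A * Im B)" "hopf A B $ 2 = 2 * (Re A * Im B - Im A * Re B)"
  "hopf A B $ 3 = (Re A)\<^sup>2 + (Im A)\<^sup>2 - ((Re B)\<^sup>2 + (Im B)\<^sup>2)"
  by (simp_all add: hopf_def cmod_power2)

lemma hopf_phase: "hopf (- \<i> * A) (- \<i> * B) = hopf A B"
  by (simp add: eq3_iff algebra_simps)

lemma mirror_hopf: "mirror (hopf A B) = hopf A (- B)"
  by (simp add: eq3_iff)

lemma mirror_mirror [simp]: "mirror (mirror x) = x"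
  by (simp add: eq3_iff)

lemma norm_hopf: "norm (hopf A B) = (cmod A)\<^sup>2 + (cmod B)\<^sup>2"
proof (rule power2_eq_imp_eq)
  show "(norm (hopf A B))\<^sup>2 = ((cmod A)\<^sup>2 + (cmod B)\<^sup>2)\<^sup>2"
    unfolding norm3_sq hopf_nth cmod_power2 by (simp add: power2_eq_square algebra_simps)
qed auto

(* The interior arcs, seen in coordinates mirrored at every switch, are all powers of one rotation,
   namely cos b + sin b J with J * J = - 1; turn_fst and turn_snd are the components of cos + sin J. *)
definition turn_fst :: "real \<Rightarrow> real \<Rightarrow> real \<Rightarrow> complex \<Rightarrow> complex \<Rightarrow> complex" where
  "turn_fst k l r p q = of_real (cos r) * p + of_real (sin r) * (of_real k * q - of_real l * \<i> * p)"

definition turn_snd :: "real \<Rightarrow> real \<Rightarrow> real \<Rightarrow> complex \<Rightarrow> complex \<Rightarrow> complex" where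
  "turn_snd k l r p q = of_real (cos r) * q + of_real (sin r) * (of_real l * \<i> * q - of_real k * p)"

lemma turn_add:
  assumes "k\<^sup>2 + l\<^sup>2 = 1"
  shows "turn_fst k l r (turn_fst k l r' p q) (turn_snd k l r' p q) = turn_fst k l (r + r') p q"
    and "turn_snd k l r (turn_fst k l r' p q) (turn_snd k l r' p q) = turn_snd k l (r + r') p q"
proof -
  have *: "c * (c' * p + s' * (k * q - l * i * p)) + s * (k * (c' * q + s' * (l * i * q - k * p)) - l * i * (c' * p + s' * (k * q - l * i * p)))
      = (c * c' - s * s') * p + (s * c' + c * s') * (k * q - l * i * p)"
    "c * (c' * q + s' * (l * i * q - k * p)) + s * (l * i * (c' * q + s' * (l * i * q - k * p)) - k * (c' * p + s' * (k * q - l * i * p)))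
      = (c * c' - s * s') * q + (s * c' + c * s') * (l * i * q - k * p)"
    if "k\<^sup>2 + l\<^sup>2 = 1" "i * i = - 1" for c c' s s' k l i :: complex
    using that by algebra+
  have kl: "(of_real k)\<^sup>2 + (of_real l)\<^sup>2 = (1::complex)"
    using assms by (metis of_real_1 of_real_add of_real_power)
  have ii: "\<i> * \<i> = - 1" by simp
  show "turn_fst k l r (turn_fst k l r' p q) (turn_snd k l r' p q) = turn_fst k l (r + r') p q"
    unfolding turn_fst_def turn_snd_def cos_add sin_add using *(1)[OF kl ii] by simp
  show "turn_snd k l r (turn_fst k l r' p q) (turn_snd k l r' p q) = turn_snd k l (r + r') p q"
    unfolding turn_fst_def turn_snd_def cos_add sin_add using *(2)[OF kl ii] by simp
qed

context bang
begin

text \<open>\<open>rotA t\<close> and \<open>rotB t\<close> are the entries of the SU(2) matrix over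
  the rotation by t about \<open>axis_of 1\<close>; see \<open>arc_hopf\<close>.\<close>

definition rotA :: "real \<Rightarrow> complex" where
  "rotA t = Complex (cos (t / 2)) (cos \<alpha> * sin (t / 2))"

definition rotB :: "real \<Rightarrow> real" where
  "rotB t = sin \<alpha> * sin (t / 2)"

lemma arc_hopf:
  "arc 1 (hopf A B) t = hopf (cnj (rotA t) * A - \<i> * of_real (rotB t) * B) (rotA t * B - \<i> * of_real (rotB t) * A)"
proof -
  define C S c s where "C = cos (t / 2)" "S = sin (t / 2)" "c = cos \<alpha>" "s = sin \<alpha>"
  have 1: "s\<^sup>2 + c\<^sup>2 = 1" by (simp add: C_S_c_s_def)
  have t: "sin t = 2 * S * C" "1 - cos t = 2 * S\<^sup>2"
    using sin_double[of "t / 2"] cos_double_sin[of "t / 2"] by (simp_all add: C_S_c_s_def)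
  have t': "cos t = C\<^sup>2 - S\<^sup>2 * (s\<^sup>2 + c\<^sup>2)"
    unfolding 1 using cos_double[of "t / 2"] by (simp add: C_S_c_s_def)
  have R: "Re (rotA t) = C" "Im (rotA t) = c * S" "rotB t = s * S"
    by (simp_all add: rotA_def rotB_def C_S_c_s_def)
  show ?thesis
    unfolding eq3_iff arc_nth hopf_nth C_S_c_s_def(3,4)[symmetric] t unfolding t'
    by (simp add: R power2_eq_square) (simp add: algebra_simps)
qed

text \<open>\<open>gap s\<close> divided by sin \<alpha>, and the slope of \<open>node s j\<close>
  in the plane of the last two coordinates up to sign. \<open>tilt_cos\<close> and
  \<open>tilt_sin\<close> are the cosine and sine of its arctangent.\<close>

definition tilt :: "real \<Rightarrow> real" where
  "tilt s = sin \<alpha> * sin s / ((cos \<alpha>)\<^sup>2 + (sin \<alpha>)\<^sup>2 * cos s)"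

text \<open>The angle b with cos b = cos \<alpha> sin (period s / 2), half the rotation angle of an
  interior arc followed by the mirror. The arctangent form shows how close it is to
  \<alpha>.\<close>

definition turn_angle :: "real \<Rightarrow> real" where
  "turn_angle s = arctan (tan \<alpha> * sqrt (1 + (tilt s)\<^sup>2))"

definition tilt_cos :: "real \<Rightarrow> real" where "tilt_cos s = 1 / sqrt (1 + (tilt s)\<^sup>2)"
definition tilt_sin :: "real \<Rightarrow> real" where "tilt_sin s = tilt s / sqrt (1 + (tilt s)\<^sup>2)"

lemma tilt_cos_sin: "(tilt_cos s)\<^sup>2 + (tilt_sin s)\<^sup>2 = 1"
  by (simp add: tilt_cos_def tilt_sin_def power_divide add_divide_distrib[symmetric] add_nonneg_eq_0_iff)

lemma turn_angle_trig:
  "cos (turn_angle s) = cos \<alpha> * sin (period s / 2)"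
  "sin (turn_angle s) * tilt_cos s = sin \<alpha> * sin (period s / 2)"
  "sin (turn_angle s) * tilt_sin s = - cos (period s / 2)"
proof -
  let ?q = "sqrt (1 + (tilt s)\<^sup>2)"
  have q: "0 < ?q" "?q\<^sup>2 = 1 + (tilt s)\<^sup>2" by (simp_all add: add_pos_nonneg)
  have g: "gap s = sin \<alpha> * tilt s" by (simp add: gap_def tilt_def power2_eq_square)
  have ta: "tan \<alpha> * cos \<alpha> = sin \<alpha>" using cos_pos by (simp add: tan_def)
  have "1 + (tan \<alpha> * ?q)\<^sup>2 = (1 + (gap s)\<^sup>2) / (cos \<alpha>)\<^sup>2"
  proof -
    have "(1 + (tan \<alpha> * ?q)\<^sup>2) * (cos \<alpha>)\<^sup>2 = (cos \<alpha>)\<^sup>2 + (tan \<alpha> * cos \<alpha>)\<^sup>2 * ?q\<^sup>2"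
      by (simp add: algebra_simps power_mult_distrib)
    also have "\<dots> = 1 + (gap s)\<^sup>2"
      unfolding ta q(2) g by (simp add: algebra_simps power_mult_distrib cos_squared_eq)
    finally show ?thesis using cos_pos by (simp add: field_simps)
  qed
  then have "cos (turn_angle s) = 1 / sqrt ((1 + (gap s)\<^sup>2) / (cos \<alpha>)\<^sup>2)"
    unfolding turn_angle_def cos_arctan by simp
  also have "\<dots> = cos \<alpha> * cos (arctan (gap s))"
    using cos_pos by (simp add: real_sqrt_divide cos_arctan)
  finally show c: "cos (turn_angle s) = cos \<alpha> * sin (period s / 2)"
    unfolding gap_period .
  have "sin (turn_angle s) = tan (turn_angle s) * cos (turn_angle s)"
    using cos_arctan_not_zero[of "tan \<alpha> * ?q"] by (simp add: tan_def turn_angle_def)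
  also have "tan (turn_angle s) = tan \<alpha> * ?q" by (simp add: turn_angle_def tan_arctan)
  finally have sn: "sin (turn_angle s) = (tan \<alpha> * cos \<alpha>) * (?q * sin (period s / 2))"
    unfolding c by (simp add: mult_ac)
  show 2: "sin (turn_angle s) * tilt_cos s = sin \<alpha> * sin (period s / 2)"
    unfolding sn ta tilt_cos_def using q by simp
  have "tilt_sin s = tilt s * tilt_cos s" by (simp add: tilt_sin_def tilt_cos_def)
  then have "sin (turn_angle s) * tilt_sin s = tilt s * (sin (turn_angle s) * tilt_cos s)" by simp
  then show "sin (turn_angle s) * tilt_sin s = - cos (period s / 2)"
    unfolding 2 gap_period g by simp
qed

text \<open>\<open>turnP\<close> and \<open>turnQ\<close> form the spinor at switch n after n + 1
  mirrorings. The initial pair is the end of the first arc, with its second component negated by the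
  first mirroring.\<close>

abbreviation turnP :: "real \<Rightarrow> nat \<Rightarrow> complex" where
  "turnP s n \<equiv> turn_fst (tilt_cos s) (tilt_sin s) (n * turn_angle s) (cnj (rotA s)) (\<i> * of_real (rotB s))"
abbreviation turnQ :: "real \<Rightarrow> nat \<Rightarrow> complex" where
  "turnQ s n \<equiv> turn_snd (tilt_cos s) (tilt_sin s) (n * turn_angle s) (cnj (rotA s)) (\<i> * of_real (rotB s))"

text \<open>On spinors the mirror negates the second component. With this sign included, every
  interior arc becomes the same matrix, up to the phase - \<i> that \<open>hopf\<close> does not
  see.\<close>

lemma period_turn:
  "cnj (rotA (period s)) * P - \<i> * of_real (rotB (period s)) * Q = - \<i> * turn_fst (tilt_cos s) (tilt_sin s) (turn_angle s) P Q"
  "- (rotA (period s) * Q - \<i> * of_real (rotB (period s)) * P) = - \<i> * turn_snd (tilt_cos s) (tilt_sin s) (turn_angle s) P Q"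
proof -
  let ?C = "cos (period s / 2)" and ?S = "sin (period s / 2)"
  have A: "rotA (period s) = of_real ?C + \<i> * of_real (cos \<alpha> * ?S)" "cnj (rotA (period s)) = of_real ?C - \<i> * of_real (cos \<alpha> * ?S)"
    by (simp_all add: rotA_def complex_eq_iff)
  have F: "turn_fst (tilt_cos s) (tilt_sin s) (turn_angle s) P Q = of_real (cos (turn_angle s)) * P
     + (of_real (sin (turn_angle s) * tilt_cos s) * Q - of_real (sin (turn_angle s) * tilt_sin s) * \<i> * P)"
    "turn_snd (tilt_cos s) (tilt_sin s) (turn_angle s) P Q = of_real (cos (turn_angle s)) * Q
     + (of_real (sin (turn_angle s) * tilt_sin s) * \<i> * Q - of_real (sin (turn_angle s) * tilt_cos s) * P)"
    by (simp_all add: turn_fst_def turn_snd_def algebra_simps)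
  show "cnj (rotA (period s)) * P - \<i> * of_real (rotB (period s)) * Q = - \<i> * turn_fst (tilt_cos s) (tilt_sin s) (turn_angle s) P Q"
    unfolding F turn_angle_trig A by (simp add: rotB_def algebra_simps)
  show "- (rotA (period s) * Q - \<i> * of_real (rotB (period s)) * P) = - \<i> * turn_snd (tilt_cos s) (tilt_sin s) (turn_angle s) P Q"
    unfolding F turn_angle_trig A by (simp add: rotB_def algebra_simps)
qed

lemma turn_Suc:
  "turnP s (Suc n) = turn_fst (tilt_cos s) (tilt_sin s) (turn_angle s) (turnP s n) (turnQ s n)"
  "turnQ s (Suc n) = turn_snd (tilt_cos s) (tilt_sin s) (turn_angle s) (turnP s n) (turnQ s n)"
  unfolding turn_add[OF tilt_cos_sin] by (simp_all add: algebra_simps)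

lemma arc_mirror: "arc (- e) (mirror x) t = mirror (arc e x t)"
  by (simp add: eq3_iff arc_nth algebra_simps)

lemma arc_mirror_power: "arc ((- 1) ^ n) ((mirror ^^ n) x) t = (mirror ^^ n) (arc 1 x t)"
proof (induction n)
  case (Suc n)
  then show ?case using arc_mirror[of "(- 1) ^ n" "(mirror ^^ n) x" t] by simp
qed simp

lemma arc_hopf_mirror:
  "(mirror ^^ Suc n) (arc 1 (hopf (turnP s n) (turnQ s n)) (period s)) = (mirror ^^ Suc (Suc n)) (hopf (turnP s (Suc n)) (turnQ s (Suc n)))"
proof -
  have "arc 1 (hopf (turnP s n) (turnQ s n)) (period s) = mirror (hopf (turnP s (Suc n)) (turnQ s (Suc n)))"
    unfolding arc_hopf turn_Suc
    by (subst hopf_phase[symmetric], subst mirror_hopf[symmetric, of _ "- _", simplified])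
       (simp only: period_turn(1) period_turn(2)[symmetric] minus_minus mirror_hopf)
  then show ?thesis by (simp add: funpow_swap1)
qed

text \<open>\<open>endA\<close> and \<open>endB\<close> form the spinor after a last arc of duration
  t that follows n interior arcs, in mirrored coordinates.\<close>

definition endA :: "real \<Rightarrow> nat \<Rightarrow> real \<Rightarrow> complex" where
  "endA s n t = cnj (rotA t) * turnP s n - \<i> * of_real (rotB t) * turnQ s n"

definition endB :: "real \<Rightarrow> nat \<Rightarrow> real \<Rightarrow> complex" where
  "endB s n t = rotA t * turnQ s n - \<i> * of_real (rotB t) * turnP s n"

lemma wave_traj_hopf:
  assumes y: "sol (wave s) y" "y 0 = N_pole" and s: "s \<in> {0..pi}" and t: "t \<in> {switch s n..switch s (Suc n)}"
  shows "rotx (sin \<alpha> * wave s t) (y t) = (mirror ^^ Suc n) (hopf (endA s n (t - switch s n)) (endB s n (t - switch s n)))"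
proof -
  have start: "rotx (sin \<alpha> * wave s (switch s n)) (y (switch s n)) = (mirror ^^ Suc n) (hopf (turnP s n) (turnQ s n))" for n
  proof (induction n)
    case 0
    have "N_pole = hopf 1 0" by (simp add: eq3_iff)
    then have "rotx (sin \<alpha> * wave s s) (y s) = hopf (cnj (rotA s)) (- \<i> * of_real (rotB s))"
      using wave_traj_first[OF y(1) s, of s s] s y(2) arc_hopf[of 1 0 s] by simp
    then show ?case
      by (simp add: switch_def turn_fst_def turn_snd_def mirror_hopf)
  next
    case (Suc n)
    have d: "switch s (Suc n) - switch s n = period s" by (simp add: switch_def algebra_simps)
    have "rotx (sin \<alpha> * wave s (switch s (Suc n))) (y (switch s (Suc n)))
      = arc ((- 1) ^ Suc n) ((mirror ^^ Suc n) (hopf (turnP s n) (turnQ s n))) (period s)"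
      using wave_traj_arc[OF y(1) s, where T = "switch s (Suc n)" and t = "switch s (Suc n)" and j = n]
        switch_mono[OF s, of n] Suc by (simp only: d) simp
    also have "\<dots> = (mirror ^^ Suc (Suc n)) (hopf (turnP s (Suc n)) (turnQ s (Suc n)))"
      unfolding arc_mirror_power arc_hopf_mirror ..
    finally show ?case .
  qed
  have "rotx (sin \<alpha> * wave s t) (y t) = arc ((- 1) ^ Suc n) ((mirror ^^ Suc n) (hopf (turnP s n) (turnQ s n))) (t - switch s n)"
    using wave_traj_arc[OF y(1) s, where T = t and t = t and j = n] t start[of n] by simp
  then show ?thesis
    unfolding arc_mirror_power arc_hopf endA_def endB_def .
qed

lemma front_wave:
  assumes "x \<in> front T"
  obtains e s z where "e = 1 \<or> e = (- 1 :: real)" "s \<in> {0..pi}" "sol (wave s) z" "z 0 = N_pole"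
    "x = (if e = 1 then id else mirror) (rotx (sin \<alpha> * wave s T) (z T))"
proof -
  obtain e s y where e: "e = 1 \<or> e = - 1" and s: "s \<in> {0..pi}" and y: "sol (\<lambda>t. e * wave s t) y" "y 0 = N_pole"
    and x: "x = rotx (sin \<alpha> * (e * wave s T)) (y T)"
    using assms by (auto simp: front_def)
  have mN: "mirror N_pole = N_pole" by (simp add: eq3_iff)
  define z where "z = (if e = 1 then y else (\<lambda>t. mirror (y t)))"
  have "sol (wave s) z" "z 0 = N_pole"
    using e y sol_mirror[OF y(1)] mN by (auto simp: z_def)
  moreover have "x = (if e = 1 then id else mirror) (rotx (sin \<alpha> * wave s T) (z T))"
    using e by (auto simp: x z_def mirror_rotx)
  ultimately show thesis using that e s by blast
qed

lemma front_cases: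
  assumes "x \<in> front T" "0 \<le> T"
  obtains e s where "e = 1 \<or> e = (- 1 :: real)" "s \<in> {0..pi}" "T \<le> s" "x = (if e = 1 then arc 1 N_pole T else mirror (arc 1 N_pole T))"
  | e s n where "e = 1 \<or> e = (- 1 :: real)" "s \<in> {0..pi}" "T \<in> {switch s n..switch s (Suc n)}"
    "x = (if e = 1 then id else mirror) ((mirror ^^ Suc n) (hopf (endA s n (T - switch s n)) (endB s n (T - switch s n))))"
proof -
  obtain e s z where e: "e = 1 \<or> e = (- 1 :: real)" and s: "s \<in> {0..pi}" and z: "sol (wave s) z" "z 0 = N_pole"
    and xz: "x = (if e = 1 then id else mirror) (rotx (sin \<alpha> * wave s T) (z T))"
    using assms(1) by (rule front_wave)
  show thesis
  proof (cases "T \<le> s")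
    case True
    have "rotx (sin \<alpha> * wave s T) (z T) = arc 1 N_pole T"
      using wave_traj_first[OF z(1) s, of T T] z(2) True assms(2) by simp
    then show thesis using that(1)[OF e s True] xz by auto
  next
    case False
    define n where "n = nat \<lfloor>(T - s) / period s\<rfloor>"
    have v: "0 < period s" using period_pos[OF s] .
    have "real n \<le> (T - s) / period s" "(T - s) / period s < real n + 1"
      using False v by (auto simp: n_def)
    then have T: "T \<in> {switch s n..switch s (Suc n)}"
      using v by (auto simp: switch_def field_simps)
    from that(2)[OF e s T] xz show thesis
      unfolding wave_traj_hopf[OF z s T] by blast
  qed
qed

end

section \<open>The south pole\<close>

lemma cos_ge_quadratic: "1 - x\<^sup>2 / 2 \<le> cos (x::real)"
  using chord_le_arc[of x] by simp

lemma sin_ge_cubic: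
  assumes "0 \<le> (x::real)"
  shows "x * (1 - x\<^sup>2 / 2) \<le> sin x"
proof (cases "x = 0")
  case False
  then have "0 < x" using assms by simp
  then obtain z where z: "0 < z" "z < x" "sin x - sin 0 = (x - 0) * cos z"
    using MVT2[of 0 x sin cos] by auto
  have "z\<^sup>2 \<le> x\<^sup>2" using z by (intro power_mono) auto
  then have "1 - x\<^sup>2 / 2 \<le> cos z" using cos_ge_quadratic[of z] by simp
  then show ?thesis using z \<open>0 < x\<close> by simp
qed simp

lemma sqrt_one_plus_le: "0 \<le> (x::real) \<Longrightarrow> sqrt (1 + x) \<le> 1 + x / 2"
  by (rule real_le_lsqrt) (auto simp: power2_eq_square algebra_simps)

lemma arctan_diff_le: "\<bar>arctan x - arctan y\<bar> \<le> \<bar>x - y\<bar>"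
proof -
  have "norm (arctan x - arctan y) \<le> 1 * norm (x - y)"
  proof (rule field_differentiable_bound[of UNIV arctan "\<lambda>x. inverse (1 + x\<^sup>2)"])
    show "norm (inverse (1 + z\<^sup>2)) \<le> 1" for z :: real
      by (simp add: inverse_le_1_iff abs_of_pos add_pos_nonneg)
  qed (auto intro!: derivative_eq_intros simp: add_nonneg_eq_0_iff)
  then show ?thesis by simp
qed

context bang
begin

lemma tilt_bounds:
  assumes "s \<in> {0..pi}" "\<alpha> \<le> 1/2"
  shows "0 \<le> tilt s" "tilt s \<le> 2 * \<alpha>"
proof -
  let ?D = "(cos \<alpha>)\<^sup>2 + (sin \<alpha>)\<^sup>2 * cos s"
  have "sin \<alpha> \<le> \<alpha>" using sin_x_le_x \<alpha> by auto
  then have "(sin \<alpha>)\<^sup>2 \<le> (1/2)\<^sup>2" using sin_pos assms(2) by (intro power_mono) auto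
  then have s4: "(sin \<alpha>)\<^sup>2 \<le> 1/4" by (simp add: power2_eq_square)
  have "(sin \<alpha>)\<^sup>2 * (- 1) \<le> (sin \<alpha>)\<^sup>2 * cos s" by (intro mult_left_mono) auto
  then have D: "1/2 \<le> ?D" using s4 by (simp add: cos_squared_eq)
  show "0 \<le> tilt s" unfolding tilt_def using D sin_pos assms sin_ge_zero[of s] by (intro divide_nonneg_nonneg mult_nonneg_nonneg) auto
  have "sin \<alpha> * sin s \<le> \<alpha> * 1"
    using \<open>sin \<alpha> \<le> \<alpha>\<close> \<alpha> sin_pos assms by (intro mult_mono) (auto intro: sin_ge_zero)
  also have "\<dots> \<le> 2 * \<alpha> * ?D" using D \<alpha> by simp
  finally show "tilt s \<le> 2 * \<alpha>" unfolding tilt_def using D by (simp add: pos_divide_le_eq)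
qed

text \<open>The tilt is O(\<alpha>), so the square root is 1 + O(\<alpha>^2), and tan \<alpha> \<le>
  2 \<alpha> makes the excess cubic. This order matters, as the angle gets multiplied by the number
  of arcs.\<close>

lemma turn_angle_bounds:
  assumes "s \<in> {0..pi}" "\<alpha> \<le> 1/2"
  shows "0 \<le> turn_angle s" "turn_angle s \<le> \<alpha> + 4 * \<alpha> ^ 3"
proof -
  have ta: "0 \<le> tan \<alpha>" using sin_pos cos_pos by (simp add: tan_def)
  then show "0 \<le> turn_angle s" by (simp add: turn_angle_def)
  have "1 - \<alpha>\<^sup>2 / 2 \<le> cos \<alpha>" by (rule cos_ge_quadratic)
  moreover have "\<alpha>\<^sup>2 \<le> (1/2)\<^sup>2" using \<alpha> assms by (intro power_mono) auto
  ultimately have "1 / 2 \<le> cos \<alpha>" by (simp add: power2_eq_square)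
  then have "2 * \<alpha> * (1 / 2) \<le> 2 * \<alpha> * cos \<alpha>"
    using \<alpha> by (intro mult_left_mono) auto
  then have "sin \<alpha> \<le> 2 * \<alpha> * cos \<alpha>"
    using sin_x_le_x[of \<alpha>] \<alpha> by linarith
  then have t2: "tan \<alpha> \<le> 2 * \<alpha>" using cos_pos by (simp add: tan_def pos_divide_le_eq)
  have "(tilt s)\<^sup>2 \<le> (2 * \<alpha>)\<^sup>2" using tilt_bounds[OF assms] by (intro power_mono)
  then have q: "sqrt (1 + (tilt s)\<^sup>2) - 1 \<le> 2 * \<alpha>\<^sup>2" "0 \<le> sqrt (1 + (tilt s)\<^sup>2) - 1"
    using sqrt_one_plus_le[of "(tilt s)\<^sup>2"] by (simp_all add: power_mult_distrib)
  have "turn_angle s - arctan (tan \<alpha>) \<le> \<bar>tan \<alpha> * sqrt (1 + (tilt s)\<^sup>2) - tan \<alpha>\<bar>"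
    using arctan_diff_le[of "tan \<alpha> * sqrt (1 + (tilt s)\<^sup>2)" "tan \<alpha>"] by (simp add: turn_angle_def)
  also have "\<dots> = tan \<alpha> * (sqrt (1 + (tilt s)\<^sup>2) - 1)"
  proof -
    have "tan \<alpha> * sqrt (1 + (tilt s)\<^sup>2) - tan \<alpha> = tan \<alpha> * (sqrt (1 + (tilt s)\<^sup>2) - 1)"
      by (simp add: algebra_simps)
    moreover have "0 \<le> tan \<alpha> * (sqrt (1 + (tilt s)\<^sup>2) - 1)" by (intro mult_nonneg_nonneg ta q)
    ultimately show ?thesis by simp
  qed
  also have "\<dots> \<le> 2 * \<alpha> * (2 * \<alpha>\<^sup>2)" using ta t2 q \<alpha> by (intro mult_mono) auto
  finally show "turn_angle s \<le> \<alpha> + 4 * \<alpha> ^ 3"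
    using \<alpha> by (simp add: arctan_tan power2_eq_square power3_eq_cube)
qed

text \<open>The vanishing of \<open>endA\<close> says that the endpoint is the south pole. Its
  imaginary and real parts read cos r V = sin r X1 and cos r Y = sin r X2; weighted with V and Y and
  added, they isolate cos r times Y^2 + V^2, which is close to 1.\<close>

lemma endA_zero_identity:
  assumes "endA s n t = 0"
  defines "S \<equiv> sin (t / 2)" and "S' \<equiv> sin (s / 2)" and "r \<equiv> n * turn_angle s" and "\<sigma> \<equiv> (t + s) / 2"
  shows "cos r * ((cos \<sigma> + 2 * (sin \<alpha>)\<^sup>2 * (S * S'))\<^sup>2 + (cos \<alpha> * sin \<sigma>)\<^sup>2)
    = sin r * (2 * tilt_sin s * ((sin \<alpha>)\<^sup>2 * (S * S')) * (cos \<alpha> * sin \<sigma>)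
        + tilt_cos s * sin \<alpha> * cos \<alpha> * (S\<^sup>2 + S'\<^sup>2 - 4 * (sin \<alpha>)\<^sup>2 * (S * S')\<^sup>2))"
proof -
  define C C' where "C = cos (t / 2)" and "C' = cos (s / 2)"
  define a c where "a = sin \<alpha>" and "c = cos \<alpha>"
  define k l where "k = tilt_cos s" and "l = tilt_sin s"
  have ac: "c\<^sup>2 = 1 - a\<^sup>2" by (simp add: a_def c_def cos_squared_eq)
  have CS: "C\<^sup>2 = 1 - S\<^sup>2" "C'\<^sup>2 = 1 - S'\<^sup>2" by (simp_all add: C_def C'_def S_def S'_def cos_squared_eq)
  have sg: "cos \<sigma> = C * C' - S * S'" "sin \<sigma> = S * C' + C * S'"
    by (simp_all add: \<sigma>_def C_def C'_def S_def S'_def add_divide_distrib cos_add sin_add)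
  let ?Y = "C * C' - c\<^sup>2 * (S * S') + a\<^sup>2 * (S * S')" and ?V = "c * (S * C' + C * S')"
  let ?X1 = "k * a * (S' * C + S * C') - l * (C * C' - c\<^sup>2 * (S * S') - a\<^sup>2 * (S * S'))"
    and ?X2 = "l * ?V - 2 * k * a * c * (S * S')"
  have "Re (endA s n t) = cos r * ?Y - sin r * ?X2" "Im (endA s n t) = - (cos r * ?V) + sin r * ?X1"
    unfolding endA_def turn_fst_def turn_snd_def
    by (simp_all add: rotA_def rotB_def r_def C_def C'_def S_def S'_def a_def c_def k_def l_def power2_eq_square algebra_simps)
  then have 1: "cos r * ?Y = sin r * ?X2" "cos r * ?V = sin r * ?X1"
    using assms(1) by simp_all
  have "cos r * (?Y\<^sup>2 + ?V\<^sup>2) = (cos r * ?Y) * ?Y + (cos r * ?V) * ?V"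
    by (simp add: power2_eq_square algebra_simps)
  also have "\<dots> = sin r * (?X2 * ?Y + ?X1 * ?V)"
    unfolding 1 by (simp add: algebra_simps)
  also have "?Y = cos \<sigma> + 2 * a\<^sup>2 * (S * S')"
    unfolding sg ac by (simp add: algebra_simps)
  also have "?V = c * sin \<sigma>" unfolding sg by simp
  also have "(l * (c * sin \<sigma>) - 2 * k * a * c * (S * S')) * (cos \<sigma> + 2 * a\<^sup>2 * (S * S')) + ?X1 * (c * sin \<sigma>)
     = 2 * l * (a\<^sup>2 * (S * S')) * (c * sin \<sigma>) + k * a * c * (S\<^sup>2 + S'\<^sup>2 - 4 * a\<^sup>2 * (S * S')\<^sup>2)"
    using ac CS unfolding sg by algebra
  finally show ?thesis by (simp add: a_def c_def k_def l_def)
qed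

lemma mirror_power_nth:
  "((mirror ^^ n) x) $ 1 = (- 1) ^ n * x $ 1" "((mirror ^^ n) x) $ 2 = (- 1) ^ n * x $ 2" "((mirror ^^ n) x) $ 3 = x $ 3"
  by (induction n) auto

lemma norm_mirror [simp]: "norm (mirror x) = norm x"
  by (simp add: norm_eq_sqrt_inner inner3)

lemma norm_mirror_power [simp]: "norm ((mirror ^^ n) x) = norm x"
  by (induction n) auto

text \<open>cos r \<ge> sin x \<ge> x (1 - x^2 / 2), and x \<le> 3 \<alpha> gives x^2 / 2 \<le> 9/2
  \<alpha>^2, rounded up to 5 \<alpha>^2.\<close>

lemma cos_ge_linear:
  assumes "0 \<le> r" "r \<le> pi / 2 - x" "0 \<le> x" "x \<le> 3 * \<alpha>"
  shows "x * (1 - 5 * \<alpha>\<^sup>2) \<le> cos r"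
proof -
  have "x\<^sup>2 \<le> (3 * \<alpha>)\<^sup>2" using assms by (intro power_mono) auto
  then have "x\<^sup>2 \<le> 9 * \<alpha>\<^sup>2" by (simp add: power_mult_distrib)
  then have "1 - 5 * \<alpha>\<^sup>2 \<le> 1 - x\<^sup>2 / 2" using zero_le_power2[of \<alpha>] by linarith
  then have "x * (1 - 5 * \<alpha>\<^sup>2) \<le> x * (1 - x\<^sup>2 / 2)" using assms by (intro mult_left_mono)
  also have "\<dots> \<le> sin x" by (rule sin_ge_cubic[OF assms(3)])
  also have "\<dots> = cos (pi / 2 - x)" by (simp add: cos_diff)
  also have "\<dots> \<le> cos r" using assms pi_gt_zero by (intro cos_monotone_0_pi_le) auto
  finally show ?thesis .
qed

(* Up to lower order the identity above reads cos r = \<alpha> (S^2 + S'^2), whereas r \<le> pi/2 - m \<alpha>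
   with m > S^2 + S'^2. *)
lemma south_pole_notin_front:
  assumes small: "\<alpha> < 1 / 100" and t: "0 \<le> t" "t \<le> real_of_int (k_M \<alpha> - 1) * pi"
  shows "- N_pole \<notin> front t"
proof
  assume "- N_pole \<in> front t"
  then show False
  proof (cases rule: front_cases[OF _ t(1), of "- N_pole", case_names a first arc])
    case (first e s)
    have "(- N_pole) $ 3 = (if e = 1 then arc 1 N_pole t else mirror (arc 1 N_pole t)) $ 3"
      using first(4) by (rule arg_cong)
    then have "arc 1 N_pole t $ 3 = - 1" by (simp split: if_splits)
    then have "(1 - (cos \<alpha>)\<^sup>2) * cos t = - 1 - (cos \<alpha>)\<^sup>2"
      unfolding arc_nth by (simp add: algebra_simps power2_eq_square)
    moreover have "(1 - (cos \<alpha>)\<^sup>2) * (- 1) \<le> (1 - (cos \<alpha>)\<^sup>2) * cos t"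
      by (intro mult_left_mono) (auto simp: sin_squared_eq[symmetric])
    ultimately have "- (1 - (cos \<alpha>)\<^sup>2) \<le> - 1 - (cos \<alpha>)\<^sup>2" by simp
    moreover have "0 < (cos \<alpha>)\<^sup>2" using cos_pos by simp
    ultimately show False by linarith
  next
    case (arc e s n)
    let ?\<tau> = "t - switch s n"
    have s: "s \<in> {0..pi}" by fact
    have \<alpha>2: "\<alpha> \<le> 1 / 2" using small by simp
    have v: "pi \<le> period s" "period s < 2 * pi" using period_ge[OF s] period_less by auto
    have \<tau>: "0 \<le> ?\<tau>" "?\<tau> \<le> period s"
      using arc(3) by (auto simp: switch_def algebra_simps)
    let ?A = "endA s n ?\<tau>" and ?B = "endB s n ?\<tau>"
    have "norm (- N_pole) = norm (hopf ?A ?B)" "(- N_pole) $ 3 = hopf ?A ?B $ 3"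
      unfolding arc(4) by (simp_all add: mirror_power_nth)
    then have "(cmod ?A)\<^sup>2 + (cmod ?B)\<^sup>2 = 1" "(cmod ?A)\<^sup>2 - (cmod ?B)\<^sup>2 = - 1"
      by (simp_all add: norm_hopf cmod_power2)
    then have "(cmod ?A)\<^sup>2 = 0" by linarith
    then have A0: "?A = 0" by simp
    define r where "r = n * turn_angle s"
    define S where "S = sin (?\<tau> / 2)"
    define S' where "S' = sin (s / 2)"
    define \<sigma> where "\<sigma> = (?\<tau> + s) / 2"
    define q where "q = S\<^sup>2 + S'\<^sup>2"
    have S: "0 \<le> S" "0 \<le> S'" "S \<le> 1" "S' \<le> 1"
      using \<tau> v s by (auto simp: S_def S'_def intro!: sin_ge_zero)
    have q: "0 \<le> S * S'" "S * S' \<le> 1" "2 * (S * S') \<le> q" "0 \<le> q" "q \<le> 2"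
      using S sum_squares_bound[of S S'] mult_mono[of S 1 S' 1] power_le_one[of S 2] power_le_one[of S' 2]
      by (auto simp: q_def)
    have a: "0 < sin \<alpha>" "sin \<alpha> \<le> \<alpha>" using sin_pos sin_x_le_x \<alpha> by auto
    have a2: "(sin \<alpha>)\<^sup>2 \<le> \<alpha>\<^sup>2" using a by (intro power_mono) auto
    have kM: "real_of_int (k_M \<alpha>) * \<alpha> \<le> pi / 2"
    proof -
      have "real_of_int (k_M \<alpha>) \<le> pi / (2 * \<alpha>)" unfolding k_M_def by (rule of_int_floor_le)
      then show ?thesis using \<alpha> by (simp add: field_simps)
    qed
    have sum: "s + ?\<tau> \<le> real_of_int (k_M \<alpha> - 1 - int n) * pi"
    proof -
      have "n * pi \<le> n * period s" using v by (intro mult_left_mono) auto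
      then show ?thesis using t(2) by (simp add: switch_def algebra_simps)
    qed
    then have "0 \<le> real_of_int (k_M \<alpha> - 1 - int n) * pi" using \<tau> s by auto
    then have "0 \<le> real_of_int (k_M \<alpha> - 1 - int n)"
      using pi_gt_zero by (simp add: zero_le_mult_iff)
    then have nk: "int n \<le> k_M \<alpha> - 1" by linarith
    \<comment> \<open>n + m arcs of angle \<alpha> cover at most pi / 2. The excess of the n actual
      angles is at most 4 n \<alpha>^3 \<le> 8 \<alpha>^2, because n \<alpha> \<le> 2.\<close>
    have rb: "r \<le> pi / 2 - (m * \<alpha> - 8 * \<alpha>\<^sup>2)" if "m \<le> k_M \<alpha> - int n" for m :: int
    proof -
      have "real_of_int (int n + m) * \<alpha> \<le> real_of_int (k_M \<alpha>) * \<alpha>"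
        using that \<alpha> by (intro mult_right_mono) auto
      then have 1: "n * \<alpha> \<le> pi / 2 - m * \<alpha>" using kM by (simp add: algebra_simps)
      have "real n * \<alpha> \<le> real_of_int (k_M \<alpha>) * \<alpha>"
        using nk \<alpha> by (intro mult_right_mono) linarith+
      then have "n * \<alpha> \<le> 2" using kM pi_less_4 by linarith
      then have "(n * \<alpha>) * (4 * \<alpha>\<^sup>2) \<le> 2 * (4 * \<alpha>\<^sup>2)" by (intro mult_right_mono) auto
      moreover have "r \<le> n * (\<alpha> + 4 * \<alpha> ^ 3)"
        unfolding r_def by (intro mult_left_mono turn_angle_bounds s \<alpha>2) auto
      ultimately show ?thesis using 1 by (simp add: algebra_simps power2_eq_square power3_eq_cube)
    qed
    have r0: "0 \<le> r" unfolding r_def by (intro mult_nonneg_nonneg turn_angle_bounds s \<alpha>2) auto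
    have "8 * \<alpha>\<^sup>2 \<le> 8 * (\<alpha> * (1 / 100))"
      using small \<alpha> unfolding power2_eq_square by (intro mult_left_mono) auto
    then have al8: "8 * \<alpha>\<^sup>2 \<le> 8 / 100 * \<alpha>" by simp
    have r1: "r \<le> pi / 2" using rb[of 1] nk al8 \<alpha> by auto
    have sr: "0 \<le> sin r" "sin r \<le> 1" using r0 r1 pi_gt_zero by (auto intro!: sin_ge_zero)
    have cr: "0 \<le> cos r" using r0 r1 by (intro cos_ge_zero) auto
    have tc: "0 \<le> tilt_cos s" "tilt_cos s \<le> 1"
    proof -
      have h: "1 \<le> sqrt (1 + (tilt s)\<^sup>2)" by (rule real_sqrt_ge_one) simp
      show "0 \<le> tilt_cos s" by (simp add: tilt_cos_def)
      show "tilt_cos s \<le> 1"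
        unfolding tilt_cos_def by (subst pos_divide_le_eq) (use h in linarith)+
    qed
    have ts: "0 \<le> tilt_sin s" "tilt_sin s \<le> 2 * \<alpha>"
    proof -
      have "tilt_sin s = tilt s * tilt_cos s" by (simp add: tilt_sin_def tilt_cos_def)
      moreover have "tilt s * tilt_cos s \<le> 2 * \<alpha> * 1"
        using tc tilt_bounds[OF s \<alpha>2] \<alpha> by (intro mult_mono) auto
      ultimately show "0 \<le> tilt_sin s" "tilt_sin s \<le> 2 * \<alpha>"
        using tc tilt_bounds[OF s \<alpha>2] by simp_all
    qed
    let ?L = "(cos \<sigma> + 2 * (sin \<alpha>)\<^sup>2 * (S * S'))\<^sup>2 + (cos \<alpha> * sin \<sigma>)\<^sup>2"
    let ?R = "2 * tilt_sin s * ((sin \<alpha>)\<^sup>2 * (S * S')) * (cos \<alpha> * sin \<sigma>)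
        + tilt_cos s * sin \<alpha> * cos \<alpha> * (S\<^sup>2 + S'\<^sup>2 - 4 * (sin \<alpha>)\<^sup>2 * (S * S')\<^sup>2)"
    have id: "cos r * ?L = sin r * ?R"
      using endA_zero_identity[OF A0] unfolding r_def S_def S'_def \<sigma>_def .
    \<comment> \<open>4 \<alpha>^2 is lost in the mixed term of the first square, and \<alpha>^2 in
      replacing cos \<alpha> by 1.\<close>
    have L: "1 - 5 * \<alpha>\<^sup>2 \<le> ?L"
    proof -
      have "?L = (cos \<sigma>)\<^sup>2 + (sin \<sigma>)\<^sup>2 + (4 * (sin \<alpha>)\<^sup>2 * (S * S') * cos \<sigma> + (2 * (sin \<alpha>)\<^sup>2 * (S * S'))\<^sup>2 - (sin \<alpha>)\<^sup>2 * (sin \<sigma>)\<^sup>2)"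
        unfolding power_mult_distrib[of "cos \<alpha>"] cos_squared_eq[of \<alpha>] by (simp add: power2_eq_square algebra_simps)
      moreover have "4 * (sin \<alpha>)\<^sup>2 * (S * S') * (- 1) \<le> 4 * (sin \<alpha>)\<^sup>2 * (S * S') * cos \<sigma>"
        using q by (intro mult_left_mono) auto
      moreover have "4 * (sin \<alpha>)\<^sup>2 * (S * S') \<le> 4 * \<alpha>\<^sup>2 * 1"
        using q a2 by (intro mult_mono) auto
      moreover have "(sin \<alpha>)\<^sup>2 * (sin \<sigma>)\<^sup>2 \<le> \<alpha>\<^sup>2 * 1"
        using a2 by (intro mult_mono) (auto simp: abs_square_le_1)
      moreover have "0 \<le> (2 * (sin \<alpha>)\<^sup>2 * (S * S'))\<^sup>2" by simp
      moreover have "(cos \<sigma>)\<^sup>2 + (sin \<sigma>)\<^sup>2 = 1" by simp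
      ultimately show ?thesis by linarith
    qed
    have R: "?R \<le> (\<alpha> + 2 * \<alpha> ^ 3) * q"
    proof -
      have "tilt_sin s * ((sin \<alpha>)\<^sup>2 * (S * S')) \<le> 2 * \<alpha> * (\<alpha>\<^sup>2 * (q / 2))"
        using ts a2 q \<alpha> by (intro mult_mono) auto
      moreover have "cos \<alpha> * sin \<sigma> \<le> 1 * 1"
        using cos_pos mult_mono[of "cos \<alpha>" 1 "\<bar>sin \<sigma>\<bar>" 1] abs_ge_self[of "sin \<sigma>"]
        by (smt (verit) abs_sin_le_one cos_le_one mult_left_mono)
      then have "2 * tilt_sin s * ((sin \<alpha>)\<^sup>2 * (S * S')) * (cos \<alpha> * sin \<sigma>) \<le> 2 * tilt_sin s * ((sin \<alpha>)\<^sup>2 * (S * S')) * 1"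
        using ts q S by (intro mult_left_mono mult_nonneg_nonneg) auto
      moreover have "tilt_cos s * sin \<alpha> * cos \<alpha> * (S\<^sup>2 + S'\<^sup>2 - 4 * (sin \<alpha>)\<^sup>2 * (S * S')\<^sup>2) \<le> tilt_cos s * sin \<alpha> * cos \<alpha> * q"
        unfolding q_def using tc a cos_pos by (intro mult_left_mono mult_nonneg_nonneg) auto
      moreover have "tilt_cos s * sin \<alpha> * cos \<alpha> * q \<le> 1 * \<alpha> * 1 * q"
        using tc a cos_pos q \<alpha> by (intro mult_mono mult_nonneg_nonneg) auto
      ultimately show ?thesis by (simp add: algebra_simps power2_eq_square power3_eq_cube)
    qed
    have main: "cos r * (1 - 5 * \<alpha>\<^sup>2) \<le> (\<alpha> + 2 * \<alpha> ^ 3) * q"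
    proof -
      have "cos r * (1 - 5 * \<alpha>\<^sup>2) \<le> cos r * ?L" using L cr by (rule mult_left_mono)
      also have "\<dots> \<le> sin r * ((\<alpha> + 2 * \<alpha> ^ 3) * q)" unfolding id using R sr(1) by (rule mult_left_mono)
      also have "\<dots> \<le> 1 * ((\<alpha> + 2 * \<alpha> ^ 3) * q)" using sr \<alpha> q by (intro mult_right_mono) auto
      finally show ?thesis by simp
    qed
    \<comment> \<open>First and last arc together last at most (k_M - 1 - n) pi. If this is 0 then q
      = 0; if it is pi then S \<le> cos (s / 2), hence q \<le> 1; in general q \<le> 2. So q \<le> m
      - 1 with m the number of missing arcs, capped at 3.\<close>
    obtain m :: int where m: "1 \<le> m" "m \<le> 3" "m \<le> k_M \<alpha> - int n" "q \<le> m - 1"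
    proof -
      consider "int n = k_M \<alpha> - 1" | "int n = k_M \<alpha> - 2" | "int n \<le> k_M \<alpha> - 3" using nk by linarith
      then show thesis
      proof cases
        case 1
        then have "s = 0" "?\<tau> = 0" using sum \<tau> s by auto
        then have "q = 0" by (simp add: q_def S_def S'_def)
        then show thesis using 1 by (intro that[of 1]) auto
      next
        case 2
        then have "s + ?\<tau> \<le> pi" using sum by simp
        then have "S \<le> sin (pi / 2 - s / 2)"
          unfolding S_def using \<tau> s by (intro sin_monotone_2pi_le) auto
        then have "S \<le> cos (s / 2)" by (simp add: sin_diff)
        then have "S\<^sup>2 \<le> (cos (s / 2))\<^sup>2" using S by (intro power_mono) auto
        then have "q \<le> 1" by (simp add: q_def S'_def cos_squared_eq)
        then show thesis using 2 by (intro that[of 2]) auto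
      next
        case 3
        then show thesis using q by (intro that[of 3]) auto
      qed
    qed
    define x where "x = m * \<alpha> - 8 * \<alpha>\<^sup>2"
    have ma: "1 * \<alpha> \<le> m * \<alpha>" "m * \<alpha> \<le> 3 * \<alpha>" using m \<alpha> by (intro mult_right_mono; simp)+
    have x: "(m - 8 / 100) * \<alpha> \<le> x" "x \<le> 3 * \<alpha>" using al8 ma(2) zero_le_power2[of \<alpha>] unfolding x_def Rings.left_diff_distrib by linarith+
    have x0: "0 \<le> x" using ma(1) al8 \<alpha> unfolding x_def by linarith
    have b: "999 / 1000 \<le> 1 - 5 * \<alpha>\<^sup>2"
      using mult_mono[of \<alpha> "1/100" \<alpha> "1/100"] small \<alpha> by (simp add: power2_eq_square)
    have "x * (1 - 5 * \<alpha>\<^sup>2) \<le> cos r"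
      using rb[OF m(3)] r0 x x0 by (intro cos_ge_linear) (auto simp: x_def)
    then have "x * (1 - 5 * \<alpha>\<^sup>2) * (1 - 5 * \<alpha>\<^sup>2) \<le> cos r * (1 - 5 * \<alpha>\<^sup>2)"
      using b by (intro mult_right_mono) auto
    moreover have "x * (999 / 1000) * (999 / 1000) \<le> x * (1 - 5 * \<alpha>\<^sup>2) * (1 - 5 * \<alpha>\<^sup>2)"
      using b x0 by (intro mult_mono) auto
    moreover have "(\<alpha> + 2 * \<alpha> ^ 3) * q \<le> (1001 / 1000 * \<alpha>) * (m - 1)"
    proof (intro mult_mono)
      have "\<alpha> * \<alpha>\<^sup>2 \<le> \<alpha> * (1 / 5000)"
        using b \<alpha> by (intro mult_left_mono) auto
      then show "\<alpha> + 2 * \<alpha> ^ 3 \<le> 1001 / 1000 * \<alpha>" using \<alpha> by (simp add: power3_eq_cube power2_eq_square)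
    qed (use m q \<alpha> in auto)
    ultimately have "(m - 8 / 100) * \<alpha> * (999 / 1000) * (999 / 1000) \<le> (1001 / 1000 * \<alpha>) * (m - 1)"
      using main x(1) by linarith
    then have "\<alpha> * ((m - 8 / 100) * (999 / 1000) * (999 / 1000)) \<le> \<alpha> * (1001 / 1000 * (m - 1))"
      by (simp add: mult_ac)
    \<comment> \<open>Impossible for m \<le> 3: the left side exceeds the right one by about
      0.9.\<close>
    then have "(m - 8 / 100) * (999 / 1000) * (999 / 1000) \<le> 1001 / 1000 * (real_of_int m - 1)"
      using \<alpha> by (simp only: mult_le_cancel_left_pos of_int_diff of_int_1)
    moreover have "real_of_int m \<le> 3" using m(2) by simp
    ultimately show False by (simp add: field_simps)
  qed simp
qed

end

section \<open>Asymptotics in the small parameter\<close>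

(* The Lipschitz constant is needed as well, in order to compare the directions of nearby points. *)
definition LO :: "nat \<Rightarrow> (real \<Rightarrow> real \<Rightarrow> 'a::real_normed_vector) \<Rightarrow> bool" where
  "LO k f \<longleftrightarrow> (\<exists>C. \<forall>\<^sub>F \<alpha> in at_right 0. \<forall>s\<in>{0..pi}. norm (f \<alpha> s) \<le> C * \<alpha> ^ k \<and>
     (\<forall>s'\<in>{0..pi}. norm (f \<alpha> s - f \<alpha> s') \<le> C * \<alpha> ^ k * \<bar>s - s'\<bar>))"

lemma eventually_at_right_0_less: "0 < a \<Longrightarrow> \<forall>\<^sub>F \<alpha>::real in at_right 0. 0 < \<alpha> \<and> \<alpha> < a"
  by (auto simp: eventually_at_right_field)

lemma LO_I:
  assumes "\<forall>\<^sub>F \<alpha> in at_right 0. \<forall>s\<in>{0..pi}. norm (f \<alpha> s) \<le> C * \<alpha> ^ k"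
    "\<forall>\<^sub>F \<alpha> in at_right 0. \<forall>s\<in>{0..pi}. \<forall>s'\<in>{0..pi}. norm (f \<alpha> s - f \<alpha> s') \<le> C * \<alpha> ^ k * \<bar>s - s'\<bar>"
  shows "LO k f"
  unfolding LO_def by (rule exI[of _ C]) (use assms in eventually_elim, blast)

lemma LO_E:
  assumes "LO k f"
  obtains C where "0 \<le> C" "\<forall>\<^sub>F \<alpha> in at_right 0. 0 < \<alpha> \<and> \<alpha> < 1 \<and> (\<forall>s\<in>{0..pi}. norm (f \<alpha> s) \<le> C * \<alpha> ^ k \<and>
     (\<forall>s'\<in>{0..pi}. norm (f \<alpha> s - f \<alpha> s') \<le> C * \<alpha> ^ k * \<bar>s - s'\<bar>))"
proof -
  obtain C where C: "\<forall>\<^sub>F \<alpha> in at_right 0. \<forall>s\<in>{0..pi}. norm (f \<alpha> s) \<le> C * \<alpha> ^ k \<and>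
     (\<forall>s'\<in>{0..pi}. norm (f \<alpha> s - f \<alpha> s') \<le> C * \<alpha> ^ k * \<bar>s - s'\<bar>)"
    using assms unfolding LO_def by blast
  have "\<forall>\<^sub>F \<alpha> in at_right 0. 0 < \<alpha> \<and> \<alpha> < 1 \<and> (\<forall>s\<in>{0..pi}. norm (f \<alpha> s) \<le> \<bar>C\<bar> * \<alpha> ^ k \<and>
     (\<forall>s'\<in>{0..pi}. norm (f \<alpha> s - f \<alpha> s') \<le> \<bar>C\<bar> * \<alpha> ^ k * \<bar>s - s'\<bar>))"
    using C eventually_at_right_0_less[of 1, simplified]
  proof eventually_elim
    case (elim \<alpha>)
    then have "C * \<alpha> ^ k \<le> \<bar>C\<bar> * \<alpha> ^ k" by (intro mult_right_mono) auto
    then have "C * \<alpha> ^ k \<le> \<bar>C\<bar> * \<alpha> ^ k" "C * \<alpha> ^ k * \<bar>s - s'\<bar> \<le> \<bar>C\<bar> * \<alpha> ^ k * \<bar>s - s'\<bar>" for s s' :: real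
      by (auto intro!: mult_right_mono)
    with elim show ?case by (meson order_trans)
  qed
  then show thesis by (intro that[of "\<bar>C\<bar>"]) auto
qed

lemma LO_cong:
  assumes "LO k f" "\<forall>\<^sub>F \<alpha> in at_right 0. \<forall>s\<in>{0..pi}. f \<alpha> s = g \<alpha> s"
  shows "LO k g"
proof -
  obtain C where C: "\<forall>\<^sub>F \<alpha> in at_right 0. \<forall>s\<in>{0..pi}. norm (f \<alpha> s) \<le> C * \<alpha> ^ k \<and>
     (\<forall>s'\<in>{0..pi}. norm (f \<alpha> s - f \<alpha> s') \<le> C * \<alpha> ^ k * \<bar>s - s'\<bar>)"
    using assms unfolding LO_def by blast
  show ?thesis unfolding LO_def
    by (rule exI[of _ C]) (use C assms(2) in eventually_elim, simp)
qed

lemma LO_mono: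
  assumes "LO k f" "j \<le> k"
  shows "LO j f"
proof -
  obtain C where C: "0 \<le> C" "\<forall>\<^sub>F \<alpha> in at_right 0. 0 < \<alpha> \<and> \<alpha> < 1 \<and> (\<forall>s\<in>{0..pi}. norm (f \<alpha> s) \<le> C * \<alpha> ^ k \<and>
     (\<forall>s'\<in>{0..pi}. norm (f \<alpha> s - f \<alpha> s') \<le> C * \<alpha> ^ k * \<bar>s - s'\<bar>))"
    using assms(1) by (rule LO_E)
  show ?thesis unfolding LO_def
  proof (rule exI[of _ C], use C(2) in eventually_elim)
    case (elim \<alpha>)
    then have "C * \<alpha> ^ k \<le> C * \<alpha> ^ j"
      using C(1) assms(2) by (intro mult_left_mono power_decreasing) auto
    then have "C * \<alpha> ^ k \<le> C * \<alpha> ^ j" "C * \<alpha> ^ k * \<bar>s - s'\<bar> \<le> C * \<alpha> ^ j * \<bar>s - s'\<bar>" for s s' :: real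
      by (auto intro!: mult_right_mono)
    with elim show ?case by (meson order_trans)
  qed
qed

lemma LO_add:
  assumes "LO k f" "LO k g"
  shows "LO k (\<lambda>\<alpha> s. f \<alpha> s + g \<alpha> s)"
proof -
  obtain C where C: "\<forall>\<^sub>F \<alpha> in at_right 0. \<forall>s\<in>{0..pi}. norm (f \<alpha> s) \<le> C * \<alpha> ^ k \<and>
     (\<forall>s'\<in>{0..pi}. norm (f \<alpha> s - f \<alpha> s') \<le> C * \<alpha> ^ k * \<bar>s - s'\<bar>)"
    using assms(1) unfolding LO_def by blast
  obtain D where D: "\<forall>\<^sub>F \<alpha> in at_right 0. \<forall>s\<in>{0..pi}. norm (g \<alpha> s) \<le> D * \<alpha> ^ k \<and>
     (\<forall>s'\<in>{0..pi}. norm (g \<alpha> s - g \<alpha> s') \<le> D * \<alpha> ^ k * \<bar>s - s'\<bar>)"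
    using assms(2) unfolding LO_def by blast
  show ?thesis unfolding LO_def
  proof (rule exI[of _ "C + D"], use C D in eventually_elim)
    case (elim \<alpha>)
    show ?case
    proof (intro ballI conjI)
      fix s s' :: real assume s: "s \<in> {0..pi}"
      have "norm (f \<alpha> s + g \<alpha> s) \<le> C * \<alpha> ^ k + D * \<alpha> ^ k"
        using elim s by (intro norm_triangle_le add_mono) auto
      then show "norm (f \<alpha> s + g \<alpha> s) \<le> (C + D) * \<alpha> ^ k"
        by (simp add: distrib_right)
      assume s': "s' \<in> {0..pi}"
      have "f \<alpha> s + g \<alpha> s - (f \<alpha> s' + g \<alpha> s') = (f \<alpha> s - f \<alpha> s') + (g \<alpha> s - g \<alpha> s')" by simp
      also have "norm \<dots> \<le> C * \<alpha> ^ k * \<bar>s - s'\<bar> + D * \<alpha> ^ k * \<bar>s - s'\<bar>"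
        using elim s s' by (intro norm_triangle_le add_mono) auto
      finally show "norm (f \<alpha> s + g \<alpha> s - (f \<alpha> s' + g \<alpha> s')) \<le> (C + D) * \<alpha> ^ k * \<bar>s - s'\<bar>"
        by (simp add: distrib_right)
    qed
  qed
qed

lemma LO_mult:
  fixes f g :: "real \<Rightarrow> real \<Rightarrow> 'a::real_normed_algebra"
  assumes "LO i f" "LO j g"
  shows "LO (i + j) (\<lambda>\<alpha> s. f \<alpha> s * g \<alpha> s)"
proof -
  obtain C where C: "0 \<le> C" "\<forall>\<^sub>F \<alpha> in at_right 0. 0 < \<alpha> \<and> \<alpha> < 1 \<and> (\<forall>s\<in>{0..pi}. norm (f \<alpha> s) \<le> C * \<alpha> ^ i \<and>
     (\<forall>s'\<in>{0..pi}. norm (f \<alpha> s - f \<alpha> s') \<le> C * \<alpha> ^ i * \<bar>s - s'\<bar>))"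
    using assms(1) by (rule LO_E)
  obtain D where D: "0 \<le> D" "\<forall>\<^sub>F \<alpha> in at_right 0. 0 < \<alpha> \<and> \<alpha> < 1 \<and> (\<forall>s\<in>{0..pi}. norm (g \<alpha> s) \<le> D * \<alpha> ^ j \<and>
     (\<forall>s'\<in>{0..pi}. norm (g \<alpha> s - g \<alpha> s') \<le> D * \<alpha> ^ j * \<bar>s - s'\<bar>))"
    using assms(2) by (rule LO_E)
  show ?thesis unfolding LO_def
  proof (rule exI[of _ "2 * C * D"], use C(2) D(2) in eventually_elim)
    case (elim \<alpha>)
    then have a: "0 < \<alpha>" by blast
    show ?case
    proof (intro ballI conjI)
      fix s s' :: real assume s: "s \<in> {0..pi}"
      have "norm (f \<alpha> s * g \<alpha> s) \<le> (C * \<alpha> ^ i) * (D * \<alpha> ^ j)"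
        by (rule order_trans[OF norm_mult_ineq mult_mono]) (use elim s C D a in auto)
      also have "\<dots> = C * D * \<alpha> ^ (i + j)" by (simp add: power_add mult_ac)
      also have "\<dots> \<le> 2 * C * D * \<alpha> ^ (i + j)" using C D a by (intro mult_right_mono) auto
      finally show "norm (f \<alpha> s * g \<alpha> s) \<le> 2 * C * D * \<alpha> ^ (i + j)" .
      assume s': "s' \<in> {0..pi}"
      have "f \<alpha> s * g \<alpha> s - f \<alpha> s' * g \<alpha> s' = f \<alpha> s * (g \<alpha> s - g \<alpha> s') + (f \<alpha> s - f \<alpha> s') * g \<alpha> s'"
        by (simp add: algebra_simps)
      also have "norm \<dots> \<le> (C * \<alpha> ^ i) * (D * \<alpha> ^ j * \<bar>s - s'\<bar>) + (C * \<alpha> ^ i * \<bar>s - s'\<bar>) * (D * \<alpha> ^ j)"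
      proof (intro norm_triangle_le add_mono)
        show "norm (f \<alpha> s * (g \<alpha> s - g \<alpha> s')) \<le> (C * \<alpha> ^ i) * (D * \<alpha> ^ j * \<bar>s - s'\<bar>)"
          by (rule order_trans[OF norm_mult_ineq mult_mono]) (use elim s s' C D a in auto)
        show "norm ((f \<alpha> s - f \<alpha> s') * g \<alpha> s') \<le> (C * \<alpha> ^ i * \<bar>s - s'\<bar>) * (D * \<alpha> ^ j)"
          by (rule order_trans[OF norm_mult_ineq mult_mono]) (use elim s s' C D a in auto)
      qed
      also have "\<dots> = 2 * C * D * \<alpha> ^ (i + j) * \<bar>s - s'\<bar>" by (simp add: power_add mult_ac)
      finally show "norm (f \<alpha> s * g \<alpha> s - f \<alpha> s' * g \<alpha> s') \<le> 2 * C * D * \<alpha> ^ (i + j) * \<bar>s - s'\<bar>" .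
    qed
  qed
qed

lemma LO_norm_le:
  assumes "LO k f" "\<forall>\<^sub>F \<alpha> in at_right 0. \<forall>s\<in>{0..pi}. \<forall>s'\<in>{0..pi}.
    norm (g \<alpha> s) \<le> B * norm (f \<alpha> s) \<and> norm (g \<alpha> s - g \<alpha> s') \<le> B * norm (f \<alpha> s - f \<alpha> s')"
  shows "LO k g"
proof -
  obtain C where C: "0 \<le> C" "\<forall>\<^sub>F \<alpha> in at_right 0. 0 < \<alpha> \<and> \<alpha> < 1 \<and> (\<forall>s\<in>{0..pi}. norm (f \<alpha> s) \<le> C * \<alpha> ^ k \<and>
     (\<forall>s'\<in>{0..pi}. norm (f \<alpha> s - f \<alpha> s') \<le> C * \<alpha> ^ k * \<bar>s - s'\<bar>))"
    using assms(1) by (rule LO_E)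
  show ?thesis unfolding LO_def
  proof (rule exI[of _ "\<bar>B\<bar> * C"], use C(2) assms(2) in eventually_elim)
    case (elim \<alpha>)
    have B: "B * x \<le> \<bar>B\<bar> * y" if "x \<le> y" "0 \<le> x" for x y :: real
      using that by (intro mult_mono) auto
    show ?case
    proof (intro ballI conjI)
      fix s s' :: real assume s: "s \<in> {0..pi}"
      then have "norm (g \<alpha> s) \<le> B * norm (f \<alpha> s)" using elim by blast
      also have "\<dots> \<le> \<bar>B\<bar> * (C * \<alpha> ^ k)" using elim s by (intro B) auto
      finally show "norm (g \<alpha> s) \<le> \<bar>B\<bar> * C * \<alpha> ^ k" by simp
      assume s': "s' \<in> {0..pi}"
      have "norm (g \<alpha> s - g \<alpha> s') \<le> B * norm (f \<alpha> s - f \<alpha> s')" using elim s s' by blast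
      also have "\<dots> \<le> \<bar>B\<bar> * (C * \<alpha> ^ k * \<bar>s - s'\<bar>)" using elim s s' by (intro B) auto
      finally show "norm (g \<alpha> s - g \<alpha> s') \<le> \<bar>B\<bar> * C * \<alpha> ^ k * \<bar>s - s'\<bar>" by simp
    qed
  qed
qed

lemma LO_minus: "LO k f \<Longrightarrow> LO k (\<lambda>\<alpha> s. - f \<alpha> s)"
  by (erule LO_norm_le[where B = 1]) (auto simp: norm_minus_commute intro!: always_eventually)

lemma LO_diff: "LO k f \<Longrightarrow> LO k g \<Longrightarrow> LO k (\<lambda>\<alpha> s. f \<alpha> s - g \<alpha> s)"
  using LO_add[OF _ LO_minus, of k f g] by simp

lemma LO_of_real: "LO k f \<Longrightarrow> LO k (\<lambda>\<alpha> s. of_real (f \<alpha> s) :: 'a::real_normed_algebra_1)"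
  by (erule LO_norm_le[where B = 1]) (auto simp flip: of_real_diff intro!: always_eventually)

lemma LO_cnj: "LO k f \<Longrightarrow> LO k (\<lambda>\<alpha> s. cnj (f \<alpha> s))"
  by (erule LO_norm_le[where B = 1]) (auto simp flip: complex_cnj_diff intro!: always_eventually)

text \<open>F may depend on \<alpha>, so that the cosine of n \<alpha> + x, with n growing like
  1/\<alpha>, is covered as a function of x.\<close>

lemma LO_lipschitz:
  fixes F :: "real \<Rightarrow> real \<Rightarrow> real"
  assumes "LO k f" "\<And>\<alpha> x y. \<bar>F \<alpha> x - F \<alpha> y\<bar> \<le> \<bar>x - y\<bar>"
  shows "LO k (\<lambda>\<alpha> s. F \<alpha> (f \<alpha> s) - F \<alpha> 0)"
  by (rule LO_norm_le[OF assms(1), where B = 1]) (use assms(2)[of _ _ 0] assms(2) in \<open>auto intro!: always_eventually\<close>)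

lemma LO_const:
  assumes "\<forall>\<^sub>F \<alpha> in at_right 0. norm (c \<alpha>) \<le> C * \<alpha> ^ k"
  shows "LO k (\<lambda>\<alpha> s. c \<alpha>)"
proof (rule LO_I[where C = "\<bar>C\<bar>"])
  show "\<forall>\<^sub>F \<alpha> in at_right 0. \<forall>s\<in>{0..pi}. norm (c \<alpha>) \<le> \<bar>C\<bar> * \<alpha> ^ k"
    using assms eventually_at_right_0_less[of 1, simplified]
  proof eventually_elim
    case (elim \<alpha>)
    then have "C * \<alpha> ^ k \<le> \<bar>C\<bar> * \<alpha> ^ k" by (intro mult_right_mono) auto
    with order_trans[OF elim(1) this] show ?case by blast
  qed
qed (use eventually_at_right_0_less[of 1, simplified] in \<open>auto elim!: eventually_mono\<close>)

lemma LO_fixed: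
  assumes "\<And>s. norm (\<phi> s) \<le> C" "\<And>s s'. norm (\<phi> s - \<phi> s') \<le> C * \<bar>s - s'\<bar>"
  shows "LO 0 (\<lambda>\<alpha> s. \<phi> s)"
  by (rule LO_I[where C = C]) (use assms in auto)

text \<open>The error is (f - f0) g0 + f0 (g - g0) + (f - f0) (g - g0); m is bounded by the orders
  of the three terms.\<close>

lemma LO_mult_approx:
  fixes f g :: "real \<Rightarrow> real \<Rightarrow> 'a::real_normed_algebra"
  assumes "LO k (\<lambda>\<alpha> s. f \<alpha> s - f0 \<alpha> s)" "LO l (\<lambda>\<alpha> s. g \<alpha> s - g0 \<alpha> s)" "LO i f0" "LO j g0"
    "m \<le> k + j" "m \<le> i + l" "m \<le> k + l"
  shows "LO m (\<lambda>\<alpha> s. f \<alpha> s * g \<alpha> s - f0 \<alpha> s * g0 \<alpha> s)"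
proof -
  have "LO m (\<lambda>\<alpha> s. ((f \<alpha> s - f0 \<alpha> s) * g0 \<alpha> s + f0 \<alpha> s * (g \<alpha> s - g0 \<alpha> s)) + (f \<alpha> s - f0 \<alpha> s) * (g \<alpha> s - g0 \<alpha> s))"
    by (intro LO_add) (rule LO_mono[OF LO_mult]; fact)+
  then show ?thesis by (rule LO_cong) (simp add: algebra_simps)
qed

lemma LO_self: "LO k (\<lambda>\<alpha> s. f \<alpha> s - f \<alpha> s)"
  by (rule LO_I[where C = 0]) auto

lemma LO_from_approx: "LO k (\<lambda>\<alpha> s. f \<alpha> s - g \<alpha> s) \<Longrightarrow> LO j g \<Longrightarrow> j \<le> k \<Longrightarrow> LO j f"
  using LO_add[OF LO_mono] by fastforce

text \<open>For small \<alpha> the values satisfy |f| \<ge> 1/2, where inversion has Lipschitz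
  constant 4.\<close>

lemma LO_inverse:
  fixes f :: "real \<Rightarrow> real \<Rightarrow> 'a::real_normed_field"
  assumes "LO k (\<lambda>\<alpha> s. f \<alpha> s - 1)" "0 < k"
  shows "LO k (\<lambda>\<alpha> s. 1 / f \<alpha> s - 1)"
proof (rule LO_norm_le[OF assms(1), where B = 4])
  obtain C where C: "0 \<le> C" "\<forall>\<^sub>F \<alpha> in at_right 0. 0 < \<alpha> \<and> \<alpha> < 1 \<and> (\<forall>s\<in>{0..pi}. norm (f \<alpha> s - 1) \<le> C * \<alpha> ^ k \<and>
     (\<forall>s'\<in>{0..pi}. norm (f \<alpha> s - 1 - (f \<alpha> s' - 1)) \<le> C * \<alpha> ^ k * \<bar>s - s'\<bar>))"
    using assms(1) by (rule LO_E)
  have "0 < 1 / (2 * (C + 1))" using C by simp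
  from eventually_at_right_0_less[OF this] C(2)
  show "\<forall>\<^sub>F \<alpha> in at_right 0. \<forall>s\<in>{0..pi}. \<forall>s'\<in>{0..pi}. norm (1 / f \<alpha> s - 1) \<le> 4 * norm (f \<alpha> s - 1) \<and>
     norm (1 / f \<alpha> s - 1 - (1 / f \<alpha> s' - 1)) \<le> 4 * norm (f \<alpha> s - 1 - (f \<alpha> s' - 1))"
  proof eventually_elim
    case (elim \<alpha>)
    then have a: "0 < \<alpha>" "\<alpha> < 1" "\<alpha> < 1 / (2 * (C + 1))" by auto
    have "\<alpha> ^ k \<le> \<alpha> ^ 1" using assms(2) a by (intro power_decreasing) auto
    then have "C * \<alpha> ^ k \<le> C * \<alpha>" using C by (intro mult_left_mono) auto
    also have "\<dots> \<le> 1 / 2" using a C by (simp add: field_simps)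
    finally have small: "C * \<alpha> ^ k \<le> 1 / 2" .
    have ge: "1 / 2 \<le> norm (f \<alpha> s)" if "s \<in> {0..pi}" for s
    proof -
      have "norm (f \<alpha> s - 1) \<le> 1 / 2" using elim that small by fastforce
      then show ?thesis using norm_triangle_ineq2[of 1 "f \<alpha> s"] by (simp add: norm_minus_commute)
    qed
    show ?case
    proof (intro ballI conjI)
      fix s s' assume s: "s \<in> {0..pi}" "s' \<in> {0..pi}"
      have nz: "f \<alpha> s \<noteq> 0" "f \<alpha> s' \<noteq> 0" using ge[OF s(1)] ge[OF s(2)] by auto
      have "norm (1 / f \<alpha> s - 1) = norm (f \<alpha> s - 1) / norm (f \<alpha> s)"
        using nz by (simp add: diff_divide_eq_iff norm_divide norm_minus_commute)
      also have "\<dots> \<le> norm (f \<alpha> s - 1) / (1 / 2)" using ge[OF s(1)] by (intro divide_left_mono) auto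
      also have "\<dots> \<le> 4 * norm (f \<alpha> s - 1)" by simp
      finally show "norm (1 / f \<alpha> s - 1) \<le> 4 * norm (f \<alpha> s - 1)" .
      have "1 / f \<alpha> s - 1 - (1 / f \<alpha> s' - 1) = (f \<alpha> s' - f \<alpha> s) / (f \<alpha> s * f \<alpha> s')"
        using nz by (simp add: field_simps)
      then have "norm (1 / f \<alpha> s - 1 - (1 / f \<alpha> s' - 1)) = norm (f \<alpha> s - f \<alpha> s') / (norm (f \<alpha> s) * norm (f \<alpha> s'))"
        by (simp add: norm_divide norm_mult norm_minus_commute)
      also have "\<dots> \<le> norm (f \<alpha> s - f \<alpha> s') / (1 / 2 * (1 / 2))"
        using ge[OF s(1)] ge[OF s(2)] by (intro divide_left_mono mult_mono) (auto intro!: mult_pos_pos)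
      finally show "norm (1 / f \<alpha> s - 1 - (1 / f \<alpha> s' - 1)) \<le> 4 * norm (f \<alpha> s - 1 - (f \<alpha> s' - 1))" by simp
    qed
  qed
qed

text \<open>A factor of size 1/\<alpha> costs one order. Such factors are the number of arcs and the
  reciprocal of \<beta> - \<alpha>.\<close>

lemma LO_scale:
  assumes "LO (Suc k) f" "\<forall>\<^sub>F \<alpha> in at_right 0. \<bar>c \<alpha>\<bar> * \<alpha> \<le> B"
  shows "LO k (\<lambda>\<alpha> s. c \<alpha> *\<^sub>R f \<alpha> s)"
proof -
  obtain C where C: "0 \<le> C" "\<forall>\<^sub>F \<alpha> in at_right 0. 0 < \<alpha> \<and> \<alpha> < 1 \<and> (\<forall>s\<in>{0..pi}. norm (f \<alpha> s) \<le> C * \<alpha> ^ Suc k \<and>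
     (\<forall>s'\<in>{0..pi}. norm (f \<alpha> s - f \<alpha> s') \<le> C * \<alpha> ^ Suc k * \<bar>s - s'\<bar>))"
    using assms(1) by (rule LO_E)
  show ?thesis unfolding LO_def
  proof (rule exI[of _ "B * C"], use C(2) assms(2) in eventually_elim)
    case (elim \<alpha>)
    have le: "\<bar>c \<alpha>\<bar> * (C * \<alpha> ^ Suc k * z) \<le> B * C * \<alpha> ^ k * z" if "0 \<le> z" for z
    proof -
      have "\<bar>c \<alpha>\<bar> * (C * \<alpha> ^ Suc k * z) = (\<bar>c \<alpha>\<bar> * \<alpha>) * (C * \<alpha> ^ k * z)" by (simp add: mult_ac)
      also have "\<dots> \<le> B * (C * \<alpha> ^ k * z)" using elim C that by (intro mult_right_mono) auto
      finally show ?thesis by (simp add: mult_ac)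
    qed
    show ?case
      unfolding norm_scaleR scaleR_diff_right[symmetric]
    proof (intro ballI conjI)
      fix s s' :: real assume s: "s \<in> {0..pi}"
      have "\<bar>c \<alpha>\<bar> * norm (f \<alpha> s) \<le> \<bar>c \<alpha>\<bar> * (C * \<alpha> ^ Suc k * 1)"
        using elim s by (intro mult_left_mono) auto
      with le[of 1] show "\<bar>c \<alpha>\<bar> * norm (f \<alpha> s) \<le> B * C * \<alpha> ^ k" by simp
      assume s': "s' \<in> {0..pi}"
      have "\<bar>c \<alpha>\<bar> * norm (f \<alpha> s - f \<alpha> s') \<le> \<bar>c \<alpha>\<bar> * (C * \<alpha> ^ Suc k * \<bar>s - s'\<bar>)"
        using elim s s' by (intro mult_left_mono) auto
      also have "\<dots> \<le> B * C * \<alpha> ^ k * \<bar>s - s'\<bar>" by (rule le) simp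
      finally show "\<bar>c \<alpha>\<bar> * norm (f \<alpha> s - f \<alpha> s') \<le> B * C * \<alpha> ^ k * \<bar>s - s'\<bar>" .
    qed
  qed
qed

text \<open>The number of complete interior arcs at time (k_M - 1) pi, as the first and the last arc
  together take about pi. The truncation by \<open>nat\<close> is harmless, since k_M \<ge> 2 for
  the small \<alpha> of \<open>turns_bounds\<close>.\<close>

definition turns :: "real \<Rightarrow> nat" where
  "turns \<alpha> = nat (k_M \<alpha> - 2)"

text \<open>By the definition of the integer part, k_M \<alpha> lies between pi/2 - \<alpha> and
  pi/2.\<close>

lemma turns_bounds:
  fixes \<alpha> :: real
  assumes "0 < \<alpha>" "\<alpha> < 1 / 10"
  shows "real_of_int (k_M \<alpha> - 1) = real (turns \<alpha>) + 1"
    and "real (turns \<alpha>) * \<alpha> \<le> pi / 2 - 2 * \<alpha>" "pi / 2 - 3 * \<alpha> \<le> real (turns \<alpha>) * \<alpha>" "\<bar>real (turns \<alpha>)\<bar> * \<alpha> \<le> 2"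
proof -
  have lo: "real_of_int (k_M \<alpha>) \<le> pi / (2 * \<alpha>)" and hi: "pi / (2 * \<alpha>) < real_of_int (k_M \<alpha>) + 1"
    unfolding k_M_def by (auto simp: floor_correct)
  have "10 \<le> pi / (2 * \<alpha>)" using assms pi_gt3 by (simp add: field_simps)
  then have "2 \<le> k_M \<alpha>" using hi by linarith
  then have t: "real (turns \<alpha>) = real_of_int (k_M \<alpha>) - 2" by (simp add: turns_def)
  then show "real_of_int (k_M \<alpha> - 1) = real (turns \<alpha>) + 1" by simp
  have l: "real_of_int (k_M \<alpha>) * \<alpha> \<le> pi / 2" and h: "pi / 2 \<le> (real_of_int (k_M \<alpha>) + 1) * \<alpha>"
    using lo hi assms(1) by (simp_all add: field_simps)
  show 1: "real (turns \<alpha>) * \<alpha> \<le> pi / 2 - 2 * \<alpha>" using l by (simp add: t algebra_simps)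
  show "pi / 2 - 3 * \<alpha> \<le> real (turns \<alpha>) * \<alpha>" using h by (simp add: t algebra_simps)
  show "\<bar>real (turns \<alpha>)\<bar> * \<alpha> \<le> 2" using 1 assms pi_less_4 by simp
qed

section \<open>Expansions of elementary functions\<close>

lemma sin_diff_le: "\<bar>sin x - sin y\<bar> \<le> \<bar>x - y :: real\<bar>"
proof -
  have "norm (sin x - sin y) \<le> 1 * norm (x - y)"
    by (rule field_differentiable_bound[of UNIV sin cos]) (auto intro!: derivative_eq_intros)
  then show ?thesis by simp
qed

lemma cos_diff_le: "\<bar>cos x - cos y\<bar> \<le> \<bar>x - y :: real\<bar>"
proof -
  have "norm (cos x - cos y) \<le> 1 * norm (x - y)"
    by (rule field_differentiable_bound[of UNIV cos "\<lambda>x. - sin x"]) (auto intro!: derivative_eq_intros)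
  then show ?thesis by simp
qed

lemma sqrt_diff_le:
  assumes "0 \<le> x" "0 \<le> y"
  shows "\<bar>sqrt (1 + x) - sqrt (1 + y)\<bar> \<le> \<bar>x - y\<bar>"
proof -
  have h: "1 \<le> sqrt (1 + x)" "1 \<le> sqrt (1 + y)" using assms by auto
  have "\<bar>x - y\<bar> = \<bar>(sqrt (1 + x) - sqrt (1 + y)) * (sqrt (1 + x) + sqrt (1 + y))\<bar>"
    using assms by (simp add: algebra_simps)
  also have "\<dots> = \<bar>sqrt (1 + x) - sqrt (1 + y)\<bar> * (sqrt (1 + x) + sqrt (1 + y))"
    using h by (simp only: abs_mult abs_of_nonneg)
  finally show ?thesis
    using mult_left_mono[of 1 "sqrt (1 + x) + sqrt (1 + y)" "\<bar>sqrt (1 + x) - sqrt (1 + y)\<bar>"] h by simp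
qed

lemma LO_fixed_trig:
  "LO 0 (\<lambda>\<alpha> s. sin s)" "LO 0 (\<lambda>\<alpha> s. cos s)" "LO 0 (\<lambda>\<alpha> s. sin (s / 2))" "LO 0 (\<lambda>\<alpha> s. cos (s / 2))"
  "LO 0 (\<lambda>\<alpha> s. cis s)"
proof -
  have half: "\<bar>x / 2 - y / 2\<bar> \<le> \<bar>x - y\<bar>" for x y :: real by linarith
  show s: "LO 0 (\<lambda>\<alpha> s. sin s)" by (rule LO_fixed[where C = 1]) (auto simp: sin_diff_le)
  show c: "LO 0 (\<lambda>\<alpha> s. cos s)" by (rule LO_fixed[where C = 1]) (auto simp: cos_diff_le)
  show "LO 0 (\<lambda>\<alpha> s. sin (s / 2))"
    by (rule LO_fixed[where C = 1]) (use order_trans[OF sin_diff_le half] in auto)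
  show "LO 0 (\<lambda>\<alpha> s. cos (s / 2))"
    by (rule LO_fixed[where C = 1]) (use order_trans[OF cos_diff_le half] in auto)
  have "LO 0 (\<lambda>\<alpha> s. \<i>)" by (rule LO_fixed[where C = 1]) auto
  from LO_add[OF LO_of_real[OF c] LO_mult[OF this LO_of_real[OF s], simplified]]
  show "LO 0 (\<lambda>\<alpha> s. cis s)"
    by (rule LO_cong) (simp add: complex_eq_iff)
qed

lemma LO_parameter:
  "LO 1 (\<lambda>\<alpha> s. \<alpha>)" "LO 1 (\<lambda>\<alpha> s. sin \<alpha>)" "LO 2 (\<lambda>\<alpha> s. sin \<alpha> - \<alpha>)" "LO 2 (\<lambda>\<alpha> s. cos \<alpha> - 1)" "LO 1 (\<lambda>\<alpha> s. tan \<alpha>)"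
proof -
  note ev = eventually_at_right_0_less[of "1 / 2", simplified]
  show "LO 1 (\<lambda>\<alpha> s. \<alpha>)"
    by (rule LO_const[where C = 1]) (use ev in \<open>auto elim!: eventually_mono\<close>)
  show "LO 1 (\<lambda>\<alpha> s. sin \<alpha>)"
  proof (rule LO_const[where C = 1], use ev in eventually_elim)
    case (elim \<alpha>)
    then show ?case using abs_sin_x_le_abs_x[of \<alpha>] by simp
  qed
  show "LO 2 (\<lambda>\<alpha> s. sin \<alpha> - \<alpha>)"
  proof (rule LO_const[where C = 1], use ev in eventually_elim)
    case (elim \<alpha>)
    have "\<alpha> * (1 - \<alpha>\<^sup>2 / 2) \<le> sin \<alpha>" "sin \<alpha> \<le> \<alpha>" using elim sin_ge_cubic sin_x_le_x by auto
    moreover have "\<alpha> * \<alpha>\<^sup>2 \<le> 1 * \<alpha>\<^sup>2" using elim by (intro mult_right_mono) auto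
    ultimately show ?case by (simp add: algebra_simps)
  qed
  show "LO 2 (\<lambda>\<alpha> s. cos \<alpha> - 1)"
  proof (rule LO_const[where C = "1 / 2"], use ev in eventually_elim)
    case (elim \<alpha>)
    have "\<bar>cos \<alpha> - 1\<bar> = 1 - cos \<alpha>" by simp
    then show ?case using cos_ge_quadratic[of \<alpha>] by simp
  qed
  show "LO 1 (\<lambda>\<alpha> s. tan \<alpha>)"
  proof (rule LO_const[where C = 2], use ev in eventually_elim)
    case (elim \<alpha>)
    have "\<alpha>\<^sup>2 \<le> (1/2)\<^sup>2" using elim by (intro power_mono) auto
    then have c: "1 / 2 \<le> cos \<alpha>" using cos_ge_quadratic[of \<alpha>] by (simp add: power2_eq_square)
    have "\<bar>sin \<alpha>\<bar> / cos \<alpha> \<le> \<alpha> / (1 / 2)"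
      using c elim abs_sin_x_le_abs_x[of \<alpha>] by (intro frac_le) auto
    then show ?case using c by (simp add: tan_def abs_divide)
  qed
qed

text \<open>t is the duration of the last arc: (n + 1) pi less s and n periods, where n =
  \<open>turns \<alpha>\<close>. To leading order \<open>endA\<close> is - \<i> (\<beta> - \<alpha>)
  with \<beta> = pi/2 - n \<alpha>, and \<open>endB\<close> is - \<i> e^(- i s); their product is
  normalized to 1.\<close>

lemma front_asymptotics:
  defines "t \<equiv> \<lambda>\<alpha> s. pi - s - real (turns \<alpha>) * (2 * arctan (bang.gap \<alpha> s))"
  shows "LO 1 (\<lambda>\<alpha> s. cnj (bang.endA \<alpha> s (turns \<alpha>) (t \<alpha> s)) * bang.endB \<alpha> s (turns \<alpha>) (t \<alpha> s) * cis s
    / of_real (pi / 2 - real (turns \<alpha>) * \<alpha> - \<alpha>) - 1)"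
proof -
  note ev = eventually_at_right_0_less[of "1 / 100", simplified]
  have ev_bang: "\<forall>\<^sub>F \<alpha> in at_right 0. bang \<alpha>"
    using ev by eventually_elim (use pi_gt3 in \<open>auto simp: bang_def\<close>)
  have I0: "LO 0 (\<lambda>\<alpha> s. c)" for c :: complex by (rule LO_fixed[where C = "norm c"]) auto
  have one: "LO 0 (\<lambda>\<alpha> s. 1 :: real)" by (rule LO_fixed[where C = 1]) auto
  note trig = LO_fixed_trig and par = LO_parameter
  define D where "D \<alpha> s = (cos \<alpha>)\<^sup>2 + (sin \<alpha>)\<^sup>2 * cos s" for \<alpha> s :: real
  have "LO 2 (\<lambda>\<alpha> s. D \<alpha> s - 1)"
  proof (rule LO_cong[OF LO_mono[OF LO_mult[OF LO_mult[OF par(2) par(2)] LO_diff[OF trig(2) one]]]])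
    show "\<forall>\<^sub>F \<alpha> in at_right 0. \<forall>s\<in>{0..pi}. sin \<alpha> * sin \<alpha> * (cos s - 1) = D \<alpha> s - 1"
      by (auto simp: D_def cos_squared_eq power2_eq_square algebra_simps intro!: always_eventually)
  qed simp
  then have iD: "LO 2 (\<lambda>\<alpha> s. 1 / D \<alpha> s - 1)" by (rule LO_inverse) simp
  define g where "g \<alpha> s = sin \<alpha> * sin s * (1 / D \<alpha> s)" for \<alpha> s
  have ass: "LO 2 (\<lambda>\<alpha> s. sin \<alpha> * sin s - \<alpha> * sin s)"
    by (rule LO_mult_approx[OF par(3) LO_self[of 2] par(1) trig(1)]) auto
  have as: "LO 1 (\<lambda>\<alpha> s. \<alpha> * sin s)" using LO_mult[OF par(1) trig(1)] by simp
  have g_approx: "LO 2 (\<lambda>\<alpha> s. g \<alpha> s - \<alpha> * sin s)"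
    using LO_mult_approx[OF ass iD as one, of 2] by (simp add: g_def)
  have g: "LO 1 g" using LO_from_approx[OF g_approx as] by simp
  define q where "q \<alpha> s = sqrt (1 + (g \<alpha> s)\<^sup>2)" for \<alpha> s
  have g2: "LO 2 (\<lambda>\<alpha> s. (g \<alpha> s)\<^sup>2)" using LO_mult[OF g g] by (simp add: power2_eq_square numeral_2_eq_2)
  have q: "LO 2 (\<lambda>\<alpha> s. q \<alpha> s - 1)"
    by (rule LO_norm_le[OF g2, where B = 1]) (use sqrt_diff_le[of _ 0] sqrt_diff_le in \<open>auto simp: q_def intro!: always_eventually\<close>)
  have iq: "LO 2 (\<lambda>\<alpha> s. 1 / q \<alpha> s - 1)" by (rule LO_inverse[OF q]) simp
  define k l where "k = (\<lambda>\<alpha> s. 1 / q \<alpha> s)" and "l = (\<lambda>\<alpha> s. g \<alpha> s * (1 / q \<alpha> s))"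
  have k: "LO 2 (\<lambda>\<alpha> s. k \<alpha> s - 1)" using iq by (simp add: k_def)
  have l: "LO 2 (\<lambda>\<alpha> s. l \<alpha> s - \<alpha> * sin s)"
    using LO_mult_approx[OF g_approx iq as one, of 2] by (simp add: l_def)
  define b where "b \<alpha> s = arctan (tan \<alpha> * q \<alpha> s)" for \<alpha> s
  have tq: "LO 3 (\<lambda>\<alpha> s. tan \<alpha> * (q \<alpha> s - 1))" using LO_mult[OF par(5) q] by (simp add: numeral_3_eq_3 numeral_2_eq_2)
  \<comment> \<open>Third order, so that n b is known up to O(\<alpha>^2), one order better than
    \<beta>.\<close>
  have b: "LO 3 (\<lambda>\<alpha> s. b \<alpha> s - \<alpha>)"
  proof (rule LO_cong[OF LO_lipschitz[OF tq, where F = "\<lambda>\<alpha> x. arctan (tan \<alpha> + x)"]])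
    show "\<bar>arctan (tan \<alpha> + x) - arctan (tan \<alpha> + y)\<bar> \<le> \<bar>x - y\<bar>" for \<alpha> x y
      using arctan_diff_le[of "tan \<alpha> + x" "tan \<alpha> + y"] by simp
    show "\<forall>\<^sub>F \<alpha> in at_right 0. \<forall>s\<in>{0..pi}. arctan (tan \<alpha> + tan \<alpha> * (q \<alpha> s - 1)) - arctan (tan \<alpha> + 0) = b \<alpha> s - \<alpha>"
      using ev by eventually_elim (use pi_gt3 in \<open>auto simp: b_def arctan_tan algebra_simps\<close>)
  qed
  have n: "\<forall>\<^sub>F \<alpha> in at_right 0. \<bar>real (turns \<alpha>)\<bar> * \<alpha> \<le> 2"
    using ev by eventually_elim (use turns_bounds(4) in auto)
  have nb: "LO 2 (\<lambda>\<alpha> s. real (turns \<alpha>) * (b \<alpha> s - \<alpha>))"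
  proof -
    have "LO (Suc 2) (\<lambda>\<alpha> s. b \<alpha> s - \<alpha>)" using b by (simp add: eval_nat_numeral)
    from LO_scale[OF this n] show ?thesis by simp
  qed
  \<comment> \<open>What n turns by \<alpha> leave of pi/2. It lies between 2 \<alpha> and 3
    \<alpha>, and the leading terms see r(\<alpha>) only through it.\<close>
  define \<beta> where "\<beta> \<alpha> = pi / 2 - real (turns \<alpha>) * \<alpha>" for \<alpha>
  have \<beta>: "\<forall>\<^sub>F \<alpha> in at_right 0. 0 < \<alpha> \<and> \<alpha> < 1 / 100 \<and> 2 * \<alpha> \<le> \<beta> \<alpha> \<and> \<beta> \<alpha> \<le> 3 * \<alpha>"
    using ev by eventually_elim (use turns_bounds in \<open>force simp: \<beta>_def\<close>)
  have \<beta>1: "LO 1 (\<lambda>\<alpha> s. \<beta> \<alpha>)"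
    by (rule LO_const[where C = 3]) (use \<beta> in \<open>auto elim!: eventually_mono\<close>)
  have \<beta>_sq: "(\<beta> \<alpha>)\<^sup>2 \<le> 9 * \<alpha>\<^sup>2" if "0 < \<alpha>" "2 * \<alpha> \<le> \<beta> \<alpha>" "\<beta> \<alpha> \<le> 3 * \<alpha>" for \<alpha>
    using power_mono[of "\<beta> \<alpha>" "3 * \<alpha>" 2] that by (simp add: power_mult_distrib)
  have sin\<beta>: "LO 2 (\<lambda>\<alpha> s. sin (\<beta> \<alpha>) - \<beta> \<alpha>)"
  proof (rule LO_const[where C = 9], use \<beta> in eventually_elim)
    case (elim \<alpha>)
    have "\<beta> \<alpha> * (1 - (\<beta> \<alpha>)\<^sup>2 / 2) \<le> sin (\<beta> \<alpha>)" "sin (\<beta> \<alpha>) \<le> \<beta> \<alpha>" using elim by (auto intro!: sin_ge_cubic sin_x_le_x)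
    moreover have "\<beta> \<alpha> * (\<beta> \<alpha>)\<^sup>2 \<le> 1 * (9 * \<alpha>\<^sup>2)" using elim \<beta>_sq[of \<alpha>] by (intro mult_mono) auto
    ultimately show ?case by (simp add: algebra_simps)
  qed
  have cos\<beta>: "LO 2 (\<lambda>\<alpha> s. cos (\<beta> \<alpha>) - 1)"
  proof (rule LO_const[where C = 9], use \<beta> in eventually_elim)
    case (elim \<alpha>)
    have "\<bar>cos (\<beta> \<alpha>) - 1\<bar> = 1 - cos (\<beta> \<alpha>)" by simp
    moreover have "(\<beta> \<alpha>)\<^sup>2 \<le> 9 * \<alpha>\<^sup>2" using \<beta>_sq elim by blast
    ultimately have "\<bar>cos (\<beta> \<alpha>) - 1\<bar> \<le> 9 * \<alpha>\<^sup>2"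
      using cos_ge_quadratic[of "\<beta> \<alpha>"] zero_le_power2[of \<alpha>] by linarith
    then show ?case by simp
  qed
  define cr sr where "cr = (\<lambda>\<alpha> s. cos (real (turns \<alpha>) * b \<alpha> s))" and "sr = (\<lambda>\<alpha> s. sin (real (turns \<alpha>) * b \<alpha> s))"
  have r_eq: "real (turns \<alpha>) * \<alpha> + real (turns \<alpha>) * (b \<alpha> s - \<alpha>) = real (turns \<alpha>) * b \<alpha> s" for \<alpha> s by (simp add: algebra_simps)
  have n\<alpha>: "real (turns \<alpha>) * \<alpha> = pi / 2 - \<beta> \<alpha>" for \<alpha> by (simp add: \<beta>_def)
  have tr: "cos (real (turns \<alpha>) * \<alpha>) = sin (\<beta> \<alpha>)" "sin (real (turns \<alpha>) * \<alpha>) = cos (\<beta> \<alpha>)" for \<alpha>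
    by (simp_all add: n\<alpha> cos_diff sin_diff)
  have cr: "LO 2 (\<lambda>\<alpha> s. cr \<alpha> s - \<beta> \<alpha>)"
  proof -
    have "LO 2 (\<lambda>\<alpha> s. cos (real (turns \<alpha>) * \<alpha> + real (turns \<alpha>) * (b \<alpha> s - \<alpha>)) - cos (real (turns \<alpha>) * \<alpha> + 0))"
      by (rule LO_lipschitz[OF nb, where F = "\<lambda>\<alpha> x. cos (real (turns \<alpha>) * \<alpha> + x)"])
         (rule order_trans[OF cos_diff_le], simp)
    from LO_add[OF this sin\<beta>] show ?thesis
      by (rule LO_cong) (simp add: r_eq cr_def tr)
  qed
  have sr: "LO 2 (\<lambda>\<alpha> s. sr \<alpha> s - 1)"
  proof -
    have "LO 2 (\<lambda>\<alpha> s. sin (real (turns \<alpha>) * \<alpha> + real (turns \<alpha>) * (b \<alpha> s - \<alpha>)) - sin (real (turns \<alpha>) * \<alpha> + 0))"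
      by (rule LO_lipschitz[OF nb, where F = "\<lambda>\<alpha> x. sin (real (turns \<alpha>) * \<alpha> + x)"])
         (rule order_trans[OF sin_diff_le], simp)
    from LO_add[OF this cos\<beta>] show ?thesis
      by (rule LO_cong) (simp add: r_eq sr_def tr)
  qed
  \<comment> \<open>The total delay of the interior arcs beyond n pi: O(\<alpha>^2) on each arc,
    O(\<alpha>) altogether.\<close>
  define \<theta> where "\<theta> \<alpha> s = real (turns \<alpha>) * (2 * arctan (sin \<alpha> * g \<alpha> s))" for \<alpha> s
  have ag: "LO 2 (\<lambda>\<alpha> s. sin \<alpha> * g \<alpha> s)" using LO_mult[OF par(2) g] by (simp add: numeral_2_eq_2)
  have \<theta>: "LO 1 \<theta>"
  proof -
    have "LO 2 (\<lambda>\<alpha> s. arctan (sin \<alpha> * g \<alpha> s))"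
      using LO_lipschitz[OF ag, where F = "\<lambda>\<alpha>. arctan"] arctan_diff_le by simp
    from LO_add[OF this this] have "LO (Suc 1) (\<lambda>\<alpha> s. 2 * arctan (sin \<alpha> * g \<alpha> s))" by (simp add: eval_nat_numeral)
    from LO_scale[OF this n] show ?thesis by (simp add: \<theta>_def[abs_def])
  qed
  define C S where "C = (\<lambda>\<alpha> s. cos ((pi - s - \<theta> \<alpha> s) / 2))" and "S = (\<lambda>\<alpha> s. sin ((pi - s - \<theta> \<alpha> s) / 2))"
  have half: "LO 1 (\<lambda>\<alpha> s. \<theta> \<alpha> s / 2)"
    by (rule LO_norm_le[OF \<theta>, where B = "1/2"]) (auto simp flip: diff_divide_distrib intro!: always_eventually)
  have c\<theta>: "LO 1 (\<lambda>\<alpha> s. cos (\<theta> \<alpha> s / 2) - 1)"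
    using LO_lipschitz[OF half, where F = "\<lambda>\<alpha>. cos"] cos_diff_le by simp
  have s\<theta>: "LO 1 (\<lambda>\<alpha> s. sin (\<theta> \<alpha> s / 2))"
    using LO_lipschitz[OF half, where F = "\<lambda>\<alpha>. sin"] sin_diff_le by simp
  have arg: "(pi - s - \<theta> \<alpha> s) / 2 = pi / 2 - (s / 2 + \<theta> \<alpha> s / 2)" for \<alpha> s by (simp add: field_simps)
  have cc: "LO 1 (\<lambda>\<alpha> s. cos (s / 2) * (cos (\<theta> \<alpha> s / 2) - 1))" "LO 1 (\<lambda>\<alpha> s. sin (s / 2) * sin (\<theta> \<alpha> s / 2))"
    "LO 1 (\<lambda>\<alpha> s. sin (s / 2) * (cos (\<theta> \<alpha> s / 2) - 1))" "LO 1 (\<lambda>\<alpha> s. cos (s / 2) * sin (\<theta> \<alpha> s / 2))"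
    using LO_mult[OF trig(4) c\<theta>] LO_mult[OF trig(3) s\<theta>] LO_mult[OF trig(3) c\<theta>] LO_mult[OF trig(4) s\<theta>] by simp_all
  have S_eq: "S \<alpha> s = cos (s / 2) * cos (\<theta> \<alpha> s / 2) - sin (s / 2) * sin (\<theta> \<alpha> s / 2)"
    and C_eq: "C \<alpha> s = sin (s / 2) * cos (\<theta> \<alpha> s / 2) + cos (s / 2) * sin (\<theta> \<alpha> s / 2)" for \<alpha> s
    unfolding S_def C_def arg by (simp_all add: sin_diff cos_diff sin_add cos_add)
  have S: "LO 1 (\<lambda>\<alpha> s. S \<alpha> s - cos (s / 2))"
    by (rule LO_cong[OF LO_diff[OF cc(1,2)]]) (simp add: S_eq algebra_simps)
  have C: "LO 1 (\<lambda>\<alpha> s. C \<alpha> s - sin (s / 2))"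
    by (rule LO_cong[OF LO_add[OF cc(3,4)]]) (simp add: C_eq algebra_simps)
  define At As where "At = (\<lambda>\<alpha> s. Complex (C \<alpha> s) (cos \<alpha> * S \<alpha> s))" and "As = (\<lambda>\<alpha> s. Complex (cos (s / 2)) (cos \<alpha> * sin (s / 2)))"
  define Bt Bs where "Bt = (\<lambda>\<alpha> s. complex_of_real (sin \<alpha> * S \<alpha> s))" and "Bs = (\<lambda>\<alpha> s. complex_of_real (sin \<alpha> * sin (s / 2)))"
  \<comment> \<open>Leading terms: the last arc lasts about pi - s, so its half angle has cosine sin
    (s/2) and sine cos (s/2).\<close>
  define At0 As0 where "At0 = (\<lambda>(\<alpha>::real) s. Complex (sin (s / 2)) (cos (s / 2)))" and "As0 = (\<lambda>(\<alpha>::real) s. Complex (cos (s / 2)) (sin (s / 2)))"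
  define Bt0 Bs0 where "Bt0 = (\<lambda>\<alpha> s. complex_of_real (\<alpha> * cos (s / 2)))" and "Bs0 = (\<lambda>\<alpha> s. complex_of_real (\<alpha> * sin (s / 2)))"
  have Complex_LO: "LO m (\<lambda>\<alpha> s. Complex (f \<alpha> s) (h \<alpha> s))" if "LO m f" "LO m h" for m f h
    using LO_add[OF LO_of_real[OF that(1)] LO_mult[OF I0[of \<i>] LO_of_real[OF that(2)], simplified]]
    by (rule LO_cong) (simp add: complex_eq_iff)
  have At: "LO 1 (\<lambda>\<alpha> s. At \<alpha> s - At0 \<alpha> s)"
  proof -
    have "LO 1 (\<lambda>\<alpha> s. cos \<alpha> * S \<alpha> s - 1 * cos (s / 2))"
      by (rule LO_mult_approx[OF par(4) S one trig(4)]) auto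
    from Complex_LO[OF C this] show ?thesis by (rule LO_cong) (simp add: At_def At0_def complex_eq_iff)
  qed
  have As: "LO 1 (\<lambda>\<alpha> s. As \<alpha> s - As0 \<alpha> s)"
  proof -
    have "LO 1 (\<lambda>\<alpha> s. cos \<alpha> * sin (s / 2) - 1 * sin (s / 2))"
      by (rule LO_mult_approx[OF par(4) LO_self[of 1] one trig(3)]) auto
    from Complex_LO[OF LO_self this] show ?thesis by (rule LO_cong) (simp add: As_def As0_def complex_eq_iff)
  qed
  have Bt: "LO 2 (\<lambda>\<alpha> s. Bt \<alpha> s - Bt0 \<alpha> s)"
  proof -
    have "LO 2 (\<lambda>\<alpha> s. sin \<alpha> * S \<alpha> s - \<alpha> * cos (s / 2))"
      by (rule LO_mult_approx[OF par(3) S par(1) trig(4)]) auto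
    from LO_of_real[OF this] show ?thesis by (simp add: Bt_def Bt0_def)
  qed
  have Bs: "LO 2 (\<lambda>\<alpha> s. Bs \<alpha> s - Bs0 \<alpha> s)"
  proof -
    have "LO 2 (\<lambda>\<alpha> s. sin \<alpha> * sin (s / 2) - \<alpha> * sin (s / 2))"
      by (rule LO_mult_approx[OF par(3) LO_self[of 2] par(1) trig(3)]) auto
    from LO_of_real[OF this] show ?thesis by (simp add: Bs_def Bs0_def)
  qed
  have At0: "LO 0 At0" and As0: "LO 0 As0"
    unfolding At0_def As0_def by (intro Complex_LO trig)+
  have Bt0: "LO 1 Bt0" and Bs0: "LO 1 Bs0"
    using LO_of_real[OF LO_mult[OF par(1) trig(4)]] LO_of_real[OF LO_mult[OF par(1) trig(3)]]
    by (simp_all add: Bt0_def Bs0_def)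
  have cAt: "LO 1 (\<lambda>\<alpha> s. cnj (At \<alpha> s) - cnj (At0 \<alpha> s))" and cAs: "LO 1 (\<lambda>\<alpha> s. cnj (As \<alpha> s) - cnj (As0 \<alpha> s))"
    using LO_cnj[OF At] LO_cnj[OF As] by simp_all
  note cAt0 = LO_cnj[OF At0] and cAs0 = LO_cnj[OF As0]
  have half_angle: "sin s = 2 * sin (s / 2) * cos (s / 2)" "cos s = (cos (s / 2))\<^sup>2 - (sin (s / 2))\<^sup>2"
    "(sin (s / 2))\<^sup>2 + (cos (s / 2))\<^sup>2 = 1" for s :: real
    using sin_double[of "s / 2"] cos_double[of "s / 2"] by simp_all
  have AA: "LO 1 (\<lambda>\<alpha> s. cnj (At \<alpha> s) * cnj (As \<alpha> s) - (- \<i>))"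
  proof (rule LO_cong[OF LO_mult_approx[OF cAt cAs cAt0 cAs0]])
    have "cnj (At0 \<alpha> s) * cnj (As0 \<alpha> s) = - \<i>" for \<alpha> s
      using half_angle(3)[of s] by (simp add: At0_def As0_def complex_eq_iff power2_eq_square)
    then show "\<forall>\<^sub>F \<alpha> in at_right 0. \<forall>s\<in>{0..pi}. cnj (At \<alpha> s) * cnj (As \<alpha> s) - cnj (At0 \<alpha> s) * cnj (As0 \<alpha> s)
       = cnj (At \<alpha> s) * cnj (As \<alpha> s) - (- \<i>)" by simp
  qed auto
  have BB: "LO 1 (\<lambda>\<alpha> s. Bt \<alpha> s * Bs \<alpha> s)"
    by (rule LO_mono[OF LO_mult[OF LO_from_approx[OF Bt Bt0] LO_from_approx[OF Bs Bs0]]]) auto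
  define Y Z where "Y = (\<lambda>\<alpha> s. cnj (At \<alpha> s) * cnj (As \<alpha> s) + Bt \<alpha> s * Bs \<alpha> s)"
    and "Z = (\<lambda>\<alpha> s. cnj (At \<alpha> s) * cnj (As \<alpha> s) - Bt \<alpha> s * Bs \<alpha> s)"
  have Y: "LO 1 (\<lambda>\<alpha> s. Y \<alpha> s - (- \<i>))"
    by (rule LO_cong[OF LO_add[OF AA BB]]) (simp add: Y_def)
  have Z: "LO 1 (\<lambda>\<alpha> s. Z \<alpha> s - (- \<i>))"
    by (rule LO_cong[OF LO_diff[OF AA BB]]) (simp add: Z_def)
  define X where "X = (\<lambda>\<alpha> s. cnj (At \<alpha> s) * Bs \<alpha> s + Bt \<alpha> s * cnj (As \<alpha> s))"
  define X0 where "X0 = (\<lambda>\<alpha> s. cnj (At0 \<alpha> s) * Bs0 \<alpha> s + Bt0 \<alpha> s * cnj (As0 \<alpha> s))"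
  have X: "LO 2 (\<lambda>\<alpha> s. X \<alpha> s - X0 \<alpha> s)"
  proof (rule LO_cong[OF LO_add])
    show "LO 2 (\<lambda>\<alpha> s. cnj (At \<alpha> s) * Bs \<alpha> s - cnj (At0 \<alpha> s) * Bs0 \<alpha> s)"
      by (rule LO_mult_approx[OF cAt Bs cAt0 Bs0]) auto
    show "LO 2 (\<lambda>\<alpha> s. Bt \<alpha> s * cnj (As \<alpha> s) - Bt0 \<alpha> s * cnj (As0 \<alpha> s))"
      by (rule LO_mult_approx[OF Bt cAs Bt0 cAs0]) auto
  qed (simp add: X_def X0_def)
  have X0: "LO 1 X0"
    unfolding X0_def using LO_add[OF LO_mult[OF cAt0 Bs0, simplified] LO_mult[OF Bt0 cAs0, simplified]] by simp
  have kc: "LO 2 (\<lambda>\<alpha> s. complex_of_real (k \<alpha> s) - 1)" using LO_of_real[OF k] by simp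
  have lc: "LO 2 (\<lambda>\<alpha> s. complex_of_real (l \<alpha> s) - complex_of_real (\<alpha> * sin s))" using LO_of_real[OF l] by simp
  have lc0: "LO 1 (\<lambda>\<alpha> s. complex_of_real (\<alpha> * sin s))" by (rule LO_of_real[OF as])
  have crc: "LO 2 (\<lambda>\<alpha> s. complex_of_real (cr \<alpha> s) - complex_of_real (\<beta> \<alpha>))" using LO_of_real[OF cr] by simp
  have src: "LO 2 (\<lambda>\<alpha> s. complex_of_real (sr \<alpha> s) - 1)" using LO_of_real[OF sr] by simp
  have \<beta>c: "LO 1 (\<lambda>\<alpha> s. complex_of_real (\<beta> \<alpha>))" by (rule LO_of_real[OF \<beta>1])
  have \<alpha>c: "LO 1 (\<lambda>\<alpha> s. complex_of_real \<alpha>)" by (rule LO_of_real[OF par(1)])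
  \<comment> \<open>\<i> W is the coefficient of sin r in \<open>endA\<close>. The imaginary part -
    \<alpha> sin s of X0 is cancelled by the tilt term l Z, leaving \<alpha> for every s. This makes
    the leading term of \<open>endA\<close> independent of s.\<close>
  define W where "W = (\<lambda>\<alpha> s. of_real (k \<alpha> s) * X \<alpha> s - of_real (l \<alpha> s) * Z \<alpha> s)"
  have W: "LO 2 (\<lambda>\<alpha> s. W \<alpha> s - of_real \<alpha>)"
  proof (rule LO_cong[OF LO_diff])
    show "LO 2 (\<lambda>\<alpha> s. of_real (k \<alpha> s) * X \<alpha> s - 1 * X0 \<alpha> s)"
      by (rule LO_mult_approx[OF kc X I0 X0]) auto
    show "LO 2 (\<lambda>\<alpha> s. of_real (l \<alpha> s) * Z \<alpha> s - of_real (\<alpha> * sin s) * (- \<i>))"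
      by (rule LO_mult_approx[OF lc Z lc0 I0]) auto
    have "X0 \<alpha> s - of_real (\<alpha> * sin s) * \<i> * (- 1) = of_real \<alpha>" for \<alpha> s
    proof (rule complex_eqI)
      show "Re (X0 \<alpha> s - of_real (\<alpha> * sin s) * \<i> * (- 1)) = Re (of_real \<alpha>)"
      proof -
        have "\<alpha> * (cos (s / 2) * cos (s / 2)) + \<alpha> * (sin (s / 2) * sin (s / 2)) = \<alpha>"
          unfolding distrib_left[symmetric] by simp
        then show ?thesis by (simp add: X0_def At0_def As0_def Bt0_def Bs0_def algebra_simps)
      qed
      show "Im (X0 \<alpha> s - of_real (\<alpha> * sin s) * \<i> * (- 1)) = Im (of_real \<alpha>)"
        unfolding half_angle(1)[of s] by (simp add: X0_def At0_def As0_def Bt0_def Bs0_def)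
    qed
    then show "\<forall>\<^sub>F \<alpha> in at_right 0. \<forall>s\<in>{0..pi}. of_real (k \<alpha> s) * X \<alpha> s - 1 * X0 \<alpha> s
        - (of_real (l \<alpha> s) * Z \<alpha> s - of_real (\<alpha> * sin s) * (- \<i>)) = W \<alpha> s - of_real \<alpha>"
      by (simp add: W_def algebra_simps)
  qed
  define A where "A = (\<lambda>\<alpha> s. of_real (cr \<alpha> s) * Y \<alpha> s + \<i> * (of_real (sr \<alpha> s) * W \<alpha> s))"
  have A: "LO 2 (\<lambda>\<alpha> s. A \<alpha> s - (- \<i> * of_real (\<beta> \<alpha> - \<alpha>)))"
  proof (rule LO_cong[OF LO_add])
    show "LO 2 (\<lambda>\<alpha> s. of_real (cr \<alpha> s) * Y \<alpha> s - of_real (\<beta> \<alpha>) * (- \<i>))"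
      by (rule LO_mult_approx[OF crc Y \<beta>c I0]) auto
    have "LO 2 (\<lambda>\<alpha> s. of_real (sr \<alpha> s) * W \<alpha> s - 1 * of_real \<alpha>)"
      by (rule LO_mult_approx[OF src W I0 \<alpha>c]) auto
    from LO_mult[OF I0[of \<i>] this] show "LO 2 (\<lambda>\<alpha> s. \<i> * (of_real (sr \<alpha> s) * W \<alpha> s - 1 * of_real \<alpha>))"
      by (simp add: numeral_2_eq_2)
  qed (simp add: A_def algebra_simps)
  define B where "B = (\<lambda>\<alpha> s. \<i> * (of_real (cr \<alpha> s) * (At \<alpha> s * Bs \<alpha> s - Bt \<alpha> s * cnj (As \<alpha> s)))
     + of_real (sr \<alpha> s) * (of_real (k \<alpha> s) * (Bt \<alpha> s * Bs \<alpha> s - At \<alpha> s * cnj (As \<alpha> s))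
         - of_real (l \<alpha> s) * (Bt \<alpha> s * cnj (As \<alpha> s) + At \<alpha> s * Bs \<alpha> s)))"
  \<comment> \<open>First order suffices here, as the small factor of the product sits in A.\<close>
  have B: "LO 1 (\<lambda>\<alpha> s. B \<alpha> s - (- (\<i> * cis (- s))))"
  proof -
    have c1: "LO 1 (\<lambda>\<alpha> s. complex_of_real (cr \<alpha> s))" by (rule LO_from_approx[OF crc \<beta>c]) simp
    have l1: "LO 1 (\<lambda>\<alpha> s. complex_of_real (l \<alpha> s))" by (rule LO_from_approx[OF lc lc0]) simp
    have At': "LO 0 At" and cAs': "LO 0 (\<lambda>\<alpha> s. cnj (As \<alpha> s))"
      using LO_from_approx[OF At At0] LO_from_approx[OF cAs cAs0] by simp_all
    have Bt': "LO 0 Bt" and Bs': "LO 0 Bs"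
      using LO_mono[OF LO_from_approx[OF Bt Bt0], of 0] LO_mono[OF LO_from_approx[OF Bs Bs0], of 0] by simp_all
    have ab: "LO 0 (\<lambda>\<alpha> s. At \<alpha> s * Bs \<alpha> s)" "LO 0 (\<lambda>\<alpha> s. Bt \<alpha> s * cnj (As \<alpha> s))"
      using LO_mult[OF At' Bs'] LO_mult[OF Bt' cAs'] by simp_all
    have 1: "LO 1 (\<lambda>\<alpha> s. \<i> * (of_real (cr \<alpha> s) * (At \<alpha> s * Bs \<alpha> s - Bt \<alpha> s * cnj (As \<alpha> s))))"
      using LO_mult[OF I0[of \<i>] LO_mult[OF c1 LO_diff[OF ab]]] by simp
    have 2: "LO 1 (\<lambda>\<alpha> s. of_real (l \<alpha> s) * (Bt \<alpha> s * cnj (As \<alpha> s) + At \<alpha> s * Bs \<alpha> s))"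
      using LO_mult[OF l1 LO_add[OF ab(2,1)]] by simp
    have "At0 \<alpha> s * cnj (As0 \<alpha> s) = \<i> * cis (- s)" for \<alpha> s
      unfolding complex_eq_iff using half_angle(1,2)[of s] by (simp add: At0_def As0_def power2_eq_square)
    then have e: "LO 1 (\<lambda>\<alpha> s. At \<alpha> s * cnj (As \<alpha> s) - \<i> * cis (- s))"
      using LO_mult_approx[OF At cAs At0 cAs0, of 1] by simp
    have 3: "LO 1 (\<lambda>\<alpha> s. (Bt \<alpha> s * Bs \<alpha> s - At \<alpha> s * cnj (As \<alpha> s)) - (- (\<i> * cis (- s))))"
      by (rule LO_cong[OF LO_diff[OF BB e]]) simp
    have cis0: "LO 0 (\<lambda>\<alpha> s. - (\<i> * cis (- s)))"
      using LO_minus[OF LO_mult[OF I0[of \<i>] LO_cnj[OF trig(5)]]] by (simp add: cis_cnj)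
    have 4: "LO 1 (\<lambda>\<alpha> s. of_real (k \<alpha> s) * (Bt \<alpha> s * Bs \<alpha> s - At \<alpha> s * cnj (As \<alpha> s)) - 1 * (- (\<i> * cis (- s))))"
      by (rule LO_mult_approx[OF kc 3 I0 cis0]) auto
    from LO_diff[OF 4 2] have 5: "LO 1 (\<lambda>\<alpha> s. (of_real (k \<alpha> s) * (Bt \<alpha> s * Bs \<alpha> s - At \<alpha> s * cnj (As \<alpha> s))
         - of_real (l \<alpha> s) * (Bt \<alpha> s * cnj (As \<alpha> s) + At \<alpha> s * Bs \<alpha> s)) - (- (\<i> * cis (- s))))"
      by (rule LO_cong) simp
    have 6: "LO 1 (\<lambda>\<alpha> s. of_real (sr \<alpha> s) * (of_real (k \<alpha> s) * (Bt \<alpha> s * Bs \<alpha> s - At \<alpha> s * cnj (As \<alpha> s))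
         - of_real (l \<alpha> s) * (Bt \<alpha> s * cnj (As \<alpha> s) + At \<alpha> s * Bs \<alpha> s)) - 1 * (- (\<i> * cis (- s))))"
      by (rule LO_mult_approx[OF src 5 I0 cis0]) auto
    show ?thesis by (rule LO_cong[OF LO_add[OF 1 6]]) (simp add: B_def)
  qed
  have f1: "LO 1 (\<lambda>\<alpha> s. (1 / (\<beta> \<alpha> - \<alpha>)) *\<^sub>R cnj (A \<alpha> s) - \<i>)"
  proof -
    \<comment> \<open>\<beta> - \<alpha> \<ge> \<alpha>, whatever the remainder is; division turns
      second order in A into first order.\<close>
    have c: "\<forall>\<^sub>F \<alpha> in at_right 0. \<bar>1 / (\<beta> \<alpha> - \<alpha>)\<bar> * \<alpha> \<le> 1"
      using \<beta> by eventually_elim (auto simp: pos_divide_le_eq)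
    have "LO (Suc 1) (\<lambda>\<alpha> s. cnj (A \<alpha> s) - \<i> * of_real (\<beta> \<alpha> - \<alpha>))"
      using LO_cnj[OF A] by (simp add: numeral_2_eq_2)
    from LO_scale[OF this c] show ?thesis
    proof (rule LO_cong)
      show "\<forall>\<^sub>F \<alpha> in at_right 0. \<forall>s\<in>{0..pi}. (1 / (\<beta> \<alpha> - \<alpha>)) *\<^sub>R (cnj (A \<alpha> s) - \<i> * of_real (\<beta> \<alpha> - \<alpha>)) = (1 / (\<beta> \<alpha> - \<alpha>)) *\<^sub>R cnj (A \<alpha> s) - \<i>"
        using \<beta> by eventually_elim (auto simp: scaleR_conv_of_real field_simps)
    qed
  qed
  have f2: "LO 1 (\<lambda>\<alpha> s. B \<alpha> s * cis s - (- \<i>))"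
    using LO_mult[OF B trig(5)] by (simp add: algebra_simps cis_mult)
  have F: "LO 1 (\<lambda>\<alpha> s. (1 / (\<beta> \<alpha> - \<alpha>)) *\<^sub>R cnj (A \<alpha> s) * (B \<alpha> s * cis s) - \<i> * (- \<i>))"
    by (rule LO_mult_approx[OF f1 f2 I0 I0]) auto
  show ?thesis
  proof (rule LO_cong[OF F], use ev_bang in eventually_elim)
    case (elim \<alpha>)
    interpret bang \<alpha> by fact
    show ?case
    proof
      fix s
      have gap: "gap s = sin \<alpha> * g \<alpha> s" by (simp add: gap_def g_def D_def power2_eq_square)
      have t: "t \<alpha> s = pi - s - \<theta> \<alpha> s" by (simp add: t_def \<theta>_def gap)
      have tilt: "tilt s = g \<alpha> s" by (simp add: tilt_def g_def D_def)
      have kl: "tilt_cos s = k \<alpha> s" "tilt_sin s = l \<alpha> s" "turn_angle s = b \<alpha> s"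
        by (simp_all add: tilt_cos_def tilt_sin_def turn_angle_def tilt k_def l_def b_def q_def)
      have r: "rotA (t \<alpha> s) = At \<alpha> s" "rotA s = As \<alpha> s" "of_real (rotB (t \<alpha> s)) = Bt \<alpha> s" "of_real (rotB s) = Bs \<alpha> s"
        by (simp_all add: rotA_def rotB_def t At_def As_def Bt_def Bs_def C_def S_def)
      have csr: "cos (real (turns \<alpha>) * b \<alpha> s) = cr \<alpha> s" "sin (real (turns \<alpha>) * b \<alpha> s) = sr \<alpha> s"
        by (simp_all add: cr_def sr_def)
      have eA: "endA s (turns \<alpha>) (t \<alpha> s) = A \<alpha> s"
        unfolding endA_def turn_fst_def turn_snd_def kl r csr A_def Y_def W_def X_def Z_def by (simp add: algebra_simps)
      have eB: "endB s (turns \<alpha>) (t \<alpha> s) = B \<alpha> s"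
        unfolding endB_def turn_fst_def turn_snd_def kl r csr B_def by (simp add: algebra_simps)
      show "(1 / (\<beta> \<alpha> - \<alpha>)) *\<^sub>R cnj (A \<alpha> s) * (B \<alpha> s * cis s) - \<i> * (- \<i>)
        = cnj (endA s (turns \<alpha>) (t \<alpha> s)) * endB s (turns \<alpha>) (t \<alpha> s) * cis s / of_real (pi / 2 - real (turns \<alpha>) * \<alpha> - \<alpha>) - 1"
        unfolding eA eB by (simp add: \<beta>_def scaleR_conv_of_real)
    qed
  qed
qed

section \<open>Star-shapedness of the front\<close>

lemma sin_ge_fraction:
  assumes "0 \<le> x" "x \<le> pi / 2"
  shows "2 / 5 * x \<le> sin (x::real)"
proof -
  have "x / 2 \<le> 4 / 5" using assms pi_approx by simp
  then have "(x / 2)\<^sup>2 \<le> (4 / 5)\<^sup>2" using assms by (intro power_mono) auto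
  then have q: "2 / 3 \<le> 1 - (x / 2)\<^sup>2 / 2" by (simp add: power2_eq_square)
  have "x / 2 * (2 / 3) \<le> x / 2 * (1 - (x / 2)\<^sup>2 / 2)" using q assms by (intro mult_left_mono) auto
  also have "\<dots> \<le> sin (x / 2)" using assms by (intro sin_ge_cubic) auto
  finally have 1: "x / 3 \<le> sin (x / 2)" by simp
  have 2: "2 / 3 \<le> cos (x / 2)" using q cos_ge_quadratic[of "x / 2"] by linarith
  have "x / 3 * (2 / 3) \<le> sin (x / 2) * cos (x / 2)" using 1 2 assms by (intro mult_mono) auto
  moreover have "sin x = 2 * (sin (x / 2) * cos (x / 2))" using sin_double[of "x / 2"] by simp
  ultimately show ?thesis using assms by linarith
qed

text \<open>Closeness to 1 forces c \<ge> 8/9 and |x| \<le> pi/2, so |Im z| = c |sin x| \<ge> 16/45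
  |x|. This exceeds |x| / 19 unless x = 0.\<close>

lemma near_one_argument_zero:
  fixes z :: complex
  assumes z: "z = of_real c * cis x" "0 < c" and x: "\<bar>x\<bar> \<le> pi"
    and near: "cmod (z - 1) \<le> 1 / 9" "cmod (z - 1) \<le> \<bar>x\<bar> / 19"
  shows "x = 0"
proof (rule ccontr)
  assume "x \<noteq> 0"
  have "\<bar>Re (z - 1)\<bar> \<le> 1 / 9" using abs_Re_le_cmod[of "z - 1"] near(1) by linarith
  moreover have "Re (z - 1) = c * cos x - 1" by (simp add: z(1))
  ultimately have re: "8 / 9 \<le> c * cos x" by linarith
  have "c * cos x \<le> c * 1" using z(2) by (intro mult_left_mono) auto
  then have c: "8 / 9 \<le> c" using re by simp
  have "0 < cos x" using re z(2) by (metis less_le_trans zero_less_divide_iff zero_less_mult_pos zero_less_numeral)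
  then have cx: "0 < cos \<bar>x\<bar>" by simp
  have x2: "\<bar>x\<bar> \<le> pi / 2"
  proof (rule ccontr)
    assume "\<not> \<bar>x\<bar> \<le> pi / 2"
    then have "cos \<bar>x\<bar> \<le> cos (pi / 2)" using x by (intro cos_monotone_0_pi_le) auto
    with cx show False by simp
  qed
  have "2 / 5 * \<bar>x\<bar> \<le> sin \<bar>x\<bar>" using x2 by (intro sin_ge_fraction) auto
  also have "\<dots> \<le> \<bar>sin x\<bar>" by (auto simp: abs_if)
  finally have "8 / 9 * (2 / 5 * \<bar>x\<bar>) \<le> c * \<bar>sin x\<bar>" using c by (intro mult_mono) auto
  also have "\<dots> = \<bar>Im (z - 1)\<bar>" using z(2) by (simp add: z(1) abs_mult)
  also have "\<dots> \<le> \<bar>x\<bar> / 19" using abs_Im_le_cmod[of "z - 1"] near(2) by linarith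
  finally show False using \<open>x \<noteq> 0\<close> by simp
qed

text \<open>Equal directions give F s' / F s the argument s' - s, but the Lipschitz bound keeps this
  quotient within |s' - s| / 19 of 1. For opposite directions the argument is s' - s shifted by pi,
  and the comparison of F s with F s' goes round through the identified ends 0 and pi, whose length
  pi - |s' - s| is just the modulus of that argument.\<close>

lemma direction_injective:
  fixes F :: "real \<Rightarrow> complex"
  assumes one: "\<And>s. s \<in> {0..pi} \<Longrightarrow> cmod (F s - 1) \<le> 1 / 20"
    and lip: "\<And>s s'. s \<in> {0..pi} \<Longrightarrow> s' \<in> {0..pi} \<Longrightarrow> cmod (F s - F s') \<le> \<bar>s - s'\<bar> / 20"
    and per: "F pi = F 0" and s: "s \<in> {0..pi}" "s' \<in> {0..pi}" and c: "0 < c"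
  shows "cis (- s') * F s' = of_real c * (cis (- s) * F s) \<Longrightarrow> s' = s"
    and "cis (- s') * F s' = - (of_real c * (cis (- s) * F s)) \<Longrightarrow> s = 0 \<and> s' = pi \<or> s = pi \<and> s' = 0"
proof -
  have ge: "19 / 20 \<le> cmod (F s)"
    using norm_triangle_ineq2[of 1 "F s"] one[OF s(1)] by (simp add: norm_minus_commute)
  then have nz: "F s \<noteq> 0" by auto
  \<comment> \<open>From |F s| \<ge> 19/20: the quotients are (1/10) / (19/20) = 2/19 \<le> 1/9 and
    (d/20) / (19/20) = d/19.\<close>
  have near: "cmod (F s' / F s - 1) \<le> 1 / 9" "cmod (F s' / F s - 1) \<le> d / 19" if d: "cmod (F s' - F s) \<le> d / 20" for d
  proof -
    have "0 \<le> d" using d norm_ge_zero[of "F s' - F s"] by linarith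
    have eq: "cmod (F s' / F s - 1) = cmod (F s' - F s) / cmod (F s)"
      using nz by (simp add: diff_divide_distrib flip: norm_divide)
    have "cmod (F s' - F s) \<le> 1 / 10"
      using norm_triangle_ineq4[of "F s' - 1" "F s - 1"] one[OF s(1)] one[OF s(2)] by simp
    then have "cmod (F s' - F s) / cmod (F s) \<le> (1 / 10) / (19 / 20)" using ge by (intro frac_le) auto
    then show "cmod (F s' / F s - 1) \<le> 1 / 9" unfolding eq by simp
    have "cmod (F s' - F s) / cmod (F s) \<le> (d / 20) / (19 / 20)" using d ge \<open>0 \<le> d\<close> by (intro frac_le) auto
    then show "cmod (F s' / F s - 1) \<le> d / 19" unfolding eq by simp
  qed
  {
    assume eq: "cis (- s') * F s' = of_real c * (cis (- s) * F s)"
    have "F s' = cis s' * (cis (- s') * F s')" by (simp add: cis_mult flip: mult.assoc)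
    also have "\<dots> = of_real c * (cis s' * cis (- s)) * F s" unfolding eq by (simp add: mult_ac)
    also have "\<dots> = of_real c * cis (s' - s) * F s" by (simp add: cis_mult)
    finally have "F s' = of_real c * cis (s' - s) * F s" .
    then have "F s' / F s = of_real c * cis (s' - s)" using nz by simp
    moreover have "cmod (F s' - F s) \<le> \<bar>s' - s\<bar> / 20" by (rule lip[OF s(2,1)])
    ultimately have "s' - s = 0" using s c near[of "\<bar>s' - s\<bar>"] by (intro near_one_argument_zero[of "F s' / F s" c]) auto
    then show "s' = s" by simp
  }
  {
    assume eq: "cis (- s') * F s' = - (of_real c * (cis (- s) * F s))"
    have "F s' = cis s' * (cis (- s') * F s')" by (simp add: cis_mult flip: mult.assoc)
    also have "\<dots> = - of_real c * (cis s' * cis (- s)) * F s" unfolding eq by (simp add: mult_ac)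
    also have "\<dots> = - of_real c * cis (s' - s) * F s" by (simp add: cis_mult)
    finally have F: "F s' = - of_real c * cis (s' - s) * F s" .
    have z: "0 \<in> {0..pi}" "pi \<in> {0..pi}" by auto
    show "s = 0 \<and> s' = pi \<or> s = pi \<and> s' = 0"
    proof (cases "s \<le> s'")
      case True
      have "cis (s' - s - pi) = - cis (s' - s)" by (simp add: complex_eq_iff cos_diff sin_diff)
      then have "F s' / F s = of_real c * cis (s' - s - pi)" using F nz by simp
      moreover have "cmod (F s' - F s) \<le> \<bar>s' - s - pi\<bar> / 20"
      proof -
        have "F s' - F s = (F s' - F pi) + (F 0 - F s)" by (simp add: per)
        then have "cmod (F s' - F s) \<le> \<bar>s' - pi\<bar> / 20 + \<bar>0 - s\<bar> / 20"
          using norm_triangle_mono[OF lip[OF s(2) z(2)] lip[OF z(1) s(1)]] by simp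
        then show ?thesis using s True by (auto simp: field_simps)
      qed
      ultimately have "s' - s - pi = 0"
        using s c True near[of "\<bar>s' - s - pi\<bar>"] by (intro near_one_argument_zero[of "F s' / F s" c]) auto
      then show ?thesis using s by auto
    next
      case False
      have "cis (s' - s + pi) = - cis (s' - s)" by (simp add: complex_eq_iff cos_add sin_add cos_diff sin_diff)
      then have "F s' / F s = of_real c * cis (s' - s + pi)" using F nz by simp
      moreover have "cmod (F s' - F s) \<le> \<bar>s' - s + pi\<bar> / 20"
      proof -
        have "F s' - F s = (F s' - F 0) + (F pi - F s)" by (simp add: per)
        then have "cmod (F s' - F s) \<le> \<bar>s' - 0\<bar> / 20 + \<bar>pi - s\<bar> / 20"
          using norm_triangle_mono[OF lip[OF s(2) z(1)] lip[OF z(2) s(1)]] by simp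
        then show ?thesis using s False by (auto simp: field_simps)
      qed
      ultimately have "s' - s + pi = 0"
        using s c False near[of "\<bar>s' - s + pi\<bar>"] by (intro near_one_argument_zero[of "F s' / F s" c]) auto
      then show ?thesis using s by auto
    qed
  }
qed

context bang
begin

text \<open>The delay of the interior arcs is at most 8 \<alpha> (pi - s), because
  \<open>gap s\<close> carries the factor sin s \<le> pi - s. So it fits into the remaining time pi
  - s even for s near pi, and one number of arcs serves for all s.\<close>

lemma final_time_in_arc:
  assumes "\<alpha> < 1 / 100" "s \<in> {0..pi}"
  shows "(real (turns \<alpha>) + 1) * pi \<in> {switch s (turns \<alpha>)..switch s (Suc (turns \<alpha>))}"
proof -
  let ?n = "real (turns \<alpha>)"
  have s: "0 \<le> s" "s \<le> pi" using assms by auto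
  have sp: "sin s \<le> pi - s" using sin_x_le_x[of "pi - s"] s by simp
  have "sin \<alpha> \<le> \<alpha>" using sin_x_le_x \<alpha> by auto
  then have a2: "(sin \<alpha>)\<^sup>2 \<le> \<alpha>\<^sup>2" using sin_pos by (intro power_mono) auto
  have "\<alpha>\<^sup>2 \<le> (1 / 2)\<^sup>2" using \<alpha> assms by (intro power_mono) auto
  then have "(sin \<alpha>)\<^sup>2 \<le> 1 / 4" using a2 by (simp add: power2_eq_square)
  moreover have "(sin \<alpha>)\<^sup>2 * (- 1) \<le> (sin \<alpha>)\<^sup>2 * cos s" by (intro mult_left_mono) auto
  ultimately have D: "1 / 2 \<le> (cos \<alpha>)\<^sup>2 + (sin \<alpha>)\<^sup>2 * cos s" by (simp add: cos_squared_eq)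
  have "(sin \<alpha>)\<^sup>2 * sin s \<le> \<alpha>\<^sup>2 * (pi - s)"
    using a2 sp s by (intro mult_mono) (auto intro: sin_ge_zero)
  then have "gap s \<le> \<alpha>\<^sup>2 * (pi - s) / (1 / 2)"
    unfolding gap_def using D s by (intro frac_le) auto
  then have "arctan (gap s) \<le> 2 * \<alpha>\<^sup>2 * (pi - s)"
    using arctan_diff_le[of "gap s" 0] gap_nonneg[OF assms(2)] by simp
  then have "?n * (2 * arctan (gap s)) \<le> ?n * (2 * (2 * \<alpha>\<^sup>2 * (pi - s)))"
    by (intro mult_left_mono) auto
  also have "\<dots> = (?n * \<alpha>) * (4 * \<alpha> * (pi - s))" by (simp add: power2_eq_square)
  also have "\<dots> \<le> 2 * (4 * \<alpha> * (pi - s))"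
    using turns_bounds(4)[of \<alpha>] \<alpha> assms s by (intro mult_right_mono) auto
  also have "\<dots> = (8 * \<alpha>) * (pi - s)" by simp
  also have "\<dots> \<le> 1 * (pi - s)" using assms s by (intro mult_right_mono) auto
  finally have "?n * (2 * arctan (gap s)) \<le> pi - s" by simp
  moreover have "(?n + 1) * pi \<le> (?n + 1) * period s"
    using period_ge[OF assms(2)] by (intro mult_left_mono) auto
  ultimately show ?thesis using s
    by (simp add: switch_def period_def algebra_simps)
qed

definition planar :: "real^3 \<Rightarrow> complex" where
  "planar x = Complex (x $ 1) (x $ 2)"

lemma planar_simps:
  "planar (hopf A B) = 2 * (cnj A * B)" "planar (mirror x) = - planar x" "planar ((mirror ^^ n) x) = (- 1) ^ n * planar x"
proof -
  show "planar (hopf A B) = 2 * (cnj A * B)" by (simp add: planar_def complex_eq_iff)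
  show m: "planar (mirror x) = - planar x" for x by (simp add: planar_def complex_eq_iff)
  show "planar ((mirror ^^ n) x) = (- 1) ^ n * planar x" by (induction n) (simp_all add: m)
qed

lemma planar_sign:
  assumes "e = 1 \<or> e = (- 1 :: real)"
  shows "planar ((if e = 1 then id else mirror) x) = of_real e * planar x"
  using assms by (auto simp: planar_simps(2))

text \<open>Follows from \<open>wave_zero_eq\<close>, since the mirror changes the sign of the
  control. In the planar picture this is F pi = F 0.\<close>

lemma wave_end_identified:
  assumes "sol (wave pi) z" "z 0 = N_pole" "sol (wave 0) z'" "z' 0 = N_pole"
  shows "rotx (sin \<alpha> * wave 0 T) (z' T) = mirror (rotx (sin \<alpha> * wave pi T) (z T))"
proof -
  have "sol (\<lambda>t. - wave pi t) (\<lambda>t. mirror (z t))" by (rule sol_mirror[OF assms(1)])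
  then have "sol (wave 0) (\<lambda>t. mirror (z t))" by (simp add: wave_zero_eq[symmetric])
  moreover have "mirror (z 0) = z' 0" by (simp add: assms eq3_iff)
  ultimately have "mirror (z T) = z' T" by (rule sol_unique[OF _ assms(3)])
  then show ?thesis by (simp add: mirror_rotx wave_zero_eq)
qed

text \<open>In the plane an endpoint is a common nonzero factor times e^(- i s) F(s), up to the sign
  of the first control. Equal directions thus mean the same s and the same sign, or s = 0 and s = pi
  with opposite signs, which is one point. The pole is excluded because F does not vanish.\<close>

lemma front_star_shaped:
  fixes F :: "real \<Rightarrow> complex"
  assumes arc: "\<And>s. s \<in> {0..pi} \<Longrightarrow> T \<in> {switch s n..switch s (Suc n)}"
    and F: "\<And>s. s \<in> {0..pi} \<Longrightarrow> cnj (endA s n (T - switch s n)) * endB s n (T - switch s n) = of_real \<kappa> * (cis (- s) * F s)"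
    and \<kappa>: "0 < \<kappa>" and one: "\<And>s. s \<in> {0..pi} \<Longrightarrow> cmod (F s - 1) \<le> 1 / 20"
    and lip: "\<And>s s'. s \<in> {0..pi} \<Longrightarrow> s' \<in> {0..pi} \<Longrightarrow> cmod (F s - F s') \<le> \<bar>s - s'\<bar> / 20"
  shows "x \<in> front T \<Longrightarrow> x' \<in> front T \<Longrightarrow> 0 < c \<Longrightarrow> x' $ 1 = c * x $ 1 \<Longrightarrow> x' $ 2 = c * x $ 2 \<Longrightarrow> x' = x"
    and "N_pole \<notin> front T"
proof -
  let ?K = "(- 1) ^ Suc n * (2 * of_real \<kappa>) :: complex"
  have K: "?K \<noteq> 0" using \<kappa> by simp
  have pl: "planar (rotx (sin \<alpha> * wave s T) (z T)) = ?K * (cis (- s) * F s)"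
    if "s \<in> {0..pi}" "sol (wave s) z" "z 0 = N_pole" for s z
    unfolding wave_traj_hopf[OF that(2,3,1) arc[OF that(1)]] planar_simps F[OF that(1)] by simp
  have zpi: "0 \<in> {0..pi}" "pi \<in> {0..pi}" by auto
  have per: "F pi = F 0"
  proof -
    obtain z where z: "sol (wave pi) z" "z 0 = N_pole"
      using sol_exists[OF lip1_continuous[OF wave_lip1[OF zpi(2)]]] by blast
    obtain z' where z': "sol (wave 0) z'" "z' 0 = N_pole"
      using sol_exists[OF lip1_continuous[OF wave_lip1[OF zpi(1)]]] by blast
    have "?K * (cis (- 0) * F 0) = - (?K * (cis (- pi) * F pi))"
      using arg_cong[OF wave_end_identified[OF z z', of T], of planar]
      unfolding planar_simps pl[OF zpi(1) z'] pl[OF zpi(2) z] .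
    moreover have "cis (- pi) = - 1" by (simp add: complex_eq_iff)
    ultimately show ?thesis using K by simp
  qed
  have same: "s' = s"
    if "s \<in> {0..pi}" "s' \<in> {0..pi}" "0 < c" "cis (- s') * F s' = of_real c * (cis (- s) * F s)" for s s' c
    by (rule direction_injective(1)[OF _ _ per that]; (rule one lip; assumption))
  have opposite: "s = 0 \<and> s' = pi \<or> s = pi \<and> s' = 0"
    if "s \<in> {0..pi}" "s' \<in> {0..pi}" "0 < c" "cis (- s') * F s' = - (of_real c * (cis (- s) * F s))" for s s' c
    by (rule direction_injective(2)[OF _ _ per that]; (rule one lip; assumption))
  show "x' = x" if "x \<in> front T" "x' \<in> front T" and c: "0 < c" "x' $ 1 = c * x $ 1" "x' $ 2 = c * x $ 2"
  proof -
    obtain e s z where e: "e = 1 \<or> e = (- 1 :: real)" and s: "s \<in> {0..pi}" and z: "sol (wave s) z" "z 0 = N_pole"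
      and x: "x = (if e = 1 then id else mirror) (rotx (sin \<alpha> * wave s T) (z T))"
      using \<open>x \<in> front T\<close> by (rule front_wave)
    obtain e' s' z' where e': "e' = 1 \<or> e' = (- 1 :: real)" and s': "s' \<in> {0..pi}" and z': "sol (wave s') z'" "z' 0 = N_pole"
      and x': "x' = (if e' = 1 then id else mirror) (rotx (sin \<alpha> * wave s' T) (z' T))"
      using \<open>x' \<in> front T\<close> by (rule front_wave)
    have px: "planar x = of_real e * (?K * (cis (- s) * F s))" "planar x' = of_real e' * (?K * (cis (- s') * F s'))"
      unfolding x x' planar_sign[OF e] planar_sign[OF e'] pl[OF s z] pl[OF s' z'] by (rule refl)+
    have e0: "complex_of_real e \<noteq> 0" using e by auto
    have pc: "planar x' = of_real c * planar x" using c by (simp add: planar_def complex_eq_iff)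
    show ?thesis
    proof (cases "e = e'")
      case True
      have "of_real e * (?K * (cis (- s') * F s')) = of_real e * (?K * (of_real c * (cis (- s) * F s)))"
        using pc unfolding px True by (simp only: mult.left_commute)
      then have "cis (- s') * F s' = of_real c * (cis (- s) * F s)" using K e0 by (simp only: mult_cancel_left simp_thms)
      then have "s' = s" by (rule same[OF s s' c(1)])
      then have "z' T = z T" using sol_unique[OF z'(1), of z 0 T] z z' by simp
      then show ?thesis by (simp add: x x' True \<open>s' = s\<close>)
    next
      case False
      then have e'e: "e' = - e" using e e' by auto
      have "of_real e * (?K * (cis (- s') * F s')) = of_real e * (?K * (- (of_real c * (cis (- s) * F s))))"
      proof -
        have "- (of_real e * (?K * (cis (- s') * F s'))) = of_real c * (of_real e * (?K * (cis (- s) * F s)))"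
          using pc unfolding px e'e by (simp only: of_real_minus mult_minus_left)
        also have "\<dots> = of_real e * (?K * (of_real c * (cis (- s) * F s)))" by (simp only: mult.left_commute)
        finally have "- (of_real e * (?K * (cis (- s') * F s'))) = of_real e * (?K * (of_real c * (cis (- s) * F s)))" .
        from arg_cong[OF this, of uminus] show ?thesis by (simp only: minus_minus mult_minus_right)
      qed
      then have "cis (- s') * F s' = - (of_real c * (cis (- s) * F s))" using K e0 by (simp only: mult_cancel_left simp_thms)
      then consider "s = 0" "s' = pi" | "s = pi" "s' = 0" using opposite[OF s s' c(1)] by blast
      then show ?thesis
      proof cases
        case 1
        then show ?thesis using wave_end_identified[of z' z T] z z' e e' e'e by (auto simp: x x')
      next
        case 2
        then show ?thesis using wave_end_identified[of z z' T] z z' e e' e'e by (auto simp: x x')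
      qed
    qed
  qed
  show "N_pole \<notin> front T"
  proof
    assume "N_pole \<in> front T"
    then obtain e s z where e: "e = 1 \<or> e = (- 1 :: real)" and s: "s \<in> {0..pi}" and z: "sol (wave s) z" "z 0 = N_pole"
      and x: "N_pole = (if e = 1 then id else mirror) (rotx (sin \<alpha> * wave s T) (z T))"
      by (rule front_wave)
    have "planar N_pole = of_real e * (?K * (cis (- s) * F s))"
      using arg_cong[OF x, of planar] unfolding planar_sign[OF e] pl[OF s z] .
    moreover have "planar N_pole = 0" by (simp add: planar_def complex_eq_iff)
    moreover have "F s \<noteq> 0" using one[OF s] by auto
    ultimately show False using K e by auto
  qed
qed

end

theorem mainTheorem5:
  shows "\<exists>\<alpha>0::real. 0 < \<alpha>0 \<and> \<alpha>0 \<le> pi / 4 \<and>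
           (\<forall>\<alpha>\<in>{0<..<\<alpha>0}.
              extremal_front \<alpha> (real_of_int (k_M \<alpha> - 1) * pi)
                = optimal_front \<alpha> (real_of_int (k_M \<alpha> - 1) * pi))"
proof -
  define t where "t \<alpha> s = pi - s - real (turns \<alpha>) * (2 * arctan (bang.gap \<alpha> s))" for \<alpha> s
  define \<kappa> where "\<kappa> \<alpha> = pi / 2 - real (turns \<alpha>) * \<alpha> - \<alpha>" for \<alpha>
  define F where "F \<alpha> s = cnj (bang.endA \<alpha> s (turns \<alpha>) (t \<alpha> s)) * bang.endB \<alpha> s (turns \<alpha>) (t \<alpha> s) * cis s / of_real (\<kappa> \<alpha>)" for \<alpha> s
  have "LO 1 (\<lambda>\<alpha> s. F \<alpha> s - 1)"
    unfolding F_def t_def \<kappa>_def by (rule front_asymptotics)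
  then obtain C where C: "0 \<le> C" "\<forall>\<^sub>F \<alpha> in at_right 0. 0 < \<alpha> \<and> \<alpha> < 1 \<and> (\<forall>s\<in>{0..pi}. norm (F \<alpha> s - 1) \<le> C * \<alpha> ^ 1 \<and>
     (\<forall>s'\<in>{0..pi}. norm (F \<alpha> s - 1 - (F \<alpha> s' - 1)) \<le> C * \<alpha> ^ 1 * \<bar>s - s'\<bar>))"
    by (rule LO_E)
  then obtain a where a: "0 < a" "\<And>\<alpha>. 0 < \<alpha> \<Longrightarrow> \<alpha> < a \<Longrightarrow> (\<forall>s\<in>{0..pi}. cmod (F \<alpha> s - 1) \<le> C * \<alpha> \<and>
     (\<forall>s'\<in>{0..pi}. cmod (F \<alpha> s - F \<alpha> s') \<le> C * \<alpha> * \<bar>s - s'\<bar>))"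
    unfolding eventually_at_right_field by auto
  \<comment> \<open>1/100 serves \<open>south_pole_notin_front\<close> and
    \<open>final_time_in_arc\<close>; the last bound gives C \<alpha> \<le> 1/20, the constant of
    \<open>direction_injective\<close>.\<close>
  define \<alpha>0 where "\<alpha>0 = min (min a (1 / 100)) (1 / (20 * (C + 1)))"
  have "0 < \<alpha>0" using a C by (simp add: \<alpha>0_def)
  moreover have "\<alpha>0 \<le> pi / 4" using pi_gt3 by (simp add: \<alpha>0_def min_def)
  moreover have "extremal_front \<alpha> (real_of_int (k_M \<alpha> - 1) * pi) = optimal_front \<alpha> (real_of_int (k_M \<alpha> - 1) * pi)"
    if "\<alpha> \<in> {0<..<\<alpha>0}" for \<alpha>
  proof -
    have small: "0 < \<alpha>" "\<alpha> < a" "\<alpha> < 1 / 100" "\<alpha> < 1 / (20 * (C + 1))" using that by (auto simp: \<alpha>0_def)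
    interpret bang \<alpha> using small pi_gt3 by unfold_locales auto
    have "C * \<alpha> \<le> (C + 1) * (1 / (20 * (C + 1)))" using small C by (intro mult_mono) auto
    also have "\<dots> = 1 / 20" using C by simp
    finally have Ca: "C * \<alpha> \<le> 1 / 20" .
    define n where "n = turns \<alpha>"
    define T where "T = real_of_int (k_M \<alpha> - 1) * pi"
    have T: "T = (real n + 1) * pi" unfolding T_def n_def using turns_bounds(1)[of \<alpha>] small by simp
    have "0 \<le> T" by (simp add: T)
    have \<kappa>: "0 < \<kappa> \<alpha>" using turns_bounds(2)[of \<alpha>] small by (simp add: \<kappa>_def)
    have arc: "T \<in> {switch s n..switch s (Suc n)}" if "s \<in> {0..pi}" for s
      unfolding T n_def by (rule final_time_in_arc[OF small(3) that])
    have F_eq: "cnj (endA s n (T - switch s n)) * endB s n (T - switch s n) = of_real (\<kappa> \<alpha>) * (cis (- s) * F \<alpha> s)" for s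
    proof -
      have "T - switch s n = t \<alpha> s" by (simp add: T switch_def period_def t_def n_def algebra_simps)
      moreover have "cis (- s) * cis s = 1" by (simp add: cis_mult)
      ultimately show ?thesis using \<kappa> by (simp add: F_def n_def field_simps)
    qed
    have F1: "cmod (F \<alpha> s - 1) \<le> 1 / 20" if "s \<in> {0..pi}" for s
      using a(2)[OF small(1,2)] that Ca by fastforce
    have F2: "cmod (F \<alpha> s - F \<alpha> s') \<le> \<bar>s - s'\<bar> / 20" if "s \<in> {0..pi}" "s' \<in> {0..pi}" for s s'
    proof -
      have "cmod (F \<alpha> s - F \<alpha> s') \<le> C * \<alpha> * \<bar>s - s'\<bar>" using a(2)[OF small(1,2)] that by blast
      also have "\<dots> \<le> 1 / 20 * \<bar>s - s'\<bar>" using Ca by (intro mult_right_mono) auto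
      finally show ?thesis by simp
    qed
    have star: "x' = x" if "x \<in> front T" "x' \<in> front T" "0 < c" "x' $ 1 = c * x $ 1" "x' $ 2 = c * x $ 2" for x x' c
      by (rule front_star_shaped(1)[OF arc F_eq \<kappa> F1 F2 that])
    have N: "N_pole \<notin> front T"
      by (rule front_star_shaped(2)[OF arc F_eq \<kappa> F1 F2])
    \<comment> \<open>If it were reachable by time T, the south pole would lie on the front of its
      first reaching time; hence fronts of all times up to T are covered by
      \<open>south_pole_notin_front\<close>.\<close>
    have S: "- N_pole \<notin> reach T"
    proof
      assume "- N_pole \<in> reach T"
      then obtain t0 where "0 \<le> t0" "t0 \<le> T" "- N_pole \<in> front t0"
        using reach_first_time[OF _ \<open>0 \<le> T\<close>] by metis
      then show False using south_pole_notin_front[OF small(3), of t0] by (simp add: T_def)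
    qed
    have "extremal_front \<alpha> T = optimal_front \<alpha> T"
      by (rule extremal_front_eq_optimal_front[OF \<open>0 \<le> T\<close>], rule star_shaped_front_optimal[OF \<open>0 \<le> T\<close> S star N])
    then show ?thesis by (simp add: T_def)
  qed
  ultimately show ?thesis by blast
qed

end
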